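(* Let $W:\mathcal{X}\to\mathcal{P}(\mathcal{Y})$ be a channel, $M,L,n\in\mathbb{Z}_+$, and $P\in\mathcal{P}(\mathcal{X})$ a finitely supported distribution with $nP(x)\in\mathbb{Z}_{\ge0}$ for all $x$, such that $$I_1(P;W)<\tfrac1n\ln\tfrac ML<\lim_{\alpha\uparrow\infty} I_1\big(P;W_\alpha^{q_{\alpha,P}}\big).$$ Let $R=\frac1n\ln\frac ML$ and $\alpha^*=\frac{1}{1-E_{sc}'(R,W,P)}$, where $E_{sc}'$ is the derivative of $E_{sc}(\cdot,W,P)$ with respect to the rate. Then $\alpha^*\in(1,\infty)$ and $I_1\big(P;W_{\alpha^*}^{q_{\alpha^*,P}}\big)=R$. Moreover, every $(M,L)$ list code of block length $n$ on the stationary product channel $W^{\otimes n}$ whose codewords all have composition $P$ has average error probability satisfying $$P_e^{(n)}\ge 1-2e^{\alpha^*}\Big(\frac{\hat\delta}{\alpha^*-1}\Big)^{1/\alpha^*} n^{-\frac{1}{2\alpha^*}}e^{-nE_{sc}(R,W,P)},$$ where, writing $q=q_{\alpha^*,P}$, $V(x)=W_{\alpha^*}^{q}(x)$ and $\ell_x=\ln\frac{dW(x)_{ac}}{dq}$ (with $W(x)_{ac}$ the part of $W(x)$ absolutely continuous w.r.t. $q$), $$a_2=\sum_x P(x)\,\mathbb{E}_{V(x)}\big[|\ell_x-\mathbb{E}_{V(x)}[\ell_x]|^2\big],\quad a_3=\sum_x P(x)\,\mathbb{E}_{V(x)}\big[|\ell_x-\mathbb{E}_{V(x)}[\ell_x]|^3\big],\quad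 \hat\delta=\frac{1}{e\sqrt{a_2}}\Big(\frac{1}{\sqrt{2\pi}}+2\frac{0.56\,a_3}{a_2}\Big)$$ (assuming $a_2>0$).
   Context: A channel is a map $W:\mathcal{X}\to\mathcal{P}(\mathcal{Y})$ into probability measures on a measurable space $(\mathcal{Y},\mathcal{B})$; $\mathcal{P}(\mathcal{X})$ denotes finitely supported probability mass functions on $\mathcal{X}$. Rényi divergence: $D_\alpha(W\|Q)=\frac{1}{\alpha-1}\ln\int (\frac{dW}{d\nu})^\alpha(\frac{dQ}{d\nu})^{1-\alpha}d\nu$ ($\alpha\ne1$), $D_1(W\|Q)=\int \frac{dW}{d\nu}[\ln\frac{dW}{d\nu}-\ln\frac{dQ}{d\nu}]d\nu$. Conditional Rényi divergence: $D_\alpha(W\|Q|P)=\sum_x P(x)D_\alpha(W(x)\|Q)$. Augustin information: $I_\alpha(P;W)=\inf_{Q}D_\alpha(W\|Q|P)$ over probability measures $Q$ on $\mathcal{Y}$; the infimum is attained by a unique measure $q_{\alpha,P}$, the Augustin mean. Tilted measures: for probability measures $W,Q$, with $W_{ac}$ the part of $W$ absolutely continuous w.r.t. $Q$, $W_1^Q=W_{ac}/\|W_{ac}\|$, and for $\alpha>0$ with $D_\alpha(W_1^Q\|Q)<\infty$, $\frac{dW_\alpha^Q}{dQ}=e^{(1-\alpha)D_\alpha(W_1^Q\|Q)}(\frac{dW_1^Q}{dQ})^\alpha$. The tilted channel $W_\alpha^{q_{\alpha,P}}$ maps $x$ to the order-$\alpha$ tilted measure between $W(x)$ and $q_{\alpha,P}$;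 $I_1(P;V)$ for a channel $V$ is the order-1 Augustin information (mutual information). Strong converse exponent: $E_{sc}(R,W,P)=\sup_{\alpha\in(1,\infty)}\frac{1-\alpha}{\alpha}(I_\alpha(P;W)-R)$. An $(M,L)$ code of length $n$ consists of an encoder $\Psi:\{1,\dots,M\}\to\mathcal{X}^n$ and a measurable decoder $\Theta$ from $\mathcal{Y}^n$ to subsets of $\{1,\dots,M\}$ of size at most $L$; $P_e^{(n)}=\frac1M\sum_m W^{\otimes n}(\Psi(m))(\{y: m\notin\Theta(y)\})$, where $W^{\otimes n}(x_1^n)=\bigotimes_t W(x_t)$. A codeword $x_1^n$ has composition $P$ if its empirical distribution equals $P$. *)

theory Defs
  imports "HOL-Probability.Probability"
begin

text \<open>For two probability measures P, Q on the same measurable space we use the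
  reference measure nu = (P + Q)/2 (written as a Giry-monad mixture), which dominates
  both. Densities are taken with respect to nu.\<close>

definition ref_meas :: "'b measure \<Rightarrow> 'b measure \<Rightarrow> 'b measure" where
  "ref_meas P Q = measure_pmf (bernoulli_pmf (1/2)) \<bind> (\<lambda>b. if b then P else Q)"

definition dens1 :: "'b measure \<Rightarrow> 'b measure \<Rightarrow> 'b \<Rightarrow> real" where
  "dens1 P Q y = enn2real (RN_deriv (ref_meas P Q) P y)"

definition dens2 :: "'b measure \<Rightarrow> 'b measure \<Rightarrow> 'b \<Rightarrow> real" where
  "dens2 P Q y = enn2real (RN_deriv (ref_meas P Q) Q y)"

definition renyi_integrand :: "real \<Rightarrow> real \<Rightarrow> real \<Rightarrow> ennreal" where
  "renyi_integrand \<alpha> p q =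
     (if q = 0 then (if p = 0 then 0 else if \<alpha> > 1 then \<infinity> else 0)
      else ennreal (p powr \<alpha> * q powr (1 - \<alpha>)))"

definition renyi_div :: "real \<Rightarrow> 'b measure \<Rightarrow> 'b measure \<Rightarrow> ereal" where
  "renyi_div \<alpha> P Q =
    (let \<nu> = ref_meas P Q; p = dens1 P Q; q = dens2 P Q in
     if \<alpha> = 1 then
       (if emeasure \<nu> {y \<in> space \<nu>. q y = 0 \<and> p y > 0} \<noteq> 0 then \<infinity>
        else if integrable \<nu> (\<lambda>y. p y * (ln (p y) - ln (q y)))
        then ereal (\<integral>y. p y * (ln (p y) - ln (q y)) \<partial>\<nu>)
        else \<infinity>)
     else
       (let I = (\<integral>\<^sup>+ y. renyi_integrand \<alpha> (p y) (q y) \<partial>\<nu>) in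
        if I = 0 \<or> I = \<infinity> then \<infinity> else ereal (ln (enn2real I) / (\<alpha> - 1))))"

definition cond_renyi :: "real \<Rightarrow> ('a \<Rightarrow> 'b measure) \<Rightarrow> 'b measure \<Rightarrow> 'a pmf \<Rightarrow> ereal" where
  "cond_renyi \<alpha> W Q P = (\<Sum>x\<in>set_pmf P. ereal (pmf P x) * renyi_div \<alpha> (W x) Q)"

definition prob_measures :: "'b measure \<Rightarrow> 'b measure set" where
  "prob_measures Y = {Q. prob_space Q \<and> sets Q = sets Y}"

definition augustin_info :: "'b measure \<Rightarrow> ('a \<Rightarrow> 'b measure) \<Rightarrow> 'a pmf \<Rightarrow> real \<Rightarrow> ereal" where
  "augustin_info Y W P \<alpha> = (INF Q\<in>prob_measures Y. cond_renyi \<alpha> W Q P)"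

definition augustin_mean :: "'b measure \<Rightarrow> ('a \<Rightarrow> 'b measure) \<Rightarrow> 'a pmf \<Rightarrow> real \<Rightarrow> 'b measure" where
  "augustin_mean Y W P \<alpha> =
     (THE Q. Q \<in> prob_measures Y \<and> cond_renyi \<alpha> W Q P = augustin_info Y W P \<alpha>)"

text \<open>A version of dW_ac/dQ, W_ac being the part of W absolutely continuous w.r.t. Q.\<close>
definition ac_dens :: "'b measure \<Rightarrow> 'b measure \<Rightarrow> 'b \<Rightarrow> real" where
  "ac_dens W Q y = (if dens2 W Q y > 0 then dens1 W Q y / dens2 W Q y else 0)"

definition tilt1_dens :: "'b measure \<Rightarrow> 'b measure \<Rightarrow> 'b \<Rightarrow> real" where
  "tilt1_dens W Q y = ac_dens W Q y / (\<integral>z. ac_dens W Q z \<partial>Q)"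

definition tilt1 :: "'b measure \<Rightarrow> 'b measure \<Rightarrow> 'b measure" where
  "tilt1 W Q = density Q (\<lambda>y. ennreal (tilt1_dens W Q y))"

definition tilted :: "real \<Rightarrow> 'b measure \<Rightarrow> 'b measure \<Rightarrow> 'b measure" where
  "tilted \<alpha> W Q = density Q (\<lambda>y. ennreal
      (exp ((1 - \<alpha>) * real_of_ereal (renyi_div \<alpha> (tilt1 W Q) Q)) * tilt1_dens W Q y powr \<alpha>))"

definition tilted_channel :: "'b measure \<Rightarrow> ('a \<Rightarrow> 'b measure) \<Rightarrow> 'a pmf \<Rightarrow> real \<Rightarrow> 'a \<Rightarrow> 'b measure" where
  "tilted_channel Y W P \<alpha> = (\<lambda>x. tilted \<alpha> (W x) (augustin_mean Y W P \<alpha>))"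

definition E_sc :: "'b measure \<Rightarrow> ('a \<Rightarrow> 'b measure) \<Rightarrow> 'a pmf \<Rightarrow> real \<Rightarrow> real" where
  "E_sc Y W P R = (SUP \<alpha>\<in>{1<..}. (1 - \<alpha>) / \<alpha> * (real_of_ereal (augustin_info Y W P \<alpha>) - R))"

definition is_channel :: "'b measure \<Rightarrow> ('a \<Rightarrow> 'b measure) \<Rightarrow> bool" where
  "is_channel Y W \<longleftrightarrow> (\<forall>x. prob_space (W x) \<and> sets (W x) = sets Y)"

definition prod_channel :: "('a \<Rightarrow> 'b measure) \<Rightarrow> nat \<Rightarrow> (nat \<Rightarrow> 'a) \<Rightarrow> (nat \<Rightarrow> 'b) measure" where
  "prod_channel W n x = (\<Pi>\<^sub>M t\<in>{..<n}. W (x t))"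

text \<open>An (M,L) list code of length n: encoder Psi (message m in {1..M} is mapped to
  the codeword t \<mapsto> Psi m t, t < n) and measurable list decoder Theta.\<close>
definition is_list_code :: "'b measure \<Rightarrow> nat \<Rightarrow> nat \<Rightarrow> nat \<Rightarrow>
    (nat \<Rightarrow> nat \<Rightarrow> 'a) \<Rightarrow> ((nat \<Rightarrow> 'b) \<Rightarrow> nat set) \<Rightarrow> bool" where
  "is_list_code Y n M L \<Psi> \<Theta> \<longleftrightarrow>
     (\<forall>y\<in>space (\<Pi>\<^sub>M t\<in>{..<n}. Y). \<Theta> y \<subseteq> {1..M} \<and> card (\<Theta> y) \<le> L) \<and>
     (\<forall>m\<in>{1..M}. {y\<in>space (\<Pi>\<^sub>M t\<in>{..<n}. Y). m \<in> \<Theta> y} \<in> sets (\<Pi>\<^sub>M t\<in>{..<n}. Y))"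

definition error_prob :: "('a \<Rightarrow> 'b measure) \<Rightarrow> nat \<Rightarrow> nat \<Rightarrow>
    (nat \<Rightarrow> nat \<Rightarrow> 'a) \<Rightarrow> ((nat \<Rightarrow> 'b) \<Rightarrow> nat set) \<Rightarrow> real" where
  "error_prob W n M \<Psi> \<Theta> = (1 / real M) * (\<Sum>m=1..M.
     measure (prod_channel W n (\<Psi> m)) {y\<in>space (prod_channel W n (\<Psi> m)). m \<notin> \<Theta> y})"

definition has_composition :: "nat \<Rightarrow> 'a pmf \<Rightarrow> (nat \<Rightarrow> 'a) \<Rightarrow> bool" where
  "has_composition n P x \<longleftrightarrow> (\<forall>a. real (card {t\<in>{..<n}. x t = a}) = real n * pmf P a)"

definition llr :: "'b measure \<Rightarrow> ('a \<Rightarrow> 'b measure) \<Rightarrow> 'a pmf \<Rightarrow> real \<Rightarrow> 'a \<Rightarrow> 'b \<Rightarrow> real" where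
  "llr Y W P \<alpha> x y = ln (ac_dens (W x) (augustin_mean Y W P \<alpha>) y)"

definition abs_moment :: "'b measure \<Rightarrow> ('a \<Rightarrow> 'b measure) \<Rightarrow> 'a pmf \<Rightarrow> real \<Rightarrow> nat \<Rightarrow> ennreal" where
  "abs_moment Y W P \<alpha> k = (\<Sum>x\<in>set_pmf P. ennreal (pmf P x) *
     (\<integral>\<^sup>+ y. ennreal (\<bar>llr Y W P \<alpha> x y - (\<integral>z. llr Y W P \<alpha> x z \<partial>tilted_channel Y W P \<alpha> x)\<bar> ^ k)
        \<partial>tilted_channel Y W P \<alpha> x))"

end

theory Submission
  imports Defs
begin

text \<open>A probability measure q that is the average of the outputs tilted towards it exists, because the
  problem dual to the definition of Augustin information is a convex minimisation over one real weight per
  input letter. Jensen's inequality under the tilted measures, with \<open>ln u \<le> u - 1\<close>, gives for every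
  output distribution and every order \<open>\<alpha>' > 1\<close> a lower bound on the conditional Renyi divergence that is
  affine in \<open>\<alpha>'\<close> after multiplication by \<open>\<alpha>' - 1\<close>. At \<open>\<alpha>' = \<alpha>\<close> it shows that q is the unique Augustin
  mean. For \<open>\<alpha>' \<noteq> \<alpha>\<close> it shows that \<open>J \<alpha> = (\<alpha> - 1) I\<^sub>\<alpha>\<close> is strictly convex with slope the tilted mean of the
  log-likelihood ratio, unless tilting does not change the channel. The mutual information of the tilted
  channel is \<open>\<alpha> J' - J\<close>, so it increases and takes the value R exactly once; the exponent is a supremum of
  affine functions of the rate, and its derivative is the slope of the active one.

  For codes, \<open>\<Sum> Q\<^sup>n(A\<^sub>m) \<le> L\<close> bounds the success probability once the event that the log-likelihood ratio
  exceeds a threshold \<open>\<tau>\<close> is removed. Tilting turns the probability of that event into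
  \<open>exp (n J) E[exp (- (\<alpha> - 1) S); S > \<tau>]\<close> for a sum S of independent variables. Smoothing with a Fejer kernel bounds
  this through the characteristic function near 0, which takes the place of the Berry-Esseen theorem and is
  within the constant 0.56.\<close>

section \<open>Exponential tails of independent sums\<close>

text \<open>Limits under the integral are replaced by inequalities. \<open>J\<close> has at
  \<open>\<alpha>\<close> a supporting line from below, and from above a parabola obtained by
  inserting the mean of order \<open>\<alpha>\<close> as test measure at order
  \<open>\<alpha> + h\<close>; the two squeeze out the derivative without any statement on how the
  mean varies with the order. The minimum of the dual problem is likewise characterised by an
  explicit one-variable comparison, and the value R is reached by the Darboux property of a
  derivative instead of continuity of the tilted information. The finite support of the input
  supplies uniformity: nonnegative densities with weighted average 1 are bounded, so their powers,
  also multiplied by logarithms, are integrable. A competitor Q may have a part singular to q; as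
  each letter's output is dominated by q, only the absolutely continuous part of Q enters the
  divergence. The constant of the theorem, solved backwards for the tail, dominates (1.864 / \<mu> +
  18.3 \<rho>) / sqrt (2 pi), with \<rho> the ratio of third moments to variances, and this leaves
  room for a crude smoothing bound.\<close>

definition fejer :: "real \<Rightarrow> real \<Rightarrow> real" where
  "fejer T s = (if s = 0 then T\<^sup>2 / 2 else (1 - cos (T * s)) / s\<^sup>2)"

lemma fejer_measurable [measurable]: "fejer T \<in> borel_measurable borel"
  unfolding fejer_def by measurable

lemma fejer_nonneg: "0 \<le> fejer T s"
  by (simp add: fejer_def)

text \<open>The Fourier transform of the kernel is the triangle \<open>T - t\<close> on
  \<open>{0..T}\<close>, so an expectation of the kernel sees the characteristic function only up to
  frequency T. The value chosen at s = 0 is the limit there and makes the identity hold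
  everywhere.\<close>

lemma fejer_eq_integral:
  assumes "0 \<le> T"
  shows "(\<integral>t. ((T - t) * cos (t * s)) * indicator {0..T} t \<partial>lborel) = fejer T s"
proof (cases "s = 0")
  case True
  have "(\<integral>t. (T - t) * indicator {0..T} t \<partial>lborel) = (T * T - T\<^sup>2 / 2) - (T * 0 - 0\<^sup>2 / 2)"
    by (rule integral_FTC_Icc_real[OF assms]) (auto intro!: derivative_eq_intros)
  then show ?thesis
    using True by (simp add: fejer_def power2_eq_square)
next
  case False
  have "(\<integral>t. ((T - t) * cos (t * s)) * indicator {0..T} t \<partial>lborel)
      = ((T - T) * sin (T * s) / s - cos (T * s) / s\<^sup>2) - ((T - 0) * sin (0 * s) / s - cos (0 * s) / s\<^sup>2)"
    using False
    by (intro integral_FTC_Icc_real[OF assms])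
      (auto intro!: derivative_eq_intros continuous_intros simp: field_simps power2_eq_square)
  then show ?thesis
    using False by (simp add: fejer_def diff_divide_distrib)
qed

lemma one_minus_half_square_le_cos: "1 - y\<^sup>2 / 2 \<le> cos (y :: real)"
proof -
  have "(sin (y / 2))\<^sup>2 \<le> (y / 2)\<^sup>2"
    using abs_sin_x_le_abs_x[of "y / 2"] by (rule abs_le_square_iff[THEN iffD1])
  moreover have "cos y = 1 - 2 * (sin (y / 2))\<^sup>2"
    using cos_double_sin[of "y / 2"] by simp
  ultimately show ?thesis by (simp add: power_divide)
qed

lemma sin_ge_cubic:
  fixes x :: real
  assumes "0 \<le> x"
  shows "x - x ^ 3 / 6 \<le> sin x"
proof -
  have "(\<lambda>x. sin x - (x - x ^ 3 / 6)) 0 \<le> (\<lambda>x. sin x - (x - x ^ 3 / 6)) x"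
  proof (rule DERIV_nonneg_imp_nondecreasing[OF assms])
    fix y :: real
    show "\<exists>d. ((\<lambda>x. sin x - (x - x ^ 3 / 6)) has_real_derivative d) (at y) \<and> 0 \<le> d"
      using one_minus_half_square_le_cos[of y]
      by (intro exI[of _ "cos y - (1 - y\<^sup>2 / 2)"]) (auto intro!: derivative_eq_intros)
  qed
  then show ?thesis by simp
qed

text \<open>By the half-angle formula \<open>1 - cos (T * s)\<close> is twice the square of
  \<open>sin v\<close> with \<open>v = \<bar>T * s\<bar> / 2\<close>, and the cubic lower bound of
  the sine is squared. The bound 24 keeps that cubic nonnegative, as squaring requires.\<close>

lemma fejer_ge:
  assumes "0 \<le> T" "(T * s)\<^sup>2 \<le> 24"
  shows "T\<^sup>2 / 2 * (1 - (T * s)\<^sup>2 / 24)\<^sup>2 \<le> fejer T s"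
proof (cases "s = 0")
  case True
  then show ?thesis by (simp add: fejer_def)
next
  case False
  define v where "v = \<bar>T * s\<bar> / 2"
  have v: "0 \<le> v" by (simp add: v_def)
  have v2: "v\<^sup>2 = (T * s)\<^sup>2 / 4" by (simp add: v_def power_divide)
  have "0 \<le> v * (1 - v\<^sup>2 / 6)"
    using assms v by (intro mult_nonneg_nonneg) (auto simp: v2)
  then have "(v * (1 - v\<^sup>2 / 6))\<^sup>2 \<le> (sin v)\<^sup>2"
    using sin_ge_cubic[OF v] by (intro power_mono) (auto simp: algebra_simps power2_eq_square power3_eq_cube)
  moreover have "1 - cos (T * s) = 2 * (sin v)\<^sup>2"
  proof -
    have "cos (T * s) = cos (2 * v)" by (simp add: v_def)
    then show ?thesis using cos_double_sin[of v] by simp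
  qed
  ultimately have "2 * (v * (1 - v\<^sup>2 / 6))\<^sup>2 \<le> 1 - cos (T * s)" by simp
  then have "2 * v\<^sup>2 * (1 - v\<^sup>2 / 6)\<^sup>2 \<le> 1 - cos (T * s)" by (simp add: power_mult_distrib)
  then have "T\<^sup>2 / 2 * (1 - (T * s)\<^sup>2 / 24)\<^sup>2 * s\<^sup>2 \<le> 1 - cos (T * s)"
    by (simp add: v2 power_mult_distrib mult_ac)
  then show ?thesis
    using False by (simp add: fejer_def pos_le_divide_eq)
qed

lemma gaussian_half_line:
  assumes k: "0 < k"
  shows "has_bochner_integral lborel (\<lambda>x. indicator {0..} x *\<^sub>R exp (- (sqrt k * x)\<^sup>2)) ((sqrt pi / 2) / sqrt k)"
proof -
  have "has_bochner_integral lborel (\<lambda>x. indicator {0..} (0 + sqrt k * x) *\<^sub>R exp (- (0 + sqrt k * x)\<^sup>2)) ((sqrt pi / 2) /\<^sub>R \<bar>sqrt k\<bar>)"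
      using lborel_has_bochner_integral_real_affine_iff[of "sqrt k" "\<lambda>x. indicator {0..} x *\<^sub>R exp (- x\<^sup>2)" "sqrt pi / 2" 0]
        gaussian_moment_0 k by simp
  moreover have "indicator {0..} (sqrt k * x) = (indicator {0..} x :: real)" for x
      using k by (auto simp: zero_le_mult_iff split: split_indicator)
  ultimately show ?thesis
    using k by (simp add: field_simps)
qed

text \<open>After exchanging expectation and frequency integral, the cosine moment is at most the
  modulus of the characteristic function, uniformly in the shift u. Then \<open>T - t\<close> is
  bounded by T and the Gaussian is extended from \<open>{0..T}\<close> to the half-line.\<close>

lemma (in prob_space) expectation_fejer_le:
  assumes S [measurable]: "S \<in> borel_measurable M"
    and T: "0 < T" and k: "0 < k"
    and char: "\<And>t. 0 \<le> t \<Longrightarrow> t \<le> T \<Longrightarrow> cmod (\<integral>\<omega>. iexp (t * S \<omega>) \<partial>M) \<le> exp (- k * t\<^sup>2)"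
  shows "(\<integral>\<^sup>+\<omega>. ennreal (fejer T (S \<omega> - u)) \<partial>M) \<le> ennreal (T * (sqrt (pi / k) / 2))"
proof -
  interpret pair_sigma_finite M lborel ..
  define h where "h = (\<lambda>(\<omega>, t). ((T - t) * cos (t * (S \<omega> - u))) * indicator {0..T} t)"
  have hm [measurable]: "h \<in> borel_measurable (M \<Otimes>\<^sub>M lborel)"
    unfolding h_def by measurable
  have int: "integrable (M \<Otimes>\<^sub>M lborel) h"
  proof (rule integrableI_bounded_set[where A = "space M \<times> {0..T}" and B = T])
    show "emeasure (M \<Otimes>\<^sub>M lborel) (space M \<times> {0..T}) < \<infinity>"
      using T by (subst lborel.emeasure_pair_measure_Times) (auto simp: emeasure_space_1)
    show "AE x in M \<Otimes>\<^sub>M lborel. x \<in> space M \<times> {0..T} \<longrightarrow> norm (h x) \<le> T"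
    proof (intro AE_I2 impI)
      fix x assume "x \<in> space M \<times> {0..T}"
      then obtain \<omega> t where x: "x = (\<omega>, t)" "0 \<le> t" "t \<le> T" by auto
      have "\<bar>T - t\<bar> * \<bar>cos (t * (S \<omega> - u))\<bar> \<le> T * 1"
        using x by (intro mult_mono) auto
      then show "norm (h x) \<le> T" using x by (simp add: h_def abs_mult)
    qed
    show "AE x in M \<Otimes>\<^sub>M lborel. x \<notin> space M \<times> {0..T} \<longrightarrow> h x = 0"
      by (intro AE_I2) (auto simp: h_def space_pair_measure indicator_def split: if_splits)
  qed simp_all
  have bnd: "\<bar>fejer T s\<bar> \<le> T * T" for s
  proof -
    have "\<bar>fejer T s\<bar> = \<bar>\<integral>t. ((T - t) * cos (t * s)) * indicator {0..T} t \<partial>lborel\<bar>"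
      using fejer_eq_integral[of T s] T by simp
    also have "\<dots> \<le> (\<integral>t. \<bar>((T - t) * cos (t * s)) * indicator {0..T} t\<bar> \<partial>lborel)"
      by (rule integral_abs_bound)
    also have "\<dots> \<le> (\<integral>t. T * indicator {0..T} t \<partial>lborel)"
    proof (rule integral_mono)
      fix t
      have "\<bar>T - t\<bar> * \<bar>cos (t * s)\<bar> \<le> T * 1" if "0 \<le> t" "t \<le> T"
        using that by (intro mult_mono) auto
      then show "\<bar>(T - t) * cos (t * s) * indicator {0..T} t\<bar> \<le> T * indicator {0..T} t"
        by (auto simp: abs_mult split: split_indicator)
    next
      show "integrable lborel (\<lambda>t. \<bar>(T - t) * cos (t * s) * indicator {0..T} t\<bar>)"
        by (intro integrable_abs borel_integrable_atLeastAtMost) auto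
      show "integrable lborel (\<lambda>t. T * indicator {0..T} t)"
        by (rule borel_integrable_atLeastAtMost) auto
    qed
    also have "\<dots> = T * T" using T by simp
    finally show ?thesis .
  qed
  have "(\<integral>\<omega>. fejer T (S \<omega> - u) \<partial>M) = (\<integral>\<omega>. \<integral>t. h (\<omega>, t) \<partial>lborel \<partial>M)"
    using T by (simp add: h_def fejer_eq_integral)
  also have "\<dots> = (\<integral>t. \<integral>\<omega>. h (\<omega>, t) \<partial>M \<partial>lborel)"
    using Fubini_integral[of "\<lambda>\<omega> t. h (\<omega>, t)"] int by simp
  also have "\<dots> \<le> (\<integral>t. T * (indicator {0..} t *\<^sub>R exp (- (sqrt k * t)\<^sup>2)) \<partial>lborel)"
  proof (rule integral_mono)
    show "integrable lborel (\<lambda>t. \<integral>\<omega>. h (\<omega>, t) \<partial>M)"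
      using integrable_snd[of "\<lambda>\<omega> t. h (\<omega>, t)"] int by simp
    note hb = gaussian_half_line[OF k]
    from hb show "integrable lborel (\<lambda>t. T * (indicator {0..} t *\<^sub>R exp (- (sqrt k * t)\<^sup>2)))"
      by (auto simp: has_bochner_integral_iff)
    show "(\<integral>\<omega>. h (\<omega>, t) \<partial>M) \<le> T * (indicator {0..} t *\<^sub>R exp (- (sqrt k * t)\<^sup>2))" for t
    proof (cases "t \<in> {0..T}")
      case True
      have ii: "integrable M (\<lambda>\<omega>. iexp (t * S \<omega>))"
        by (intro integrable_const_bound[of _ 1]) auto
      have "(\<integral>\<omega>. cos (t * (S \<omega> - u)) \<partial>M) = (\<integral>\<omega>. Re (iexp (- t * u) * iexp (t * S \<omega>)) \<partial>M)"
        by (intro Bochner_Integration.integral_cong)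
          (auto simp: exp_add[symmetric] Re_exp algebra_simps)
      also have "\<dots> = Re (\<integral>\<omega>. iexp (- t * u) * iexp (t * S \<omega>) \<partial>M)"
        by (rule integral_Re) (intro integrable_mult_right ii)
      also have "\<dots> = Re (iexp (- t * u) * (\<integral>\<omega>. iexp (t * S \<omega>) \<partial>M))"
        by (subst integral_mult_right_zero) simp
      also have "\<dots> \<le> cmod (iexp (- t * u) * (\<integral>\<omega>. iexp (t * S \<omega>) \<partial>M))"
        by (rule complex_Re_le_cmod)
      also have "\<dots> \<le> exp (- k * t\<^sup>2)"
        using char[of t] True by (simp add: norm_mult)
      finally have "(\<integral>\<omega>. cos (t * (S \<omega> - u)) \<partial>M) \<le> exp (- k * t\<^sup>2)" .
      then have "(T - t) * (\<integral>\<omega>. cos (t * (S \<omega> - u)) \<partial>M) \<le> T * exp (- k * t\<^sup>2)"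
        using True by (meson atLeastAtMost_iff diff_ge_0_iff_ge diff_le_eq le_add_same_cancel1 mult_left_mono mult_right_mono order_trans exp_ge_zero)
      then show ?thesis using True k by (simp add: h_def power_mult_distrib)
    next
      case False
      then show ?thesis using T by (auto simp: h_def)
    qed
  qed
  also have "\<dots> = T * (sqrt (pi / k) / 2)"
  proof -
    note hb = gaussian_half_line[OF k]
    from hb show ?thesis
      by (simp add: has_bochner_integral_iff real_sqrt_divide)
  qed
  finally have "(\<integral>\<omega>. fejer T (S \<omega> - u) \<partial>M) \<le> T * (sqrt (pi / k) / 2)" .
  moreover have "integrable M (\<lambda>\<omega>. fejer T (S \<omega> - u))"
    using bnd by (intro integrable_const_bound[of _ "T * T"]) auto
  ultimately show ?thesis
    by (subst nn_integral_eq_integral) (auto simp: fejer_nonneg intro!: ennreal_leI)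
qed

lemma DERIV_sextic:
  fixes c1 c2 c3 c4 c5 c6 s :: real
  shows "((\<lambda>s. c1 * s + c2 * s ^ 2 + c3 * s ^ 3 + c4 * s ^ 4 + c5 * s ^ 5 + c6 * s ^ 6) has_real_derivative
    (c1 + 2 * c2 * s + 3 * c3 * s ^ 2 + 4 * c4 * s ^ 3 + 5 * c5 * s ^ 4 + 6 * c6 * s ^ 5)) (at s)"
  by (auto intro!: derivative_eq_intros)

text \<open>The exponential is bounded below by its tangent \<open>1 + \<mu> * s\<close>, whose odd
  part integrates to zero over the symmetric window. What remains is the integral of the squared
  polynomial from \<open>fejer_ge\<close>, so the bound is free of \<open>\<mu>\<close>.\<close>

lemma exp_fejer_window:
  assumes T: "0 < T" and z: "0 < z" "(T * z)\<^sup>2 \<le> 24"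
  shows "ennreal (T\<^sup>2 * (z - T\<^sup>2 * z ^ 3 / 36 + T ^ 4 * z ^ 5 / 2880))
    \<le> (\<integral>\<^sup>+s. ennreal (exp (\<mu> * s) * fejer T s * indicator {-z..z} s) \<partial>lborel)"
proof -
  define g where "g s = (1 + \<mu> * s) * (T\<^sup>2 / 2 * (1 - (T * s)\<^sup>2 / 24)\<^sup>2)" for s
  define h where "h s = exp (\<mu> * s) * (T\<^sup>2 / 2 * (1 - (T * s)\<^sup>2 / 24)\<^sup>2)" for s
  \<comment> \<open>A primitive of \<open>g\<close>, multiplied by 34560 = 60 * 24^2 so that all
    numerical coefficients are integers.\<close>
  define F where "F s = 17280 * T\<^sup>2 * s + 8640 * \<mu> * T\<^sup>2 * s\<^sup>2 + (- 480 * T ^ 4) * s ^ 3 + (- 360 * \<mu> * T ^ 4) * s ^ 4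
    + 6 * T ^ 6 * s ^ 5 + 5 * \<mu> * T ^ 6 * s ^ 6" for s
  have "(\<integral>s. g s * indicator {-z..z} s \<partial>lborel) = F z / 34560 - F (- z) / 34560"
  proof (rule integral_FTC_Icc_real)
    fix s
    have eq: "17280 * T\<^sup>2 + 2 * (8640 * \<mu> * T\<^sup>2) * s + 3 * (- 480 * T ^ 4) * s\<^sup>2 + 4 * (- 360 * \<mu> * T ^ 4) * s ^ 3
        + 5 * (6 * T ^ 6) * s ^ 4 + 6 * (5 * \<mu> * T ^ 6) * s ^ 5 = 30 * T\<^sup>2 * (1 + \<mu> * s) * (24 - (T * s)\<^sup>2)\<^sup>2"
      by (simp add: algebra_simps eval_nat_numeral)
    have "(F has_real_derivative (30 * T\<^sup>2 * (1 + \<mu> * s) * (24 - (T * s)\<^sup>2)\<^sup>2)) (at s)"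
      unfolding F_def eq[symmetric] by (rule DERIV_sextic)
    then have D: "((\<lambda>s. F s / 34560) has_real_derivative (30 * T\<^sup>2 * (1 + \<mu> * s) * (24 - (T * s)\<^sup>2)\<^sup>2) / 34560) (at s)"
      by (rule DERIV_cdivide)
    have A: "T\<^sup>2 / 2 * (1 - (T * s)\<^sup>2 / 24)\<^sup>2 = 30 * T\<^sup>2 * (24 - (T * s)\<^sup>2)\<^sup>2 / 34560"
      by (simp add: field_simps power2_eq_square)
    have "(30 * T\<^sup>2 * (1 + \<mu> * s) * (24 - (T * s)\<^sup>2)\<^sup>2) / 34560 = g s"
      unfolding g_def A by simp
    with D show "((\<lambda>s. F s / 34560) has_real_derivative g s) (at s)" by simp
    show "isCont g s"
      unfolding g_def by (intro continuous_intros) simp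
  qed (use z in auto)
  also have "\<dots> = T\<^sup>2 * (z - T\<^sup>2 * z ^ 3 / 36 + T ^ 4 * z ^ 5 / 2880)"
    unfolding F_def by (simp add: field_simps power_add[symmetric])
  finally have "T\<^sup>2 * (z - T\<^sup>2 * z ^ 3 / 36 + T ^ 4 * z ^ 5 / 2880) = (\<integral>s. g s * indicator {-z..z} s \<partial>lborel)" ..
  also have "\<dots> \<le> (\<integral>s. h s * indicator {-z..z} s \<partial>lborel)"
  proof (rule integral_mono)
    show "integrable lborel (\<lambda>s. g s * indicator {-z..z} s)"
      unfolding g_def by (rule borel_integrable_atLeastAtMost) auto
    show "integrable lborel (\<lambda>s. h s * indicator {-z..z} s)"
      unfolding h_def by (rule borel_integrable_atLeastAtMost) auto
    show "g s * indicator {-z..z} s \<le> h s * indicator {-z..z} s" for s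
      unfolding g_def h_def by (intro mult_right_mono exp_ge_add_one_self) auto
  qed
  finally have "ennreal (T\<^sup>2 * (z - T\<^sup>2 * z ^ 3 / 36 + T ^ 4 * z ^ 5 / 2880))
      \<le> ennreal (\<integral>s. h s * indicator {-z..z} s \<partial>lborel)" by (rule ennreal_leI)
  also have "\<dots> = (\<integral>\<^sup>+s. ennreal (h s * indicator {-z..z} s) \<partial>lborel)"
    unfolding h_def
    by (intro nn_integral_eq_integral[symmetric] borel_integrable_atLeastAtMost) (auto split: split_indicator)
  also have "\<dots> \<le> (\<integral>\<^sup>+s. ennreal (exp (\<mu> * s) * fejer T s * indicator {-z..z} s) \<partial>lborel)"
  proof (intro nn_integral_mono ennreal_leI)
    fix s
    show "h s * indicator {-z..z} s \<le> exp (\<mu> * s) * fejer T s * indicator {-z..z} s"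
    proof (cases "s \<in> {-z..z}")
      case True
      then have "s\<^sup>2 \<le> z\<^sup>2" by (auto intro!: abs_le_square_iff[THEN iffD1])
      then have "(T * s)\<^sup>2 \<le> (T * z)\<^sup>2" by (simp add: power_mult_distrib mult_left_mono)
      then have "(T * s)\<^sup>2 \<le> 24" using z by linarith
      then show ?thesis using fejer_ge[of T s] T by (auto simp: h_def split: split_indicator)
    qed simp
  qed
  finally show ?thesis .
qed

text \<open>Convolving with the Fejer kernel replaces the density of S, which need not exist, by
  its characteristic function on [0,T].\<close>
lemma (in prob_space) exp_tail_le:
  assumes S [measurable]: "S \<in> borel_measurable M"
    and T: "0 < T" and k: "0 < k" and \<mu>: "0 < \<mu>" and w: "0 < w" "w\<^sup>2 \<le> 24"
    and char: "\<And>t. 0 \<le> t \<Longrightarrow> t \<le> T \<Longrightarrow> cmod (\<integral>\<omega>. iexp (t * S \<omega>) \<partial>M) \<le> exp (- k * t\<^sup>2)"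
  shows "(\<integral>\<^sup>+\<omega>. ennreal (exp (- \<mu> * (S \<omega> - \<tau>)) * indicator {\<tau><..} (S \<omega>)) \<partial>M)
    \<le> ennreal (exp (\<mu> * w / T) * (sqrt (pi / k) / 2) / (\<mu> * (w - w ^ 3 / 36 + w ^ 5 / 2880)))"
proof -
  \<comment> \<open>The half-width z is w in units of 1 / T; the mass of the kernel in the window is
    then T times a quantity p depending on w alone.\<close>
  define z where "z = w / T"
  define p where "p = w - w ^ 3 / 36 + w ^ 5 / 2880"
  define I where "I = (\<integral>\<^sup>+\<omega>. ennreal (exp (- \<mu> * (S \<omega> - \<tau>)) * indicator {\<tau><..} (S \<omega>)) \<partial>M)"
  define A where "A = sqrt (pi / k) / 2"
  have z: "0 < z" "T * z = w" using w T by (auto simp: z_def)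
  have A: "0 \<le> A" using k by (simp add: A_def)
  \<comment> \<open>Positivity of p, so that it can be cancelled at the end.\<close>
  have "w\<^sup>2 / 36 \<le> 24 / 36" using w by (intro divide_right_mono) auto
  then have "0 < w * (1 - w\<^sup>2 / 36)" using w by (intro mult_pos_pos) linarith+
  moreover have "p = w * (1 - w\<^sup>2 / 36) + w ^ 5 / 2880"
    by (simp add: p_def algebra_simps power2_eq_square power3_eq_cube)
  ultimately have p: "0 < p" using w by (simp add: add_pos_nonneg)
  have Tp: "T\<^sup>2 * (z - T\<^sup>2 * z ^ 3 / 36 + T ^ 4 * z ^ 5 / 2880) = T * p"
    unfolding p_def z(2)[symmetric] by (simp add: field_simps power_mult_distrib) (simp add: eval_nat_numeral)
  have "ennreal (T * p) * I = (\<integral>\<^sup>+\<omega>. ennreal (T * p) * ennreal (exp (- \<mu> * (S \<omega> - \<tau>)) * indicator {\<tau><..} (S \<omega>)) \<partial>M)"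
    unfolding I_def by (subst nn_integral_cmult) auto
  \<comment> \<open>An outcome with S above \<tau> is averaged over the shifts u within z of S.
    These lie above \<open>\<tau> - z\<close>, and this overshoot is the origin of the factor
    \<open>exp (\<mu> * w / T)\<close>.\<close>
  also have "\<dots> \<le> (\<integral>\<^sup>+\<omega>. (\<integral>\<^sup>+u. ennreal (exp (- \<mu> * (u - \<tau>)) * fejer T (S \<omega> - u) * indicator {\<tau> - z..} u) \<partial>lborel) \<partial>M)"
  proof (rule nn_integral_mono)
    fix \<omega>
    show "ennreal (T * p) * ennreal (exp (- \<mu> * (S \<omega> - \<tau>)) * indicator {\<tau><..} (S \<omega>))
      \<le> (\<integral>\<^sup>+u. ennreal (exp (- \<mu> * (u - \<tau>)) * fejer T (S \<omega> - u) * indicator {\<tau> - z..} u) \<partial>lborel)"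
    proof (cases "\<tau> < S \<omega>")
      case True
      define c where "c = exp (- \<mu> * (S \<omega> - \<tau>))"
      have "ennreal (T * p) * ennreal c \<le> (\<integral>\<^sup>+s. ennreal (exp (\<mu> * s) * fejer T s * indicator {-z..z} s) \<partial>lborel) * ennreal c"
        using exp_fejer_window[OF T z(1), of \<mu>] w z(2) by (intro mult_right_mono) (auto simp: Tp)
      also have "\<dots> = (\<integral>\<^sup>+s. ennreal (exp (\<mu> * s) * fejer T s * indicator {-z..z} s) * ennreal c \<partial>lborel)"
        by (subst nn_integral_multc) auto
      also have "\<dots> \<le> (\<integral>\<^sup>+s. ennreal (exp (- \<mu> * (S \<omega> - s - \<tau>)) * fejer T s * indicator {\<tau> - z..} (S \<omega> - s)) \<partial>lborel)"
        using True
        by (intro nn_integral_mono)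
          (auto simp: c_def ennreal_mult'[symmetric] exp_add[symmetric] fejer_nonneg algebra_simps
            intro!: ennreal_leI split: split_indicator)
      also have "\<dots> = (\<integral>\<^sup>+u. ennreal (exp (- \<mu> * (u - \<tau>)) * fejer T (S \<omega> - u) * indicator {\<tau> - z..} u) \<partial>lborel)"
        by (subst nn_integral_real_affine[where c = "-1" and t = "S \<omega>"]) auto
      finally show ?thesis using True by (simp add: c_def)
    qed simp
  qed
  also have "\<dots> = (\<integral>\<^sup>+u. (\<integral>\<^sup>+\<omega>. ennreal (exp (- \<mu> * (u - \<tau>)) * fejer T (S \<omega> - u) * indicator {\<tau> - z..} u) \<partial>M) \<partial>lborel)"
  proof -
    interpret pair_sigma_finite lborel M ..
    show ?thesis by (rule Fubini') simp
  qed
  also have "\<dots> = (\<integral>\<^sup>+u. ennreal (exp (- \<mu> * (u - \<tau>)) * indicator {\<tau> - z..} u) * (\<integral>\<^sup>+\<omega>. ennreal (fejer T (S \<omega> - u)) \<partial>M) \<partial>lborel)"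
    by (intro nn_integral_cong, subst nn_integral_cmult[symmetric])
      (auto simp: ennreal_mult'[symmetric] fejer_nonneg mult_ac intro!: nn_integral_cong)
  also have "\<dots> \<le> (\<integral>\<^sup>+u. ennreal (exp (- \<mu> * (u - \<tau>)) * indicator {\<tau> - z..} u) * ennreal (T * A) \<partial>lborel)"
    unfolding A_def by (intro nn_integral_mono mult_left_mono expectation_fejer_le S T k char) auto
  also have "\<dots> = (\<integral>\<^sup>+u. ennreal (exp (- \<mu> * (u - \<tau>))) * indicator {\<tau> - z..} u \<partial>lborel) * ennreal (T * A)"
    by (subst nn_integral_multc) (auto simp: ennreal_mult' ennreal_indicator)
  also have "(\<integral>\<^sup>+u. ennreal (exp (- \<mu> * (u - \<tau>))) * indicator {\<tau> - z..} u \<partial>lborel) = ennreal (0 - (- exp (- \<mu> * ((\<tau> - z) - \<tau>)) / \<mu>))"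
  proof (rule nn_integral_FTC_atLeast[where F = "\<lambda>u. - exp (- \<mu> * (u - \<tau>)) / \<mu>"])
    show "((\<lambda>u. - exp (- \<mu> * (u - \<tau>)) / \<mu>) has_real_derivative exp (- \<mu> * (u - \<tau>))) (at u)" for u
      using \<mu> by (auto intro!: derivative_eq_intros)
    have "((\<lambda>u. exp (- \<mu> * (u - \<tau>))) \<longlongrightarrow> 0) at_top"
    proof (rule filterlim_compose[OF exp_at_bot])
      have "LIM u at_top. - \<mu> * (- \<tau> + u) :> at_bot"
        using \<mu> by (intro filterlim_tendsto_neg_mult_at_bot[OF tendsto_const]
            filterlim_tendsto_add_at_top[OF tendsto_const] filterlim_ident) auto
      then show "LIM u at_top. - \<mu> * (u - \<tau>) :> at_bot" by simp
    qed
    from tendsto_mult_right[OF this, of "- 1 / \<mu>"]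
    show "((\<lambda>u. - exp (- \<mu> * (u - \<tau>)) / \<mu>) \<longlongrightarrow> 0) at_top" by simp
  qed auto
  also have "\<dots> * ennreal (T * A) = ennreal (T * p) * ennreal (exp (\<mu> * z) * A / (\<mu> * p))"
    using \<mu> T A p by (subst (1 2) ennreal_mult'[symmetric]) (auto simp: field_simps)
  finally have "ennreal (T * p) * I \<le> ennreal (T * p) * ennreal (exp (\<mu> * z) * A / (\<mu> * p))" .
  then have "I \<le> ennreal (exp (\<mu> * z) * A / (\<mu> * p))"
    using T p by (subst (asm) ennreal_mult_le_mult_iff) auto
  then show ?thesis by (simp add: I_def A_def p_def z_def)
qed

section \<open>Characteristic functions of independent summands\<close>

lemma (in prob_space) moment3_ge:
  assumes X: "integrable M (\<lambda>x. \<bar>X x\<bar> ^ 3)" "integrable M (\<lambda>x. (X x)\<^sup>2 :: real)"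
  shows "sqrt (expectation (\<lambda>x. (X x)\<^sup>2)) ^ 3 \<le> expectation (\<lambda>x. \<bar>X x\<bar> ^ 3)"
proof -
  define s where "s = sqrt (expectation (\<lambda>x. (X x)\<^sup>2))"
  have s: "0 \<le> s" "s\<^sup>2 = expectation (\<lambda>x. (X x)\<^sup>2)" by (auto simp: s_def)
  \<comment> \<open>The tangent of \<open>z powr (3 / 2)\<close> at \<open>z = s^2\<close>, read at
    \<open>z = y^2\<close>. Integrating it gives Lyapunov's inequality.\<close>
  have "3 / 2 * s * y\<^sup>2 - s ^ 3 / 2 \<le> y ^ 3" if "0 \<le> y" for y
  proof -
    have "0 \<le> (y - s)\<^sup>2 * (2 * y + s)" using that s by simp
    then show ?thesis by (simp add: algebra_simps power2_eq_square power3_eq_cube)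
  qed
  from this[of "\<bar>y\<bar>" for y] have "3 / 2 * s * (X x)\<^sup>2 - s ^ 3 / 2 \<le> \<bar>X x\<bar> ^ 3" for x by auto
  then have "expectation (\<lambda>x. 3 / 2 * s * (X x)\<^sup>2 - s ^ 3 / 2) \<le> expectation (\<lambda>x. \<bar>X x\<bar> ^ 3)"
    using X by (intro integral_mono) auto
  also have "expectation (\<lambda>x. 3 / 2 * s * (X x)\<^sup>2 - s ^ 3 / 2) = 3 / 2 * s * s\<^sup>2 - s ^ 3 / 2"
    using X by (simp add: s(2) prob_space)
  finally have "s ^ 3 \<le> expectation (\<lambda>x. \<bar>X x\<bar> ^ 3)" by (simp add: power2_eq_square power3_eq_cube)
  then show ?thesis unfolding s_def .
qed

lemma (in prob_space) integrable_moments_le3: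
  assumes [measurable]: "X \<in> borel_measurable M" and X: "integrable M (\<lambda>x. \<bar>X x\<bar> ^ 3 :: real)"
  shows "integrable M X" "integrable M (\<lambda>x. (X x)\<^sup>2)"
proof -
  have b: "\<bar>y\<bar> \<le> 1 + \<bar>y\<bar> ^ 3" "y\<^sup>2 \<le> 1 + \<bar>y\<bar> ^ 3" for y :: real
  proof -
    show "\<bar>y\<bar> \<le> 1 + \<bar>y\<bar> ^ 3"
      using power_increasing[of 1 3 "\<bar>y\<bar>"] by (cases "\<bar>y\<bar> \<le> 1") (auto intro: order_trans)
    show "y\<^sup>2 \<le> 1 + \<bar>y\<bar> ^ 3"
      using power_increasing[of 2 3 "\<bar>y\<bar>"] power_le_one[of "\<bar>y\<bar>" 2]
      by (cases "\<bar>y\<bar> \<le> 1") (auto intro: order_trans)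
  qed
  have i: "integrable M (\<lambda>x. 1 + \<bar>X x\<bar> ^ 3)" using X by simp
  show "integrable M X" by (rule Bochner_Integration.integrable_bound[OF i]) (use b in auto)
  show "integrable M (\<lambda>x. (X x)\<^sup>2)" by (rule Bochner_Integration.integrable_bound[OF i]) (use b in auto)
qed

lemma (in prob_space) integrable_iexp:
  assumes [measurable]: "X \<in> borel_measurable M"
  shows "integrable M (\<lambda>x. iexp (t * X x))"
  by (intro integrable_const_bound[of _ 1]) auto

text \<open>Where the Taylor bound fails, Lyapunov's inequality makes the right-hand side at least 1; this is
  what fixes 9/25.\<close>
lemma (in prob_space) cmod_char_le:
  assumes Xm [measurable]: "X \<in> borel_measurable M" and m: "m = expectation X"
    and X3: "integrable M (\<lambda>x. \<bar>X x - m\<bar> ^ 3 :: real)" and t: "0 \<le> t"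
  shows "cmod (\<integral>x. iexp (t * X x) \<partial>M)
    \<le> exp (- (expectation (\<lambda>x. (X x - m)\<^sup>2) * t\<^sup>2 / 2) + 9 / 25 * expectation (\<lambda>x. \<bar>X x - m\<bar> ^ 3) * t ^ 3)"
proof -
  let ?X = "\<lambda>x. X x - m"
  define v where "v = expectation (\<lambda>x. (?X x)\<^sup>2)"
  define b where "b = expectation (\<lambda>x. \<bar>?X x\<bar> ^ 3)"
  have iX: "integrable M ?X" "integrable M (\<lambda>x. (?X x)\<^sup>2)"
    by (rule integrable_moments_le3[OF _ X3]; simp)+
  have "integrable M (\<lambda>x. ?X x + m)" using iX by (intro Bochner_Integration.integrable_add) auto
  then have "integrable M X" by simp
  then have E0: "expectation ?X = 0" by (simp add: m prob_space)
  have v0: "0 \<le> v" and b0: "0 \<le> b" by (auto simp: v_def b_def)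
  show ?thesis
  proof (cases "v * t\<^sup>2 \<le> 2")
    case True
    define c where "c = char (distr M borel ?X) t"
    have c: "c = (\<integral>x. iexp (t * ?X x) \<partial>M)"
      unfolding c_def char_def by (subst integral_distr) auto
    have "(\<integral>x. iexp (t * X x) \<partial>M) = (\<integral>x. iexp (t * m) * iexp (t * ?X x) \<partial>M)"
      by (intro Bochner_Integration.integral_cong) (auto simp: exp_add[symmetric] algebra_simps)
    also have "\<dots> = iexp (t * m) * c" unfolding c by (rule integral_mult_right_zero)
    finally have eq: "cmod (\<integral>x. iexp (t * X x) \<partial>M) = cmod c" by (simp add: norm_mult)
    have "cmod (c - (1 - t\<^sup>2 * v / 2)) \<le> t\<^sup>2 / 6 * expectation (\<lambda>x. min (6 * (?X x)\<^sup>2) (\<bar>t\<bar> * \<bar>?X x\<bar> ^ 3))"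
      unfolding c_def by (rule char_approx3'[OF _ iX E0 _ refl]) (auto simp: v_def E0)
    also have "\<dots> \<le> t\<^sup>2 / 6 * (t * b)"
    proof (rule mult_left_mono)
      have "expectation (\<lambda>x. min (6 * (?X x)\<^sup>2) (\<bar>t\<bar> * \<bar>?X x\<bar> ^ 3)) \<le> expectation (\<lambda>x. \<bar>t\<bar> * \<bar>?X x\<bar> ^ 3)"
        by (rule integral_mono) (auto intro!: X3 iX Bochner_Integration.integrable_min)
      then show "expectation (\<lambda>x. min (6 * (?X x)\<^sup>2) (\<bar>t\<bar> * \<bar>?X x\<bar> ^ 3)) \<le> t * b"
        using t by (simp add: b_def)
    qed simp
    finally have d: "cmod (c - (1 - t\<^sup>2 * v / 2)) \<le> b * t ^ 3 / 6"
      by (simp add: power2_eq_square power3_eq_cube mult_ac)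
    have "cmod c \<le> cmod (c - of_real (1 - t\<^sup>2 * v / 2)) + cmod (of_real (1 - t\<^sup>2 * v / 2))"
      using norm_triangle_ineq[of "c - of_real (1 - t\<^sup>2 * v / 2)" "of_real (1 - t\<^sup>2 * v / 2)"]
      by (simp only: diff_add_cancel)
    also have "cmod (of_real (1 - t\<^sup>2 * v / 2)) = 1 - t\<^sup>2 * v / 2"
      unfolding norm_of_real using True by (simp add: mult.commute)
    also have "cmod (c - of_real (1 - t\<^sup>2 * v / 2)) \<le> b * t ^ 3 / 6" using d by simp
    also have "b * t ^ 3 / 6 + (1 - t\<^sup>2 * v / 2) \<le> 1 + (- (v * t\<^sup>2 / 2) + 9 / 25 * b * t ^ 3)"
    proof -
      have "0 \<le> b * t ^ 3" using b0 t by simp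
      then show ?thesis by (simp add: mult.commute)
    qed
    also have "\<dots> \<le> exp (- (v * t\<^sup>2 / 2) + 9 / 25 * b * t ^ 3)" by (rule exp_ge_add_one_self)
    finally show ?thesis using eq by (simp add: v_def b_def)
  next
    case False
    define r where "r = sqrt v * t"
    have r: "0 \<le> r" "r\<^sup>2 = v * t\<^sup>2" using t v0 by (auto simp: r_def power_mult_distrib)
    \<comment> \<open>In this case r^2 > 2, hence r \<ge> 1.4 and
      \<open>r^2 / 2 \<le> r^3 / 2.8\<close>; the value 9/25 is just above 1 / 2.8.\<close>
    have "1.4\<^sup>2 \<le> r\<^sup>2" using False r by (simp add: power2_eq_square)
    then have r14: "1.4 \<le> r" by (rule power2_le_imp_le[OF _ r(1)])
    have "sqrt v ^ 3 \<le> b"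
      unfolding v_def b_def by (rule moment3_ge[OF X3 iX(2)])
    then have "sqrt v ^ 3 * t ^ 3 \<le> b * t ^ 3" using t by (intro mult_right_mono) auto
    then have "r ^ 3 \<le> b * t ^ 3" by (simp add: r_def power_mult_distrib)
    moreover have "1.4 * r\<^sup>2 \<le> r * r\<^sup>2" using r14 by (intro mult_right_mono) auto
    moreover have "r * r\<^sup>2 = r ^ 3" by (simp add: power2_eq_square power3_eq_cube)
    ultimately have "r\<^sup>2 / 2 \<le> 9 / 25 * (b * t ^ 3)" using zero_le_power[OF r(1), of 3] by linarith
    then have "v * t\<^sup>2 / 2 \<le> 9 / 25 * b * t ^ 3" by (simp add: r(2) mult.assoc)
    then have "1 \<le> exp (- (v * t\<^sup>2 / 2) + 9 / 25 * b * t ^ 3)" by simp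
    moreover have "cmod (\<integral>x. iexp (t * X x) \<partial>M) \<le> 1"
    proof -
      have "cmod (\<integral>x. iexp (t * X x) \<partial>M) \<le> (\<integral>x. cmod (iexp (t * X x)) \<partial>M)"
        by (rule integral_norm_bound)
      then show ?thesis by (simp add: prob_space)
    qed
    ultimately show ?thesis unfolding v_def b_def by linarith
  qed
qed

context
  fixes I :: "'i set" and N :: "'i \<Rightarrow> 'b measure" and X :: "'i \<Rightarrow> 'b \<Rightarrow> real" and B C :: real and m :: "'i \<Rightarrow> real"
  assumes fin: "finite I"
    and prob: "\<And>i. i \<in> I \<Longrightarrow> prob_space (N i)"
    and meas: "\<And>i. i \<in> I \<Longrightarrow> X i \<in> borel_measurable (N i)"
    and mean: "\<And>i. i \<in> I \<Longrightarrow> m i = integral\<^sup>L (N i) (X i)"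
    and int3: "\<And>i. i \<in> I \<Longrightarrow> integrable (N i) (\<lambda>y. \<bar>X i y - m i\<bar> ^ 3)"
    and B: "B = (\<Sum>i\<in>I. \<integral>y. (X i y - m i)\<^sup>2 \<partial>N i)"
    and C: "C = (\<Sum>i\<in>I. \<integral>y. \<bar>X i y - m i\<bar> ^ 3 \<partial>N i)"
    and Bpos: "0 < B"
begin

lemma cmod_char_sum_le:
  assumes "0 \<le> t"
  shows "cmod (\<integral>y. iexp (t * (\<Sum>i\<in>I. X i (y i))) \<partial>Pi\<^sub>M I N) \<le> exp (- (B * t\<^sup>2 / 2) + 9 / 25 * C * t ^ 3)"
proof -
  \<comment> \<open>The product locale asks for a probability space at every index. A one-point
    space is put in outside I, which leaves the product over I unchanged.\<close>
  define N' where "N' i = (if i \<in> I then N i else count_space {undefined})" for i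
  have p: "prob_space (N' i)" for i
    using prob by (auto simp: N'_def intro!: prob_spaceI)
  interpret product_prob_space N' I
    using p by (intro product_prob_spaceI)
  have eqP: "Pi\<^sub>M I N = Pi\<^sub>M I N'" by (rule PiM_cong) (auto simp: N'_def)
  have int: "integrable (N' i) (\<lambda>y. iexp (t * X i y))" if "i \<in> I" for i
    using prob_space.integrable_iexp[OF p, of "X i" i t] meas[OF that] that by (simp add: N'_def)
  have "(\<integral>y. iexp (t * (\<Sum>i\<in>I. X i (y i))) \<partial>Pi\<^sub>M I N) = (\<integral>y. (\<Prod>i\<in>I. iexp (t * X i (y i))) \<partial>Pi\<^sub>M I N')"
    unfolding eqP
    by (intro Bochner_Integration.integral_cong refl) (simp add: sum_distrib_left exp_sum[OF fin, symmetric])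
  also have "\<dots> = (\<Prod>i\<in>I. \<integral>y. iexp (t * X i y) \<partial>N' i)"
    by (rule product_integral_prod[OF fin int])
  finally have "cmod (\<integral>y. iexp (t * (\<Sum>i\<in>I. X i (y i))) \<partial>Pi\<^sub>M I N) = (\<Prod>i\<in>I. cmod (\<integral>y. iexp (t * X i y) \<partial>N i))"
    by (simp add: prod_norm[symmetric] N'_def)
  also have "\<dots> \<le> (\<Prod>i\<in>I. exp (- ((\<integral>y. (X i y - m i)\<^sup>2 \<partial>N i) * t\<^sup>2 / 2) + 9 / 25 * (\<integral>y. \<bar>X i y - m i\<bar> ^ 3 \<partial>N i) * t ^ 3))"
  proof (rule prod_mono, rule conjI)
    fix i assume i: "i \<in> I"
    show "cmod (\<integral>y. iexp (t * X i y) \<partial>N i)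
      \<le> exp (- ((\<integral>y. (X i y - m i)\<^sup>2 \<partial>N i) * t\<^sup>2 / 2) + 9 / 25 * (\<integral>y. \<bar>X i y - m i\<bar> ^ 3 \<partial>N i) * t ^ 3)"
      by (rule prob_space.cmod_char_le[OF prob[OF i] meas[OF i] mean[OF i] int3[OF i] assms])
  qed simp
  also have "\<dots> = exp (- (B * t\<^sup>2 / 2) + 9 / 25 * C * t ^ 3)"
    unfolding exp_sum[OF fin, symmetric] B C
    by (simp only: sum.distrib sum_distrib_left sum_distrib_right sum_negf sum_divide_distrib)
  finally show ?thesis .
qed

text \<open>The cut-off frequency \<open>c * B / C\<close> divides by C; Lyapunov's inequality
  excludes C = 0 as soon as one summand has positive variance.\<close>

lemma C_pos: "0 < C"
proof -
  obtain i where i: "i \<in> I" "0 < (\<integral>y. (X i y - m i)\<^sup>2 \<partial>N i)"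
    using Bpos sum_nonpos[of I "\<lambda>i. \<integral>y. (X i y - m i)\<^sup>2 \<partial>N i"] unfolding B by force
  interpret prob_space "N i" using prob i by simp
  have [measurable]: "X i \<in> borel_measurable (N i)" using meas i by simp
  have "0 < sqrt (\<integral>y. (X i y - m i)\<^sup>2 \<partial>N i) ^ 3" using i by simp
  also have "\<dots> \<le> (\<integral>y. \<bar>X i y - m i\<bar> ^ 3 \<partial>N i)"
    using int3[OF i(1)] by (intro moment3_ge integrable_moments_le3(2)) auto
  also have "\<dots> \<le> C" unfolding C using i fin by (intro member_le_sum) auto
  finally show ?thesis .
qed

text \<open>Below the frequency \<open>c * B / C\<close> the cubic term is at most a fixed multiple
  of the quadratic one, \<open>C * t^3 \<le> c * B * t^2\<close>. The characteristic function is
  then Gaussian with rate \<open>(1 - 18 / 25 * c) * B / 2\<close>, where 18/25 is twice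
  9/25.\<close>

lemma exp_tail_sum_le:
  assumes c: "0 < c" "18 / 25 * c < 1" and \<mu>: "0 < \<mu>" and w: "0 < w" "w\<^sup>2 \<le> 24"
  shows "(\<integral>\<^sup>+y. ennreal (exp (- \<mu> * ((\<Sum>i\<in>I. X i (y i)) - \<tau>)) * indicator {\<tau><..} (\<Sum>i\<in>I. X i (y i))) \<partial>Pi\<^sub>M I N)
    \<le> ennreal (exp (\<mu> * w * (C / B) / c) * (sqrt (2 * pi / ((1 - 18 / 25 * c) * B)) / 2) / (\<mu> * (w - w ^ 3 / 36 + w ^ 5 / 2880)))"
proof -
  define T where "T = c * B / C"
  define k where "k = (1 - 18 / 25 * c) * B / 2"
  have T: "0 < T" and k: "0 < k" using c Bpos C_pos by (auto simp: T_def k_def)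
  interpret prob_space "Pi\<^sub>M I N" by (intro prob_space_PiM prob)
  have [measurable]: "X i \<in> borel_measurable (N i)" if "i \<in> I" for i using meas that by simp
  have S: "(\<lambda>y. \<Sum>i\<in>I. X i (y i)) \<in> borel_measurable (Pi\<^sub>M I N)" by measurable
  have "(\<integral>\<^sup>+y. ennreal (exp (- \<mu> * ((\<Sum>i\<in>I. X i (y i)) - \<tau>)) * indicator {\<tau><..} (\<Sum>i\<in>I. X i (y i))) \<partial>Pi\<^sub>M I N)
    \<le> ennreal (exp (\<mu> * w / T) * (sqrt (pi / k) / 2) / (\<mu> * (w - w ^ 3 / 36 + w ^ 5 / 2880)))"
  proof (rule exp_tail_le[OF S T k \<mu> w])
    fix t assume t: "0 \<le> t" "t \<le> T"
    have "C * t ^ 3 = C * t * t\<^sup>2" by (simp add: power2_eq_square power3_eq_cube)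
    also have "\<dots> \<le> C * T * t\<^sup>2" using t C_pos by (intro mult_right_mono mult_left_mono) auto
    also have "C * T = c * B" using C_pos by (simp add: T_def)
    finally have "- (B * t\<^sup>2 / 2) + 9 / 25 * C * t ^ 3 \<le> - (B * t\<^sup>2 / 2) + 9 / 25 * (c * B * t\<^sup>2)" by simp
    also have "\<dots> = - k * t\<^sup>2" by (simp add: k_def field_simps)
    finally have "exp (- (B * t\<^sup>2 / 2) + 9 / 25 * C * t ^ 3) \<le> exp (- k * t\<^sup>2)" by (simp only: exp_le_cancel_iff)
    then show "cmod (\<integral>y. iexp (t * (\<Sum>i\<in>I. X i (y i))) \<partial>Pi\<^sub>M I N) \<le> exp (- k * t\<^sup>2)"
      by (rule order_trans[OF cmod_char_sum_le[OF t(1)]])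
  qed
  also have "\<mu> * w / T = \<mu> * w * (C / B) / c" using c Bpos C_pos by (simp add: T_def field_simps)
  also have "pi / k = 2 * pi / ((1 - 18 / 25 * c) * B)" by (simp add: k_def field_simps)
  finally show ?thesis .
qed

end

section \<open>Numerical bounds for the constants of the tail estimate\<close>

lemma pi_bounds: "3.1 \<le> pi" "pi \<le> 3.144"
proof -
  \<comment> \<open>The lower bound comes from \<open>cos (pi / 6) = sqrt 3 / 2\<close>, the upper
    one from \<open>sin (pi / 6) = 1 / 2\<close>, through the polynomial lower bounds of cosine and
    sine.\<close>
  have "sqrt 3 \<le> 1.7321" by (rule real_le_lsqrt) (auto simp: power2_eq_square)
  then have "9.6444 \<le> pi\<^sup>2"
    using one_minus_half_square_le_cos[of "pi / 6"] by (simp add: cos_30 power_divide)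
  then have "3.1\<^sup>2 \<le> pi\<^sup>2" by (simp add: power2_eq_square)
  then show "3.1 \<le> pi" by (rule power2_le_imp_le) simp
  have "sin (pi / 6) \<le> sin (0.524 :: real)"
    using sin_ge_cubic[of "0.524"] by (simp add: sin_30 power3_eq_cube)
  moreover have "sin (0.524 :: real) < sin (pi / 6)" if "0.524 < pi / 6"
    using that pi_gt3 by (intro sin_monotone_2pi) auto
  ultimately have "pi / 6 \<le> 0.524" by fastforce
  then show "pi \<le> 3.144" by simp
qed

lemma exp_bounds:
  "exp (3 / 8 :: real) \<le> 1.46" "exp (15 / 11 :: real) \<le> 3.92" "7.353 \<le> exp (2 :: real)" "1.645 \<le> exp (1 / 2 :: real)"
proof -
  have e: "exp 1 \<le> (2.72 :: real)" using e_less_272 by simp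
  have "exp (3 / 8 :: real) ^ 8 = exp 1 ^ 3" by (simp add: exp_of_nat_mult[symmetric])
  also have "\<dots> \<le> 2.72 ^ 3" using e by (intro power_mono) auto
  also have "\<dots> \<le> (1.46 :: real) ^ 8" by (simp add: eval_nat_numeral)
  finally show "exp (3 / 8 :: real) \<le> 1.46" by (rule power_le_imp_le_base[where n = 7, simplified eval_nat_numeral, simplified])  simp
  have "exp (15 / 11 :: real) ^ 11 = exp 1 ^ 15" by (simp add: exp_of_nat_mult[symmetric])
  also have "\<dots> \<le> 2.72 ^ 15" using e by (intro power_mono) auto
  also have "\<dots> \<le> (3.92 :: real) ^ 11" by (simp add: eval_nat_numeral)
  finally show "exp (15 / 11 :: real) \<le> 3.92" by (rule power_le_imp_le_base[where n = 10, simplified eval_nat_numeral, simplified]) simp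
  \<comment> \<open>1.1328125 is 1 + 1/8 + 1/128; its powers 16 and 4 give the two lower
    bounds.\<close>
  have b: "1.1328125 \<le> exp (1 / 8 :: real)"
    using exp_lower_Taylor_quadratic[of "1 / 8 :: real"] by (simp add: power2_eq_square)
  have "7.353 \<le> (1.1328125 :: real) ^ 16" by (simp add: eval_nat_numeral)
  also have "\<dots> \<le> exp (1 / 8) ^ 16" using b by (intro power_mono) auto
  also have "\<dots> = exp 2" by (simp add: exp_of_nat_mult[symmetric])
  finally show "7.353 \<le> exp (2 :: real)" .
  have "1.645 \<le> (1.1328125 :: real) ^ 4" by (simp add: eval_nat_numeral)
  also have "\<dots> \<le> exp (1 / 8) ^ 4" using b by (intro power_mono) auto
  also have "\<dots> = exp (1 / 2)" by (simp add: exp_of_nat_mult[symmetric])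
  finally show "1.645 \<le> exp (1 / 2 :: real)" .
qed

text \<open>A convex function lies below an affine one on an interval once it does so at the
  endpoints. This turns the inequalities of \<open>window_choice\<close> into finitely many
  numerical checks.\<close>

lemma exp_le_chord:
  fixes a b k l m x :: real
  assumes x: "a \<le> x" "x \<le> b" and l: "0 \<le> l" and ends: "l * exp (k * a) \<le> m + s * a" "l * exp (k * b) \<le> m + s * b"
  shows "l * exp (k * x) \<le> m + s * x"
proof (cases "a = b")
  case True
  then show ?thesis using x ends by auto
next
  case False
  define t where "t = (x - a) / (b - a)"
  have t: "0 \<le> t" "t \<le> 1" using x False by (auto simp: t_def)
  have "t * (b - a) = x - a" using False by (simp add: t_def)
  then have xt: "x = (1 - t) * a + t * b" by (simp add: algebra_simps)
  have "exp ((1 - t) *\<^sub>R (k * a) + t *\<^sub>R (k * b)) \<le> (1 - t) * exp (k * a) + t * exp (k * b)"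
    using convex_onD[OF exp_convex t(1) t(2), of "k * a" "k * b"] by simp
  also have "(1 - t) *\<^sub>R (k * a) + t *\<^sub>R (k * b) = k * x" by (simp add: xt algebra_simps)
  finally have "l * exp (k * x) \<le> l * ((1 - t) * exp (k * a) + t * exp (k * b))"
    using l by (rule mult_left_mono)
  also have "\<dots> = (1 - t) * (l * exp (k * a)) + t * (l * exp (k * b))" by (simp add: algebra_simps)
  also have "\<dots> \<le> (1 - t) * (m + s * a) + t * (m + s * b)"
    using t ends by (intro add_mono mult_left_mono) auto
  also have "\<dots> = m + s * x" by (simp add: xt algebra_simps)
  finally show ?thesis .
qed

text \<open>The window width w and the frequency cut-off c B/C trade the loss in the Gaussian factor
  against the loss in the exponential; two choices cover all values of \<mu> \<rho>.\<close>
lemma window_choice: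
  fixes \<mu> \<rho> :: real
  assumes pos: "0 < \<mu>" "0 < \<rho>"
  obtains c w \<mu>' where "0 < c" "18 / 25 * c < 1" "0 < w" "w\<^sup>2 \<le> 24" "0 < \<mu>'" "\<mu>' \<le> \<mu>"
    "pi * exp (\<mu>' * w * \<rho> / c) / (sqrt (1 - 18 / 25 * c) * (w - w ^ 3 / 36 + w ^ 5 / 2880) * \<mu>') \<le> 1.864 / \<mu> + 18.3 * \<rho>"
proof -
  \<comment> \<open>With \<open>\<mu>' * \<rho>\<close> as the only variable, the claim says that an
    exponential lies below an affine function; l bounds the prefactor belonging to the
    window.\<close>
  have *: "pi * exp (\<mu>' * w * \<rho> / c) / (s * p * \<mu>') \<le> 1.864 / \<mu>' + 18.3 * \<rho>"
    if "l * exp (k * (\<mu>' * \<rho>)) \<le> 1.864 + 18.3 * (\<mu>' * \<rho>)" "pi / (s * p) \<le> l" "k = w / c" "0 < \<mu>'" for l k w c s p \<mu>' :: real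
  proof -
    have "pi / (s * p) * exp (k * (\<mu>' * \<rho>)) \<le> l * exp (k * (\<mu>' * \<rho>))"
      using that by (intro mult_right_mono) auto
    also have "\<dots> \<le> 1.864 + 18.3 * (\<mu>' * \<rho>)" by (rule that)
    finally have "pi / (s * p) * exp (k * (\<mu>' * \<rho>)) / \<mu>' \<le> (1.864 + 18.3 * (\<mu>' * \<rho>)) / \<mu>'"
      using that by (intro divide_right_mono) auto
    then show ?thesis using that by (simp add: add_divide_distrib mult_ac)
  qed
  have s1: "0.7244 \<le> sqrt (1 - 18 / 25 * 0.66)" and s2: "0.6511 \<le> sqrt (1 - 18 / 25 * 0.8)"
    by (rule real_le_rsqrt, simp add: power2_eq_square)+
  have l1: "pi / (sqrt (1 - 18 / 25 * 0.66) * (3 - 3 ^ 3 / 36 + 3 ^ 5 / 2880)) \<le> 1.86"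
  proof -
    have "pi \<le> 1.86 * (0.7244 * (3 - 3 ^ 3 / 36 + 3 ^ 5 / 2880))" using pi_bounds by simp
    also have "\<dots> \<le> 1.86 * (sqrt (1 - 18 / 25 * 0.66) * (3 - 3 ^ 3 / 36 + 3 ^ 5 / 2880))"
      using s1 by (intro mult_left_mono mult_right_mono) auto
    finally show ?thesis
      by (rule mult_imp_div_pos_le[rotated]) (use s1 in \<open>intro mult_pos_pos; simp\<close>)
  qed
  have l2: "pi / (sqrt (1 - 18 / 25 * 0.8) * (1 - 1 ^ 3 / 36 + 1 ^ 5 / 2880)) \<le> 4.97"
  proof -
    have "pi \<le> 4.97 * (0.6511 * (1 - 1 ^ 3 / 36 + 1 ^ 5 / 2880))" using pi_bounds by simp
    also have "\<dots> \<le> 4.97 * (sqrt (1 - 18 / 25 * 0.8) * (1 - 1 ^ 3 / 36 + 1 ^ 5 / 2880))"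
      using s2 by (intro mult_left_mono mult_right_mono) auto
    finally show ?thesis
      by (rule mult_imp_div_pos_le[rotated]) (use s2 in \<open>intro mult_pos_pos; simp\<close>)
  qed
  consider "\<mu> * \<rho> \<le> 0.3" | "0.3 \<le> \<mu> * \<rho>" "\<mu> * \<rho> \<le> 0.8" | "0.8 \<le> \<mu> * \<rho>"
    using linear[of "\<mu> * \<rho>" "0.3"] linear[of "\<mu> * \<rho>" "0.8"] by blast
  then show thesis
  proof cases
    case 1
    \<comment> \<open>The rate is w / c = 3 / 0.66 = 50/11, which gives the exponent 15/11 at the
      endpoint 0.3.\<close>
    have "1.86 * exp (50 / 11 * (\<mu> * \<rho>)) \<le> 1.864 + 18.3 * (\<mu> * \<rho>)"
      by (rule exp_le_chord[where a = 0 and b = "0.3"]) (use pos 1 exp_bounds(2) in simp_all)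
    from *[where w = 3 and c = "0.66", OF this l1] pos show thesis
      by (intro that[of "0.66" 3 \<mu>]) auto
  next
    case 2
    \<comment> \<open>The rate is 1 / 0.8 = 5/4, with exponents 3/8 and 1 at the two
      endpoints.\<close>
    have "4.97 * exp (5 / 4 * (\<mu> * \<rho>)) \<le> 1.864 + 18.3 * (\<mu> * \<rho>)"
      by (rule exp_le_chord[where a = "0.3" and b = "0.8"]) (use 2 exp_bounds(1) e_less_272 in simp_all)
    from *[where w = 1 and c = "0.8", OF this l2] pos show thesis
      by (intro that[of "0.8" 1 \<mu>]) auto
  next
    case 3
    \<comment> \<open>For large \<open>\<mu> * \<rho>\<close> the exponential exceeds every affine
      bound. The tail integral decreases in \<mu>, so a smaller \<open>\<mu>'\<close> may stand in,
      with the product frozen at the end of the middle range.\<close>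
    define \<mu>' where "\<mu>' = 0.8 / \<rho>"
    have m: "0 < \<mu>'" "\<mu>' \<le> \<mu>" "\<mu>' * \<rho> = 0.8" using pos 3 by (auto simp: \<mu>'_def field_simps)
    have "pi / (sqrt (1 - 18 / 25 * 0.8) * (1 - 1 ^ 3 / 36 + 1 ^ 5 / 2880)) * exp 1 \<le> 4.97 * 2.72"
      using l2 e_less_272 by (intro mult_mono) auto
    then have "pi / (sqrt (1 - 18 / 25 * 0.8) * (1 - 1 ^ 3 / 36 + 1 ^ 5 / 2880)) * exp 1 / \<mu>' \<le> 4.97 * 2.72 / \<mu>'"
      using m by (intro divide_right_mono) auto
    also have "\<dots> \<le> 18.3 * \<rho>" using pos by (simp add: \<mu>'_def)
    also have "\<dots> \<le> 1.864 / \<mu> + 18.3 * \<rho>" using pos by simp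
    finally show thesis
      using m by (intro that[of "0.8" 1 \<mu>']) (auto simp: m(3) mult_ac)
  qed
qed

text \<open>1.864 and 6.58 are just below 2 exp (- exp (- 2) / 2) and 4 exp (1 / 2).\<close>
lemma exponent_constant_ge:
  fixes \<mu> :: real
  assumes \<mu>: "0 < \<mu>"
  defines "F \<equiv> exp (- 1) * (2 * exp (1 + \<mu>) * \<mu> / (1 + \<mu>)) powr (1 + \<mu>) / \<mu>\<^sup>2"
  shows "1.864 / \<mu> \<le> F" "6.58 \<le> F"
proof -
  \<comment> \<open>Here m is the free point of tangency in
    \<open>\<mu> * ln \<mu> \<ge> \<mu> * ln m - m + \<mu>\<close>; together with
    \<open>ln (1 + \<mu>) \<le> \<mu>\<close> it makes the logarithm of F, up to
    \<open>ln \<mu>\<close>, affine in \<mu>.\<close>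
  have F: "2 / \<mu> * exp (\<mu> * (2 + ln 2 + ln m) - m) \<le> F" if m: "0 < m" for m
  proof -
    have "ln (m / \<mu>) \<le> m / \<mu> - 1" using \<mu> m by (intro ln_le_minus_one) auto
    then have "\<mu> * (ln m - ln \<mu>) \<le> m - \<mu>" using \<mu> m by (simp add: ln_div field_simps)
    moreover have "(1 + \<mu>) * ln (1 + \<mu>) \<le> (1 + \<mu>) * \<mu>"
      using \<mu> by (intro mult_left_mono ln_add_one_self_le_self) auto
    ultimately have "ln 2 - ln \<mu> + (\<mu> * (2 + ln 2 + ln m) - m)
        \<le> - 1 + (1 + \<mu>) * (ln 2 + (1 + \<mu>) + ln \<mu> - ln (1 + \<mu>)) - 2 * ln \<mu>"
      by (simp add: algebra_simps)
    then have "exp (ln 2 - ln \<mu> + (\<mu> * (2 + ln 2 + ln m) - m))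
        \<le> exp (- 1 + (1 + \<mu>) * (ln 2 + (1 + \<mu>) + ln \<mu> - ln (1 + \<mu>)) - 2 * ln \<mu>)"
      by (rule exp_le_cancel_iff[THEN iffD2])
    also have "\<dots> = exp (- 1) * exp ((1 + \<mu>) * ln (2 * exp (1 + \<mu>) * \<mu> / (1 + \<mu>))) / exp (2 * ln \<mu>)"
      using \<mu> by (simp add: ln_div ln_mult exp_diff exp_add exp_minus inverse_eq_divide)
    also have "exp (2 * ln \<mu>) = \<mu>\<^sup>2" using \<mu> by (simp add: exp_double)
    also have "exp (- 1) * exp ((1 + \<mu>) * ln (2 * exp (1 + \<mu>) * \<mu> / (1 + \<mu>))) / \<mu>\<^sup>2 = F"
      using \<mu> by (simp add: F_def powr_def)
    also have "exp (ln 2 - ln \<mu> + (\<mu> * (2 + ln 2 + ln m) - m)) = 2 / \<mu> * exp (\<mu> * (2 + ln 2 + ln m) - m)"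
      using \<mu> by (simp add: exp_add exp_diff)
    finally show ?thesis .
  qed
  \<comment> \<open>This m makes the coefficient of \<mu> in the exponent vanish.\<close>
  have "ln (exp (- 2) / 2 :: real) = - 2 - ln 2" by (simp add: ln_div)
  with F[of "exp (- 2) / 2"] have "2 / \<mu> * exp (- (exp (- 2) / 2)) \<le> F" by simp
  moreover have "1.864 / \<mu> \<le> 2 / \<mu> * exp (- (exp (- 2) / 2))"
  proof -
    have "exp (- 2 :: real) = 1 / exp 2" by (simp add: exp_minus inverse_eq_divide)
    also have "\<dots> \<le> 1 / 7.353" using exp_bounds(3) by (intro divide_left_mono) auto
    finally have "0.932 \<le> 1 + - (exp (- 2) / 2 :: real)" by simp
    also have "\<dots> \<le> exp (- (exp (- 2) / 2))" by (rule exp_ge_add_one_self)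
    finally have "2 / \<mu> * 0.932 \<le> 2 / \<mu> * exp (- (exp (- 2) / 2))" using \<mu> by (intro mult_left_mono) auto
    then show ?thesis by simp
  qed
  ultimately show "1.864 / \<mu> \<le> F" by linarith
  \<comment> \<open>For m = 1/2 the exponent is \<open>2 * \<mu> - 1 / 2\<close>, and a linear lower
    bound of \<open>exp (2 * \<mu>)\<close> cancels the factor \<open>1 / \<mu>\<close>.\<close>
  have "2 * \<mu> * exp 1 \<le> exp (2 * \<mu>)"
  proof -
    have "1 + (2 * \<mu> - 1) \<le> exp (2 * \<mu> - 1)" by (rule exp_ge_add_one_self)
    then show ?thesis by (simp add: exp_diff field_simps)
  qed
  then have "2 * \<mu> * exp 1 * exp (- (1 / 2)) \<le> exp (2 * \<mu>) * exp (- (1 / 2))" by (intro mult_right_mono) auto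
  moreover have "exp 1 * exp (- (1 / 2)) = exp (1 / 2 :: real)" by (simp add: mult_exp_exp)
  moreover have "exp (2 * \<mu>) * exp (- (1 / 2)) = exp (\<mu> * 2 - 1 / 2)" by (simp add: mult_exp_exp mult.commute)
  ultimately have "2 * \<mu> * exp (1 / 2) \<le> exp (\<mu> * 2 - 1 / 2)" by (simp add: mult.assoc)
  then have "2 / \<mu> * (2 * \<mu> * exp (1 / 2)) \<le> 2 / \<mu> * exp (\<mu> * 2 - 1 / 2)"
    using \<mu> by (intro mult_left_mono) auto
  also have "\<dots> \<le> F" using F[of "1 / 2"] by (simp add: ln_div)
  finally have "4 * exp (1 / 2) \<le> F" using \<mu> by simp
  then show "6.58 \<le> F" using exp_bounds(4) by simp
qed

text \<open>The constant of the theorem solved backwards, with \<open>\<alpha> = 1 + \<mu>\<close>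
  and \<rho> the ratio of summed third moments to summed variances: the largest tail factor, up to
  the root of the summed variance, that the stated error bound can afford. The value 0.56 is thus a
  target to be met by the smoothing bound.\<close>

definition tail_const :: "real \<Rightarrow> real \<Rightarrow> real" where
  "tail_const \<mu> \<rho> = exp (- 1) * (2 * exp (1 + \<mu>) * \<mu> / (1 + \<mu>)) powr (1 + \<mu>) / \<mu>\<^sup>2
     * (1 / sqrt (2 * pi) + 2 * (0.56 * \<rho>))"

text \<open>The two coefficients are compared separately. The value 18.3 lies below 6.58 * 1.12 *
  2.489, where 1.12 = 2 * 0.56 and 2.489 is a lower bound of \<open>sqrt (2 * pi)\<close>.\<close>

lemma tail_const_ge:
  assumes pos: "0 < \<mu>" "0 < \<rho>"
  shows "(1.864 / \<mu> + 18.3 * \<rho>) / sqrt (2 * pi) \<le> tail_const \<mu> \<rho>"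
proof -
  define F where "F = exp (- 1) * (2 * exp (1 + \<mu>) * \<mu> / (1 + \<mu>)) powr (1 + \<mu>) / \<mu>\<^sup>2"
  define r where "r = sqrt (2 * pi)"
  have F: "1.864 / \<mu> \<le> F" "6.58 \<le> F"
    unfolding F_def by (rule exponent_constant_ge[OF pos(1)])+
  have r: "2.489 \<le> r"
    unfolding r_def using pi_bounds by (intro real_le_rsqrt) (simp add: power2_eq_square)
  have "6.58 * (1.12 * 2.489) \<le> F * (1.12 * r)" using F r by (intro mult_mono) auto
  then have "18.3 \<le> F * (1.12 * r)" by simp
  then have "18.3 * \<rho> \<le> F * (1.12 * r) * \<rho>" using pos by (intro mult_right_mono) auto
  with F have "1.864 / \<mu> + 18.3 * \<rho> \<le> F + F * (1.12 * r) * \<rho>" by linarith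
  also have "\<dots> = F * (1 + 1.12 * r * \<rho>)" by (simp add: algebra_simps)
  finally have "(1.864 / \<mu> + 18.3 * \<rho>) / r \<le> F * (1 + 1.12 * r * \<rho>) / r"
    using r by (intro divide_right_mono) auto
  also have "\<dots> = F * (1 / r + 2 * (0.56 * \<rho>))" using r by (simp add: field_simps)
  finally show ?thesis by (simp add: tail_const_def F_def r_def)
qed

lemma exp_tail_sum_le_tail_const:
  fixes I :: "'i set" and N :: "'i \<Rightarrow> 'b measure" and X :: "'i \<Rightarrow> 'b \<Rightarrow> real" and B C :: real and m :: "'i \<Rightarrow> real"
  assumes fin: "finite I"
    and prob: "\<And>i. i \<in> I \<Longrightarrow> prob_space (N i)"
    and meas: "\<And>i. i \<in> I \<Longrightarrow> X i \<in> borel_measurable (N i)"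
    and mean: "\<And>i. i \<in> I \<Longrightarrow> m i = integral\<^sup>L (N i) (X i)"
    and int3: "\<And>i. i \<in> I \<Longrightarrow> integrable (N i) (\<lambda>y. \<bar>X i y - m i\<bar> ^ 3)"
    and B: "B = (\<Sum>i\<in>I. \<integral>y. (X i y - m i)\<^sup>2 \<partial>N i)"
    and C: "C = (\<Sum>i\<in>I. \<integral>y. \<bar>X i y - m i\<bar> ^ 3 \<partial>N i)"
    and Bpos: "0 < B" and \<mu>: "0 < \<mu>"
  shows "(\<integral>\<^sup>+y. ennreal (exp (- \<mu> * ((\<Sum>i\<in>I. X i (y i)) - \<tau>)) * indicator {\<tau><..} (\<Sum>i\<in>I. X i (y i))) \<partial>Pi\<^sub>M I N)
    \<le> ennreal (tail_const \<mu> (C / B) / sqrt B)"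
proof -
  note ctx = fin prob meas mean int3 B C Bpos
  have C0: "0 < C" by (rule C_pos[OF ctx])
  define \<rho> where "\<rho> = C / B"
  have \<rho>: "0 < \<rho>" using C0 Bpos by (simp add: \<rho>_def)
  obtain c w \<mu>' where *: "0 < c" "18 / 25 * c < 1" "0 < w" "w\<^sup>2 \<le> 24" "0 < \<mu>'" "\<mu>' \<le> \<mu>"
    "pi * exp (\<mu>' * w * \<rho> / c) / (sqrt (1 - 18 / 25 * c) * (w - w ^ 3 / 36 + w ^ 5 / 2880) * \<mu>') \<le> 1.864 / \<mu> + 18.3 * \<rho>"
    by (rule window_choice[OF \<mu> \<rho>])
  define \<kappa> where "\<kappa> = 1 - 18 / 25 * c"
  define p where "p = w - w ^ 3 / 36 + w ^ 5 / 2880"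
  define E where "E = exp (\<mu>' * w * \<rho> / c)"
  have \<kappa>: "0 < \<kappa>" using * by (simp add: \<kappa>_def)
  have "(\<integral>\<^sup>+y. ennreal (exp (- \<mu> * ((\<Sum>i\<in>I. X i (y i)) - \<tau>)) * indicator {\<tau><..} (\<Sum>i\<in>I. X i (y i))) \<partial>Pi\<^sub>M I N)
    \<le> (\<integral>\<^sup>+y. ennreal (exp (- \<mu>' * ((\<Sum>i\<in>I. X i (y i)) - \<tau>)) * indicator {\<tau><..} (\<Sum>i\<in>I. X i (y i))) \<partial>Pi\<^sub>M I N)"
    using * by (intro nn_integral_mono ennreal_leI) (auto intro!: mult_right_mono split: split_indicator)
  also have "\<dots> \<le> ennreal (E * (sqrt (2 * pi / (\<kappa> * B)) / 2) / (\<mu>' * p))"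
    unfolding E_def \<rho>_def \<kappa>_def p_def by (rule exp_tail_sum_le[OF ctx *(1,2,5,3,4)])
  also have "E * (sqrt (2 * pi / (\<kappa> * B)) / 2) / (\<mu>' * p) = (pi * E / (sqrt \<kappa> * p * \<mu>')) / sqrt (2 * pi) / sqrt B"
  proof -
    have "sqrt (2 * pi) / 2 = pi / sqrt (2 * pi)"
      by (simp add: field_simps flip: real_sqrt_mult)
    moreover have "sqrt (2 * pi / (\<kappa> * B)) / 2 = sqrt (2 * pi) / 2 / (sqrt \<kappa> * sqrt B)"
      unfolding real_sqrt_divide real_sqrt_mult[of \<kappa> B] by simp
    ultimately have "sqrt (2 * pi / (\<kappa> * B)) / 2 = pi / sqrt (2 * pi) / (sqrt \<kappa> * sqrt B)" by (simp only:)
    then show ?thesis by (simp add: mult_ac)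
  qed
  also have "ennreal \<dots> \<le> ennreal ((1.864 / \<mu> + 18.3 * \<rho>) / sqrt (2 * pi) / sqrt B)"
    using *(7) Bpos unfolding E_def \<kappa>_def p_def by (intro ennreal_leI divide_right_mono) auto
  also have "\<dots> \<le> ennreal (tail_const \<mu> \<rho> / sqrt B)"
    using tail_const_ge[OF \<mu> \<rho>] Bpos by (intro ennreal_leI divide_right_mono) auto
  finally show ?thesis unfolding \<rho>_def .
qed

section \<open>Renyi divergence and change of reference measure\<close>

text \<open>The formula of \<open>renyi_div\<close> with reference measure and densities left free,
  so that the reference can be changed and the second density replaced by one that is correct only
  where the first is positive.\<close>

definition renyi_dens :: "real \<Rightarrow> 'b measure \<Rightarrow> ('b \<Rightarrow> real) \<Rightarrow> ('b \<Rightarrow> real) \<Rightarrow> ereal" where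
  "renyi_dens \<alpha> \<nu> p q =
     (if \<alpha> = 1 then
       (if emeasure \<nu> {y \<in> space \<nu>. q y = 0 \<and> p y > 0} \<noteq> 0 then \<infinity>
        else if integrable \<nu> (\<lambda>y. p y * (ln (p y) - ln (q y)))
        then ereal (\<integral>y. p y * (ln (p y) - ln (q y)) \<partial>\<nu>)
        else \<infinity>)
     else
       (let I = (\<integral>\<^sup>+ y. renyi_integrand \<alpha> (p y) (q y) \<partial>\<nu>) in
        if I = 0 \<or> I = \<infinity> then \<infinity> else ereal (ln (enn2real I) / (\<alpha> - 1))))"

lemma renyi_div_eq_dens: "renyi_div \<alpha> P Q = renyi_dens \<alpha> (ref_meas P Q) (dens1 P Q) (dens2 P Q)"
  by (simp add: renyi_div_def renyi_dens_def Let_def)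

text \<open>Homogeneity of degree one, also in the branches with q = 0, is why the divergence does
  not depend on the reference measure.\<close>

lemma renyi_integrand_scale:
  assumes "0 < c" "0 \<le> p" "0 \<le> q"
  shows "renyi_integrand \<alpha> (c * p) (c * q) = ennreal c * renyi_integrand \<alpha> p q"
proof -
  have "c powr \<alpha> * c powr (1 - \<alpha>) = c"
    using assms by (simp flip: powr_add)
  then have "(c * p) powr \<alpha> * (c * q) powr (1 - \<alpha>) = c * (p powr \<alpha> * q powr (1 - \<alpha>))"
    using assms by (simp add: powr_mult)
  then show ?thesis
    using assms by (auto simp: renyi_integrand_def ennreal_mult ennreal_mult_top)
qed

lemma renyi_integrand_0 [simp]: "renyi_integrand \<alpha> 0 q = 0"
  by (simp add: renyi_integrand_def)

lemma renyi_integrand_measurable [measurable]: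
  assumes [measurable]: "p \<in> borel_measurable M" "q \<in> borel_measurable M"
  shows "(\<lambda>y. renyi_integrand \<alpha> (p y) (q y)) \<in> borel_measurable M"
  unfolding renyi_integrand_def by measurable

lemma AE_iff_of_AE:
  assumes "AE y in M. P y \<longleftrightarrow> Q y"
  shows "(AE y in M. P y) \<longleftrightarrow> (AE y in M. Q y)"
proof
  assume "AE y in M. P y"
  with assms show "AE y in M. Q y" by eventually_elim simp
next
  assume "AE y in M. Q y"
  with assms show "AE y in M. P y" by eventually_elim simp
qed

text \<open>Values of the second density where the first one vanishes are irrelevant.\<close>
lemma renyi_dens_transfer:
  assumes [measurable]: "h \<in> borel_measurable \<mu>" "p \<in> borel_measurable \<mu>" "q \<in> borel_measurable \<mu>"
      "p' \<in> borel_measurable \<mu>" "q' \<in> borel_measurable \<mu>"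
    and nonneg: "\<And>y. 0 \<le> h y" "\<And>y. 0 \<le> p y" "\<And>y. 0 \<le> q y"
    and \<nu>: "\<nu> = density \<mu> (\<lambda>y. ennreal (h y))"
    and ae: "AE y in \<mu>. p' y = h y * p y \<and> (p' y > 0 \<longrightarrow> q' y = h y * q y)"
  shows "renyi_dens \<alpha> \<nu> p q = renyi_dens \<alpha> \<mu> p' q'"
proof -
  have I: "(\<integral>\<^sup>+ y. renyi_integrand \<alpha> (p y) (q y) \<partial>\<nu>) = (\<integral>\<^sup>+ y. renyi_integrand \<alpha> (p' y) (q' y) \<partial>\<mu>)"
  proof -
    have "(\<integral>\<^sup>+ y. renyi_integrand \<alpha> (p y) (q y) \<partial>\<nu>) = (\<integral>\<^sup>+ y. ennreal (h y) * renyi_integrand \<alpha> (p y) (q y) \<partial>\<mu>)"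
      unfolding \<nu> by (subst nn_integral_density) auto
    also have "\<dots> = (\<integral>\<^sup>+ y. renyi_integrand \<alpha> (p' y) (q' y) \<partial>\<mu>)"
    proof (rule nn_integral_cong_AE)
      from ae show "AE y in \<mu>. ennreal (h y) * renyi_integrand \<alpha> (p y) (q y) = renyi_integrand \<alpha> (p' y) (q' y)"
      proof eventually_elim
        case (elim y)
        show ?case
        proof (cases "h y * p y = 0")
          case True
          then show ?thesis using elim by auto
        next
          case False
          then have "0 < h y" "0 < p y" using nonneg[of y] by (auto simp: less_le)
          with elim show ?thesis using nonneg[of y] by (simp add: renyi_integrand_scale)
        qed
      qed
    qed
    finally show ?thesis .
  qed
  have H: "AE y in \<mu>. (0 < h y \<longrightarrow> \<not> (q y = 0 \<and> p y > 0)) \<longleftrightarrow> \<not> (q' y = 0 \<and> p' y > 0)"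
    using ae
  proof eventually_elim
    case (elim y)
    then show ?case using nonneg[of y] by (auto simp: zero_less_mult_iff less_le)
  qed
  have E: "emeasure \<nu> {y \<in> space \<nu>. q y = 0 \<and> p y > 0} = 0 \<longleftrightarrow> emeasure \<mu> {y \<in> space \<mu>. q' y = 0 \<and> p' y > 0} = 0"
  proof -
    have "emeasure \<nu> {y \<in> space \<nu>. q y = 0 \<and> p y > 0} = 0 \<longleftrightarrow> (AE y in \<nu>. \<not> (q y = 0 \<and> p y > 0))"
      by (subst AE_iff_measurable[OF _ refl]) (auto simp: \<nu>)
    also have "\<dots> \<longleftrightarrow> (AE y in \<mu>. 0 < h y \<longrightarrow> \<not> (q y = 0 \<and> p y > 0))"
      unfolding \<nu> by (subst AE_density) auto
    also have "\<dots> \<longleftrightarrow> (AE y in \<mu>. \<not> (q' y = 0 \<and> p' y > 0))"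
      by (rule AE_iff_of_AE[OF H])
    also have "\<dots> \<longleftrightarrow> emeasure \<mu> {y \<in> space \<mu>. q' y = 0 \<and> p' y > 0} = 0"
      by (subst AE_iff_measurable[OF _ refl]) auto
    finally show ?thesis .
  qed
  show ?thesis
  proof (cases "\<alpha> = 1 \<and> emeasure \<mu> {y \<in> space \<mu>. q' y = 0 \<and> p' y > 0} = 0")
    case False
    then show ?thesis using I E by (auto simp: renyi_dens_def)
  next
    case True
    then have "AE y in \<mu>. \<not> (q' y = 0 \<and> p' y > 0)"
      by (subst AE_iff_measurable[OF _ refl]) auto
    with ae have L: "AE y in \<mu>. h y *\<^sub>R (p y * (ln (p y) - ln (q y))) = p' y * (ln (p' y) - ln (q' y))"
    proof eventually_elim
      case (elim y)
      show ?case
      proof (cases "h y * p y = 0")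
        case True
        then show ?thesis using elim by auto
      next
        case False
        then have "0 < h y" "0 < p y" using nonneg[of y] by (auto simp: less_le)
        moreover from this have "0 < q y" using elim nonneg[of y] by (auto simp: less_le)
        ultimately show ?thesis using elim by (simp add: ln_mult algebra_simps)
      qed
    qed
    have i: "integrable \<mu> (\<lambda>y. h y *\<^sub>R (p y * (ln (p y) - ln (q y)))) \<longleftrightarrow> integrable \<mu> (\<lambda>y. p' y * (ln (p' y) - ln (q' y)))"
      "(\<integral>y. h y *\<^sub>R (p y * (ln (p y) - ln (q y))) \<partial>\<mu>) = (\<integral>y. p' y * (ln (p' y) - ln (q' y)) \<partial>\<mu>)"
      by (rule integrable_cong_AE[OF _ _ L] integral_cong_AE[OF _ _ L]; simp)+
    have "integrable \<nu> (\<lambda>y. p y * (ln (p y) - ln (q y))) \<longleftrightarrow> integrable \<mu> (\<lambda>y. p' y * (ln (p' y) - ln (q' y)))"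
      unfolding \<nu> i(1)[symmetric] by (rule integrable_density) (auto simp: nonneg)
    moreover have "(\<integral>y. p y * (ln (p y) - ln (q y)) \<partial>\<nu>) = (\<integral>y. p' y * (ln (p' y) - ln (q' y)) \<partial>\<mu>)"
      unfolding \<nu> i(2)[symmetric] by (rule integral_density) (auto simp: nonneg)
    ultimately show ?thesis using True E by (simp add: renyi_dens_def)
  qed
qed

section \<open>Densities with respect to the mixture of two measures\<close>

lemma sets_ref_meas:
  assumes "prob_space P" "prob_space Q" "sets Q = sets P"
  shows "sets (ref_meas P Q) = sets P"
    and "A \<in> sets P \<Longrightarrow> emeasure (ref_meas P Q) A = (emeasure P A + emeasure Q A) / 2"
proof -
  have m: "(\<lambda>b. if b then P else Q) \<in> measurable (measure_pmf (bernoulli_pmf (1/2))) (subprob_algebra P)"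
    using assms by (auto simp: measurable_def space_subprob_algebra prob_space_imp_subprob_space)
  show "sets (ref_meas P Q) = sets P"
    unfolding ref_meas_def using assms by (intro sets_bind) auto
  assume A: "A \<in> sets P"
  have "emeasure (ref_meas P Q) A = (\<integral>\<^sup>+b. emeasure (if b then P else Q) A \<partial>measure_pmf (bernoulli_pmf (1/2)))"
    unfolding ref_meas_def using A by (intro emeasure_bind[OF _ m]) auto
  also have "\<dots> = emeasure P A * ennreal (1/2) + emeasure Q A * ennreal (1/2)"
    by (subst nn_integral_bernoulli_pmf) auto
  also have "\<dots> = (emeasure P A + emeasure Q A) / 2"
  proof -
    interpret P: prob_space P by fact
    interpret Q: prob_space Q by fact
    have "emeasure P A * ennreal (1/2) + emeasure Q A * ennreal (1/2) = ennreal ((P.prob A + Q.prob A) / 2)"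
      unfolding P.emeasure_eq_measure Q.emeasure_eq_measure
      by (subst (1 2) ennreal_mult[symmetric]) (simp_all flip: ennreal_plus add: add_divide_distrib)
    also have "\<dots> = ennreal (P.prob A + Q.prob A) / ennreal 2"
      by (rule divide_ennreal[symmetric]) auto
    finally show ?thesis
      unfolding P.emeasure_eq_measure Q.emeasure_eq_measure by (simp add: ennreal_plus)
  qed
  finally show "emeasure (ref_meas P Q) A = (emeasure P A + emeasure Q A) / 2" .
qed

lemma prob_space_ref_meas:
  assumes "prob_space P" "prob_space Q" "sets Q = sets P"
  shows "prob_space (ref_meas P Q)"
proof (rule prob_spaceI)
  interpret P: prob_space P by fact
  interpret Q: prob_space Q by fact
  have sp: "space (ref_meas P Q) = space P" "space Q = space P"
    using sets_ref_meas(1)[OF assms] assms(3) by (auto dest: sets_eq_imp_space_eq)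
  show "emeasure (ref_meas P Q) (space (ref_meas P Q)) = 1"
    using sets_ref_meas(2)[OF assms, of "space P"] P.emeasure_space_1 Q.emeasure_space_1
    by (simp add: sp)
qed

lemma dens_measurable [measurable]:
  assumes "prob_space P" "prob_space Q" "sets Q = sets P"
  shows "dens1 P Q \<in> borel_measurable P" "dens2 P Q \<in> borel_measurable P"
  unfolding dens1_def dens2_def using sets_ref_meas(1)[OF assms]
  by (auto simp: measurable_cong_sets[OF sets_ref_meas(1)[OF assms] refl, symmetric])

lemma dens_nonneg: "0 \<le> dens1 P Q y" "0 \<le> dens2 P Q y"
  by (auto simp: dens1_def dens2_def)

lemma density_ref_meas:
  assumes PQ: "prob_space P" "prob_space Q" "sets Q = sets P"
  shows "density (ref_meas P Q) (\<lambda>y. ennreal (dens1 P Q y)) = P"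
    and "density (ref_meas P Q) (\<lambda>y. ennreal (dens2 P Q y)) = Q"
proof -
  interpret P: prob_space P by fact
  interpret Q: prob_space Q by fact
  interpret R: prob_space "ref_meas P Q" by (rule prob_space_ref_meas[OF PQ])
  note ref = sets_ref_meas[OF PQ]
  have acP: "absolutely_continuous (ref_meas P Q) P"
    unfolding absolutely_continuous_def using ref by (auto simp: null_sets_def add_eq_0_iff_both_eq_0)
  have acQ: "absolutely_continuous (ref_meas P Q) Q"
    unfolding absolutely_continuous_def using ref PQ by (auto simp: null_sets_def add_eq_0_iff_both_eq_0)
  have P: "density (ref_meas P Q) (RN_deriv (ref_meas P Q) P) = P"
    using acP ref by (intro R.density_RN_deriv) auto
  have Q: "density (ref_meas P Q) (RN_deriv (ref_meas P Q) Q) = Q"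
    using acQ ref PQ by (intro R.density_RN_deriv) auto
  have "AE y in ref_meas P Q. RN_deriv (ref_meas P Q) P y \<noteq> \<infinity>"
    using R.RN_deriv_finite[OF P.sigma_finite_measure_axioms acP] ref by auto
  then have "density (ref_meas P Q) (\<lambda>y. ennreal (dens1 P Q y)) = density (ref_meas P Q) (RN_deriv (ref_meas P Q) P)"
    unfolding dens1_def by (intro density_cong) (auto simp: top.not_eq_extremum)
  then show "density (ref_meas P Q) (\<lambda>y. ennreal (dens1 P Q y)) = P" using P by simp
  have "AE y in ref_meas P Q. RN_deriv (ref_meas P Q) Q y \<noteq> \<infinity>"
    using R.RN_deriv_finite[OF Q.sigma_finite_measure_axioms acQ] ref PQ by auto
  then have "density (ref_meas P Q) (\<lambda>y. ennreal (dens2 P Q y)) = density (ref_meas P Q) (RN_deriv (ref_meas P Q) Q)"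
    unfolding dens2_def by (intro density_cong) (auto simp: top.not_eq_extremum)
  then show "density (ref_meas P Q) (\<lambda>y. ennreal (dens2 P Q y)) = Q" using Q by simp
qed

lemma real_density_unique:
  assumes f: "f \<in> borel_measurable M" and g: "g \<in> borel_measurable M"
    and nonneg: "\<And>y. 0 \<le> f y" "\<And>y. 0 \<le> g y"
    and eq: "density M (\<lambda>y. ennreal (f y)) = density M (\<lambda>y. ennreal (g y))"
    and fin: "finite_measure (density M (\<lambda>y. ennreal (f y)))"
  shows "AE y in M. f y = (g y :: real)"
proof -
  interpret finite_measure "density M (\<lambda>y. ennreal (f y))" by (rule fin)
  have "AE y in M. ennreal (f y) = ennreal (g y)"
    using f g eq sigma_finite_measure_axioms
    by (subst sigma_finite_density_unique[symmetric]) auto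
  then show ?thesis using nonneg by auto
qed

text \<open>Any measure dominating P and Q gives concrete versions of \<open>dens1\<close> and
  \<open>dens2\<close>, which are defined only as abstract derivatives. The identification rests on
  uniqueness of densities and so holds almost everywhere.\<close>

lemma ref_meas_density:
  assumes PQ: "prob_space P" "prob_space Q"
    and [measurable]: "w \<in> borel_measurable \<mu>" "r \<in> borel_measurable \<mu>"
    and nonneg: "\<And>y. 0 \<le> w y" "\<And>y. 0 \<le> r y"
    and P: "P = density \<mu> (\<lambda>y. ennreal (w y))" and Q: "Q = density \<mu> (\<lambda>y. ennreal (r y))"
  shows "ref_meas P Q = density \<mu> (\<lambda>y. ennreal ((w y + r y) / 2))"
    and "AE y in \<mu>. w y = (w y + r y) / 2 * dens1 P Q y \<and> r y = (w y + r y) / 2 * dens2 P Q y"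
proof -
  have s: "sets Q = sets P" "sets P = sets \<mu>" by (simp_all add: P Q)
  note ref = sets_ref_meas[OF PQ s(1)]
  show eq: "ref_meas P Q = density \<mu> (\<lambda>y. ennreal ((w y + r y) / 2))"
  proof (rule measure_eqI)
    fix A assume "A \<in> sets (ref_meas P Q)"
    then have A: "A \<in> sets \<mu>" "A \<in> sets P" using ref s by auto
    have "emeasure (ref_meas P Q) A = (emeasure P A + emeasure Q A) / 2" using ref A by simp
    also have "\<dots> = ((\<integral>\<^sup>+y. ennreal (w y) * indicator A y \<partial>\<mu>) + (\<integral>\<^sup>+y. ennreal (r y) * indicator A y \<partial>\<mu>)) / 2"
      using A by (simp add: P Q emeasure_density)
    also have "\<dots> = (\<integral>\<^sup>+y. (ennreal (w y) * indicator A y + ennreal (r y) * indicator A y) / 2 \<partial>\<mu>)"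
      using A by (subst nn_integral_divide) (auto simp: nn_integral_add)
    also have "\<dots> = (\<integral>\<^sup>+y. ennreal ((w y + r y) / 2) * indicator A y \<partial>\<mu>)"
      using nonneg
      by (intro nn_integral_cong)
        (auto split: split_indicator simp: divide_ennreal[symmetric] ennreal_plus)
    also have "\<dots> = emeasure (density \<mu> (\<lambda>y. ennreal ((w y + r y) / 2))) A"
      using A by (subst emeasure_density) auto
    finally show "emeasure (ref_meas P Q) A = emeasure (density \<mu> (\<lambda>y. ennreal ((w y + r y) / 2))) A" .
  qed (use ref s in auto)
  have [measurable]: "dens1 P Q \<in> borel_measurable \<mu>" "dens2 P Q \<in> borel_measurable \<mu>"
    using dens_measurable[OF PQ s(1)] by (simp_all add: measurable_cong_sets[OF s(2) refl])
  note nn = nonneg dens_nonneg[of P Q]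
  have one: "density \<mu> (\<lambda>y. ennreal ((w y + r y) / 2 * dens1 P Q y)) = P"
  proof -
    have "density \<mu> (\<lambda>y. ennreal ((w y + r y) / 2 * dens1 P Q y)) = density \<mu> (\<lambda>y. ennreal ((w y + r y) / 2) * ennreal (dens1 P Q y))"
      by (intro density_cong AE_I2 ennreal_mult) (auto simp: nn)
    also have "\<dots> = density (ref_meas P Q) (\<lambda>y. ennreal (dens1 P Q y))"
      unfolding eq by (rule density_density_eq[symmetric]) simp_all
    finally show ?thesis using density_ref_meas(1)[OF PQ s(1)] by simp
  qed
  have 1: "AE y in \<mu>. w y = (w y + r y) / 2 * dens1 P Q y"
  proof (rule real_density_unique[OF _ _ _ _ trans[OF P[symmetric] one[symmetric]]])
    show "finite_measure (density \<mu> (\<lambda>y. ennreal (w y)))"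
      unfolding P[symmetric] by (rule prob_space.finite_measure[OF PQ(1)])
  qed (simp_all add: nn)
  have two: "density \<mu> (\<lambda>y. ennreal ((w y + r y) / 2 * dens2 P Q y)) = Q"
  proof -
    have "density \<mu> (\<lambda>y. ennreal ((w y + r y) / 2 * dens2 P Q y)) = density \<mu> (\<lambda>y. ennreal ((w y + r y) / 2) * ennreal (dens2 P Q y))"
      by (intro density_cong AE_I2 ennreal_mult) (auto simp: nn)
    also have "\<dots> = density (ref_meas P Q) (\<lambda>y. ennreal (dens2 P Q y))"
      unfolding eq by (rule density_density_eq[symmetric]) simp_all
    finally show ?thesis using density_ref_meas(2)[OF PQ s(1)] by simp
  qed
  have 2: "AE y in \<mu>. r y = (w y + r y) / 2 * dens2 P Q y"
  proof (rule real_density_unique[OF _ _ _ _ trans[OF Q[symmetric] two[symmetric]]])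
    show "finite_measure (density \<mu> (\<lambda>y. ennreal (r y)))"
      unfolding Q[symmetric] by (rule prob_space.finite_measure[OF PQ(2)])
  qed (simp_all add: nn)
  from 1 2 show "AE y in \<mu>. w y = (w y + r y) / 2 * dens1 P Q y \<and> r y = (w y + r y) / 2 * dens2 P Q y"
    by eventually_elim auto
qed

lemma ac_dens_measurable [measurable]:
  assumes "prob_space P" "prob_space Q" "sets Q = sets P"
  shows "ac_dens P Q \<in> borel_measurable P"
  unfolding ac_dens_def using dens_measurable[OF assms] by measurable

lemma ac_dens_nonneg: "0 \<le> ac_dens P Q y"
  by (simp add: ac_dens_def dens_nonneg)

text \<open>Q itself is taken as the dominating measure. Its density is 1, so the weight
  \<open>(g y + 1) / 2\<close> is positive and can be cancelled.\<close>

lemma ac_dens_unique: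
  assumes PQ: "prob_space P" "prob_space Q"
    and [measurable]: "g \<in> borel_measurable Q" and nonneg: "\<And>y. 0 \<le> g y"
    and P: "P = density Q (\<lambda>y. ennreal (g y))"
  shows "AE y in Q. ac_dens P Q y = g y"
proof -
  have "AE y in Q. g y = (g y + 1) / 2 * dens1 P Q y \<and> 1 = (g y + 1) / 2 * dens2 P Q y"
    using nonneg by (intro ref_meas_density(2)[OF PQ _ _ _ _ P]) (auto simp: density_1)
  then show ?thesis
  proof eventually_elim
    case (elim y)
    have "0 < dens2 P Q y"
      using elim nonneg[of y] dens_nonneg(2)[of P Q y] by (auto simp: less_le)
    moreover have "dens1 P Q y = g y * dens2 P Q y"
    proof -
      define h where "h = (g y + 1) / 2"
      have "h * dens1 P Q y = g y" "h * dens2 P Q y = 1" using elim by (simp_all add: h_def)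
      then have "h * dens1 P Q y = h * (g y * dens2 P Q y)" by (simp add: mult.left_commute)
      moreover have "h \<noteq> 0" using nonneg[of y] by (simp add: h_def)
      ultimately show ?thesis by simp
    qed
    ultimately show ?case by (simp add: ac_dens_def)
  qed
qed

text \<open>Q may have a part singular to q; W has no mass there, and at such points the transfer
  lemma does not look at the second density. The reference passes from the mixture of W and Q to
  that of Q and q, and from there to q.\<close>

lemma renyi_div_density:
  assumes P: "prob_space q" "prob_space Q" "prob_space W" and s: "sets Q = sets q"
    and [measurable]: "g \<in> borel_measurable q" and nonneg: "\<And>y. 0 \<le> g y"
    and W: "W = density q (\<lambda>y. ennreal (g y))"
  shows "renyi_div \<alpha> W Q = renyi_dens \<alpha> q g (ac_dens Q q)"
proof -
  define \<mu> where "\<mu> = ref_meas Q q"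
  have s': "sets q = sets Q" using s by simp
  have sm: "sets \<mu> = sets Q" unfolding \<mu>_def by (rule sets_ref_meas(1)[OF P(2,1) s'])
  define d1 where "d1 = dens1 Q q"
  define d2 where "d2 = dens2 Q q"
  have [measurable]: "d1 \<in> borel_measurable \<mu>" "d2 \<in> borel_measurable \<mu>" "g \<in> borel_measurable \<mu>" "ac_dens Q q \<in> borel_measurable \<mu>"
    using dens_measurable[OF P(2,1) s'] ac_dens_measurable[OF P(2,1) s'] assms(5)
    by (simp_all add: d1_def d2_def measurable_cong_sets[OF sm refl] measurable_cong_sets[OF s refl])
  have d: "0 \<le> d1 y" "0 \<le> d2 y" for y by (simp_all add: d1_def d2_def dens_nonneg)
  have Q: "Q = density \<mu> (\<lambda>y. ennreal (d1 y))" and q: "q = density \<mu> (\<lambda>y. ennreal (d2 y))"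
    using density_ref_meas[OF P(2,1) s'] by (simp_all add: \<mu>_def d1_def d2_def)
  have W': "W = density \<mu> (\<lambda>y. ennreal (d2 y * g y))"
    unfolding W by (subst q, subst density_density_eq) (auto simp: ennreal_mult d nonneg)
  note rm = ref_meas_density[OF P(3,2) _ _ _ _ W' Q]
  have sW: "sets Q = sets W" "sets W = sets \<mu>" using s sm by (simp_all add: W)
  have [measurable]: "dens1 W Q \<in> borel_measurable \<mu>" "dens2 W Q \<in> borel_measurable \<mu>"
    using dens_measurable[OF P(3,2) sW(1)] by (simp_all add: measurable_cong_sets[OF sW(2) refl])
  have "renyi_div \<alpha> W Q = renyi_dens \<alpha> (ref_meas W Q) (dens1 W Q) (dens2 W Q)"
    by (rule renyi_div_eq_dens)
  also have "\<dots> = renyi_dens \<alpha> \<mu> (\<lambda>y. d2 y * g y) d1"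
  proof (rule renyi_dens_transfer[where h = "\<lambda>y. (d2 y * g y + d1 y) / 2"])
    show "ref_meas W Q = density \<mu> (\<lambda>y. ennreal ((d2 y * g y + d1 y) / 2))"
      by (rule rm(1)) (auto simp: d nonneg)
    have "AE y in \<mu>. d2 y * g y = (d2 y * g y + d1 y) / 2 * dens1 W Q y \<and> d1 y = (d2 y * g y + d1 y) / 2 * dens2 W Q y"
      by (rule rm(2)) (auto simp: d nonneg)
    then show "AE y in \<mu>. d2 y * g y = (d2 y * g y + d1 y) / 2 * dens1 W Q y \<and>
        (0 < d2 y * g y \<longrightarrow> d1 y = (d2 y * g y + d1 y) / 2 * dens2 W Q y)"
      by eventually_elim auto
  qed (auto simp: d nonneg dens_nonneg)
  also have "\<dots> = renyi_dens \<alpha> q g (ac_dens Q q)"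
  proof (rule renyi_dens_transfer[where h = d2, symmetric])
    show "AE y in \<mu>. d2 y * g y = d2 y * g y \<and> (0 < d2 y * g y \<longrightarrow> d1 y = d2 y * ac_dens Q q y)"
      using d nonneg by (auto simp: ac_dens_def d1_def d2_def zero_less_mult_iff less_le)
  qed (auto simp: d nonneg q[symmetric] ac_dens_nonneg)
  finally show ?thesis .
qed

text \<open>The absolutely continuous part is dominated by Q, which gives mass at most 1. If its
  density is 1, then Q is at least q on every set and on its complement, and equal total masses
  force equality.\<close>

lemma ac_dens_integral_le:
  assumes P: "prob_space q" "prob_space Q" and s: "sets Q = sets q"
  shows "(\<integral>\<^sup>+y. ennreal (ac_dens Q q y) \<partial>q) \<le> 1"
    and "(AE y in q. ac_dens Q q y = 1) \<Longrightarrow> Q = q"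
proof -
  define \<mu> where "\<mu> = ref_meas Q q"
  have s': "sets q = sets Q" using s by simp
  interpret Q: prob_space Q by fact
  interpret q: prob_space q by fact
  have sm: "sets \<mu> = sets Q" unfolding \<mu>_def by (rule sets_ref_meas(1)[OF P(2,1) s'])
  define d1 where "d1 = dens1 Q q"
  define d2 where "d2 = dens2 Q q"
  have [measurable]: "d1 \<in> borel_measurable \<mu>" "d2 \<in> borel_measurable \<mu>" "ac_dens Q q \<in> borel_measurable \<mu>"
    using dens_measurable[OF P(2,1) s'] ac_dens_measurable[OF P(2,1) s']
    by (simp_all add: d1_def d2_def measurable_cong_sets[OF sm refl])
  have d: "0 \<le> d1 y" "0 \<le> d2 y" for y by (simp_all add: d1_def d2_def dens_nonneg)
  have Q: "Q = density \<mu> (\<lambda>y. ennreal (d1 y))" and q: "q = density \<mu> (\<lambda>y. ennreal (d2 y))"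
    using density_ref_meas[OF P(2,1) s'] by (simp_all add: \<mu>_def d1_def d2_def)
  have le: "emeasure (density q (\<lambda>y. ennreal (ac_dens Q q y))) A \<le> emeasure Q A" if A: "A \<in> sets Q" for A
  proof -
    have [measurable]: "A \<in> sets \<mu>" using A sm by simp
    have "emeasure (density q (\<lambda>y. ennreal (ac_dens Q q y))) A = (\<integral>\<^sup>+y. ennreal (d2 y * ac_dens Q q y) * indicator A y \<partial>\<mu>)"
      by (subst q, subst density_density_eq, simp, simp, subst emeasure_density)
        (auto simp: ennreal_mult d ac_dens_nonneg)
    also have "\<dots> \<le> (\<integral>\<^sup>+y. ennreal (d1 y) * indicator A y \<partial>\<mu>)"
      by (intro nn_integral_mono mult_right_mono ennreal_leI) (auto simp: ac_dens_def d1_def d2_def dens_nonneg)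
    also have "\<dots> = emeasure Q A" by (subst Q) (simp add: emeasure_density)
    finally show ?thesis .
  qed
  have [measurable]: "ac_dens Q q \<in> borel_measurable q"
    using ac_dens_measurable[OF P(2,1) s'] by (simp add: measurable_cong_sets[OF s refl])
  have "(\<integral>\<^sup>+y. ennreal (ac_dens Q q y) \<partial>q) = emeasure (density q (\<lambda>y. ennreal (ac_dens Q q y))) (space q)"
    by (subst emeasure_density) (auto intro!: nn_integral_cong)
  also have "\<dots> \<le> emeasure Q (space q)" using s by (intro le) auto
  also have "\<dots> \<le> 1" by (rule Q.emeasure_le_1)
  finally show "(\<integral>\<^sup>+y. ennreal (ac_dens Q q y) \<partial>q) \<le> 1" .
  assume one: "AE y in q. ac_dens Q q y = 1"
  have "density q (\<lambda>y. ennreal (ac_dens Q q y)) = density q (\<lambda>y. 1)"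
    using one by (intro density_cong) auto
  then have le': "emeasure q A \<le> emeasure Q A" if "A \<in> sets Q" for A
    using le[OF that] by (simp add: density_1)
  show "Q = q"
  proof (rule measure_eqI)
    fix A assume A: "A \<in> sets Q"
    have "Q.prob A \<ge> q.prob A" "Q.prob (space Q - A) \<ge> q.prob (space Q - A)"
      using le'[of A] le'[of "space Q - A"] A by (auto simp: Q.emeasure_eq_measure q.emeasure_eq_measure)
    moreover have "q.prob (space Q - A) = 1 - q.prob A" "Q.prob (space Q - A) = 1 - Q.prob A"
      using A s sets_eq_imp_space_eq[OF s] q.prob_compl[of A] Q.prob_compl[of A] by auto
    ultimately show "emeasure Q A = emeasure q A" by (simp add: Q.emeasure_eq_measure q.emeasure_eq_measure)
  qed (rule s)
qed

section \<open>Tilting\<close>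

text \<open>\<open>ennreal\<close> cuts negative values off at 0. The tangent functions that replace
  Jensen's inequality below do become negative.\<close>

lemma ennreal_integral_le_nn_integral:
  assumes "integrable M (g :: _ \<Rightarrow> real)"
  shows "ennreal (integral\<^sup>L M g) \<le> (\<integral>\<^sup>+y. ennreal (g y) \<partial>M)"
proof -
  have "integral\<^sup>L M g \<le> (\<integral>y. max 0 (g y) \<partial>M)"
    using assms by (intro integral_mono) auto
  then have "ennreal (integral\<^sup>L M g) \<le> ennreal (\<integral>y. max 0 (g y) \<partial>M)" by (rule ennreal_leI)
  also have "\<dots> = (\<integral>\<^sup>+y. ennreal (max 0 (g y)) \<partial>M)"
    using assms by (intro nn_integral_eq_integral[symmetric]) auto
  finally show ?thesis by (simp only: ennreal_max_0)
qed

text \<open>Near 0 the logarithm is tamed by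
  \<open>- \<beta> * ln a \<le> exp (- \<beta> * ln a)\<close>; above 1 the bound K takes over. At a
  = 0 the power vanishes, so the value of \<open>ln 0\<close> is harmless.\<close>

lemma powr_mult_ln_bound:
  fixes \<beta> K a :: real
  assumes "0 < \<beta>" "1 \<le> K" "0 \<le> a" "a \<le> K"
  shows "\<bar>a powr \<beta> * ln a\<bar> \<le> 1 / \<beta> + K powr \<beta> * K"
proof (cases "a \<le> 1")
  case True
  show ?thesis
  proof (cases "a = 0")
    case False
    then have a: "0 < a" using assms by simp
    have "- \<beta> * ln a \<le> exp (- \<beta> * ln a)" using exp_ge_add_one_self[of "- \<beta> * ln a"] by linarith
    then have "a powr \<beta> * (- \<beta> * ln a) \<le> a powr \<beta> * exp (- \<beta> * ln a)"
      by (rule mult_left_mono) simp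
    also have "\<dots> = 1" using a by (simp add: powr_def mult_exp_exp)
    finally have "\<beta> * \<bar>a powr \<beta> * ln a\<bar> \<le> 1"
      using True a by (simp add: abs_mult abs_of_nonpos ln_le_zero_iff mult_ac)
    then have "\<bar>a powr \<beta> * ln a\<bar> \<le> 1 / \<beta>" using assms by (simp add: field_simps)
    moreover have "0 \<le> K powr \<beta> * K" using assms by simp
    ultimately show ?thesis by linarith
  qed (use assms in simp)
next
  case False
  then have "ln a \<le> K" using ln_le_minus_one[of a] assms by linarith
  moreover have "a powr \<beta> \<le> K powr \<beta>" using False assms by (intro powr_mono2) auto
  ultimately have "a powr \<beta> * ln a \<le> K powr \<beta> * K"
    using False assms by (intro mult_mono) auto
  moreover have "0 \<le> 1 / \<beta>" using assms by simp
  moreover have "\<bar>a powr \<beta> * ln a\<bar> = a powr \<beta> * ln a" using False by simp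
  ultimately show ?thesis by linarith
qed

text \<open>A second-order expansion in the exponent whose remainder is uniform over a in
  \<open>{0..K}\<close>. The Lagrange remainder carries the square of \<open>ln a\<close>, unbounded
  near 0; restricting h to half of \<beta> leaves the power \<open>\<beta> / 2\<close> of a to
  absorb it.\<close>

lemma powr_taylor_le:
  fixes \<beta> K a h :: real
  assumes \<beta>: "0 < \<beta>" and K: "1 \<le> K" and a: "0 \<le> a" "a \<le> K" and h: "\<bar>h\<bar> \<le> \<beta> / 2"
  shows "a powr (\<beta> + h) \<le> a powr \<beta> + h * (a powr \<beta> * ln a) + (4 / \<beta>\<^sup>2 + K\<^sup>2 * K powr (2 * \<beta>)) * h\<^sup>2"
proof (cases "a = 0")
  case True
  then show ?thesis by simp
next
  case False
  define l where "l = ln a"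
  define C where "C = 4 / \<beta>\<^sup>2 + K\<^sup>2 * K powr (2 * \<beta>)"
  have a0: "0 < a" using a False by simp
  obtain t where t: "\<bar>t\<bar> \<le> \<bar>h * l\<bar>" "exp (h * l) = (\<Sum>m<2. (h * l) ^ m / fact m) + exp t / fact 2 * (h * l) ^ 2"
    using Maclaurin_exp_le[of "h * l" 2] by blast
  have ht: "exp t \<le> exp (\<beta> / 2 * \<bar>l\<bar>)"
    using t(1) mult_right_mono[OF h, of "\<bar>l\<bar>"] by (simp add: abs_mult)
  have bound: "exp (\<beta> * l) * exp (\<beta> / 2 * \<bar>l\<bar>) * l\<^sup>2 / 2 \<le> C"
  proof (cases "l \<le> 0")
    case True
    define y where "y = \<beta> / 2 * \<bar>l\<bar>"
    have y: "0 \<le> y" using \<beta> by (simp add: y_def)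
    have "exp (\<beta> * l) * exp (\<beta> / 2 * \<bar>l\<bar>) = exp (- y)"
      using True by (simp add: y_def mult_exp_exp field_simps)
    moreover have "l\<^sup>2 / 2 = 4 / \<beta>\<^sup>2 * (y\<^sup>2 / 2)"
      using \<beta> by (simp add: y_def power_mult_distrib power_divide)
    moreover have "exp (- y) * (y\<^sup>2 / 2) \<le> 1"
    proof -
      have "y\<^sup>2 / 2 \<le> exp y" using exp_lower_Taylor_quadratic[OF y] y by linarith
      then have "exp (- y) * (y\<^sup>2 / 2) \<le> exp (- y) * exp y" by (intro mult_left_mono) auto
      then show ?thesis by (simp add: mult_exp_exp)
    qed
    ultimately have "exp (\<beta> * l) * exp (\<beta> / 2 * \<bar>l\<bar>) * (l\<^sup>2 / 2) \<le> 4 / \<beta>\<^sup>2 * 1"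
      using mult_left_mono[of "exp (- y) * (y\<^sup>2 / 2)" 1 "4 / \<beta>\<^sup>2"] by (simp add: mult_ac)
    moreover have "0 \<le> K\<^sup>2 * K powr (2 * \<beta>)" by simp
    moreover have "exp (\<beta> * l) * exp (\<beta> / 2 * \<bar>l\<bar>) * l\<^sup>2 / 2 = exp (\<beta> * l) * exp (\<beta> / 2 * \<bar>l\<bar>) * (l\<^sup>2 / 2)" by simp
    ultimately show ?thesis unfolding C_def by linarith
  next
    case False
    have lK: "l \<le> K" using ln_le_minus_one[OF a0] a by (simp add: l_def)
    have "exp (\<beta> * l) * exp (\<beta> / 2 * \<bar>l\<bar>) \<le> exp (2 * \<beta> * l)"
      using False \<beta> by (simp add: mult_exp_exp)
    also have "\<dots> = a powr (2 * \<beta>)" using a0 by (simp add: powr_def l_def)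
    also have "\<dots> \<le> K powr (2 * \<beta>)" using a \<beta> by (intro powr_mono2) auto
    finally have 1: "exp (\<beta> * l) * exp (\<beta> / 2 * \<bar>l\<bar>) \<le> K powr (2 * \<beta>)" .
    have "l\<^sup>2 \<le> K\<^sup>2" using lK False by (intro power_mono) auto
    moreover have "0 \<le> l\<^sup>2" by simp
    ultimately have "l\<^sup>2 / 2 \<le> K\<^sup>2" by linarith
    with 1 have "exp (\<beta> * l) * exp (\<beta> / 2 * \<bar>l\<bar>) * (l\<^sup>2 / 2) \<le> K powr (2 * \<beta>) * K\<^sup>2"
      by (intro mult_mono) auto
    moreover have "0 \<le> 4 / \<beta>\<^sup>2" by simp
    moreover have "exp (\<beta> * l) * exp (\<beta> / 2 * \<bar>l\<bar>) * l\<^sup>2 / 2 = exp (\<beta> * l) * exp (\<beta> / 2 * \<bar>l\<bar>) * (l\<^sup>2 / 2)" by simp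
    ultimately show ?thesis unfolding C_def by (subst mult.commute[of "K\<^sup>2"]) linarith
  qed
  have "a powr (\<beta> + h) = exp (\<beta> * l) * exp (h * l)"
    using a0 by (simp add: powr_def l_def mult_exp_exp distrib_right)
  also have "exp (h * l) = 1 + h * l + exp t * (h * l)\<^sup>2 / 2"
    using t(2) by (simp add: numeral_2_eq_2)
  also have "exp (\<beta> * l) * \<dots> = exp (\<beta> * l) + h * (exp (\<beta> * l) * l) + exp (\<beta> * l) * exp t * l\<^sup>2 / 2 * h\<^sup>2"
    by (simp add: algebra_simps power_mult_distrib)
  also have "exp (\<beta> * l) * exp t * l\<^sup>2 / 2 * h\<^sup>2 \<le> exp (\<beta> * l) * exp (\<beta> / 2 * \<bar>l\<bar>) * l\<^sup>2 / 2 * h\<^sup>2"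
    using ht by (intro mult_right_mono divide_right_mono mult_left_mono) auto
  also have "\<dots> \<le> C * h\<^sup>2" using bound by (rule mult_right_mono) simp
  finally show ?thesis using a0 by (simp add: C_def l_def powr_def)
qed

lemma exp_eq_one_plus_iff: "exp t = 1 + t \<longleftrightarrow> t = (0 :: real)"
  using ln_eq_minus_one[of "exp t"] by auto

text \<open>Models the density of one letter's output relative to a common output measure. The bound
  will come from the finite support of the input distribution.\<close>

locale bounded_density = prob_space q for q :: "'b measure" +
  fixes a :: "'b \<Rightarrow> real" and K :: real
  assumes a_meas [measurable]: "a \<in> borel_measurable q"
    and a_nonneg: "\<And>y. 0 \<le> a y"
    and a_le: "AE y in q. a y \<le> K"
    and K_ge_1: "1 \<le> K"
begin

lemma integrable_powr: "0 \<le> \<beta> \<Longrightarrow> integrable q (\<lambda>y. a y powr \<beta>)"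
  using a_le a_nonneg by (intro integrable_const_bound[of _ "K powr \<beta>"]) (auto intro!: powr_mono2)

lemma integrable_powr_ln:
  assumes "0 < \<beta>"
  shows "integrable q (\<lambda>y. a y powr \<beta> * ln (a y))"
proof (rule integrable_const_bound)
  show "AE y in q. norm (a y powr \<beta> * ln (a y)) \<le> 1 / \<beta> + K powr \<beta> * K"
    using a_le
  proof eventually_elim
    case (elim y)
    then show ?case using powr_mult_ln_bound[OF assms K_ge_1 a_nonneg elim] by simp
  qed
qed simp

lemma integral_powr_taylor_le:
  assumes \<beta>: "0 < \<beta>" and h: "\<bar>h\<bar> \<le> \<beta> / 2"
  shows "(\<integral>y. a y powr (\<beta> + h) \<partial>q) \<le> (\<integral>y. a y powr \<beta> \<partial>q) + h * (\<integral>y. a y powr \<beta> * ln (a y) \<partial>q)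
    + (4 / \<beta>\<^sup>2 + K\<^sup>2 * K powr (2 * \<beta>)) * h\<^sup>2"
proof -
  have bh: "0 \<le> \<beta> + h" using \<beta> h by (auto simp: abs_if split: if_splits)
  have "(\<integral>y. a y powr (\<beta> + h) \<partial>q) \<le> (\<integral>y. a y powr \<beta> + h * (a y powr \<beta> * ln (a y)) + (4 / \<beta>\<^sup>2 + K\<^sup>2 * K powr (2 * \<beta>)) * h\<^sup>2 \<partial>q)"
  proof (rule integral_mono_AE)
    show "AE y in q. a y powr (\<beta> + h) \<le> a y powr \<beta> + h * (a y powr \<beta> * ln (a y)) + (4 / \<beta>\<^sup>2 + K\<^sup>2 * K powr (2 * \<beta>)) * h\<^sup>2"
      using a_le
    proof eventually_elim
      case (elim y)
      show ?case by (rule powr_taylor_le[OF \<beta> K_ge_1 a_nonneg elim h])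
    qed
  qed (use integrable_powr[OF bh] integrable_powr[of \<beta>] integrable_powr_ln[OF \<beta>] \<beta> in auto)
  also have "\<dots> = (\<integral>y. a y powr \<beta> \<partial>q) + h * (\<integral>y. a y powr \<beta> * ln (a y) \<partial>q) + (4 / \<beta>\<^sup>2 + K\<^sup>2 * K powr (2 * \<beta>)) * h\<^sup>2"
    using integrable_powr[of \<beta>] integrable_powr_ln[OF \<beta>] \<beta>
    by (simp add: prob_space)
  finally show ?thesis .
qed

end

locale tilting = bounded_density +
  fixes \<alpha> :: real
  assumes \<alpha>_pos: "0 < \<alpha>" and Z_pos: "0 < (\<integral>y. a y powr \<alpha> \<partial>q)"
begin

text \<open>Normaliser, tilted density and tilted mean of the log-likelihood. Where \<open>a\<close>
  is 0 so is \<open>v\<close>, hence \<open>ln 0\<close> does not contribute to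
  \<open>E\<close>.\<close>

definition "Z = (\<integral>y. a y powr \<alpha> \<partial>q)"
definition "v y = a y powr \<alpha> / Z"
definition "E = (\<integral>y. v y * ln (a y) \<partial>q)"

lemma Z_pos': "0 < Z" using Z_pos by (simp add: Z_def)

lemma v_meas [measurable]: "v \<in> borel_measurable q"
  unfolding v_def by measurable

lemma v_nonneg: "0 \<le> v y"
  using Z_pos' by (simp add: v_def)

lemma v_pos_iff: "0 < v y \<longleftrightarrow> 0 < a y"
  using Z_pos' a_nonneg[of y] by (auto simp: v_def zero_less_divide_iff less_le)

lemma v_le: "AE y in q. v y \<le> K powr \<alpha> / Z"
  using a_le
proof eventually_elim
  case (elim y)
  then show ?case unfolding v_def using Z_pos' \<alpha>_pos a_nonneg[of y]
    by (intro divide_right_mono powr_mono2) auto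
qed

lemma integrable_v: "integrable q v" and integral_v: "integral\<^sup>L q v = 1"
proof -
  show "integrable q v" unfolding v_def using integrable_powr[of \<alpha>] \<alpha>_pos by simp
  show "integral\<^sup>L q v = 1" unfolding v_def using Z_pos' by (simp add: Z_def)
qed

lemma integrable_v_ln: "integrable q (\<lambda>y. v y * ln (a y))"
proof -
  have "integrable q (\<lambda>y. (a y powr \<alpha> * ln (a y)) / Z)" using integrable_powr_ln[OF \<alpha>_pos] by simp
  then show ?thesis by (simp add: v_def)
qed

lemma integrable_v_mult:
  assumes u: "integrable q u"
  shows "integrable q (\<lambda>y. v y * u y :: real)"
proof -
  have [measurable]: "u \<in> borel_measurable q" using u by simp
  have "integrable q (\<lambda>y. K powr \<alpha> / Z * u y)" using u by simp
  then show ?thesis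
  proof (rule Bochner_Integration.integrable_bound)
    show "AE y in q. norm (v y * u y) \<le> norm (K powr \<alpha> / Z * u y)"
      using v_le
    proof eventually_elim
      case (elim y)
      have "\<bar>v y\<bar> * \<bar>u y\<bar> \<le> \<bar>K powr \<alpha> / Z\<bar> * \<bar>u y\<bar>"
        using elim v_nonneg[of y] Z_pos' by (intro mult_right_mono) auto
      then show ?case unfolding real_norm_def abs_mult .
    qed
  qed simp
qed

context
  fixes \<alpha>' :: real and u :: "'a \<Rightarrow> real"
  assumes \<alpha>': "1 < \<alpha>'" and u: "integrable q u" and u_nonneg: "\<And>y. 0 \<le> u y"
begin

text \<open>Exponent of a lower bound \<open>v * exp expo\<close> for the Renyi integrand:
  \<open>a powr \<alpha>'\<close> equals \<open>v * Z * a powr (\<alpha>' - \<alpha>)\<close>, and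
  \<open>u powr (1 - \<alpha>')\<close> is estimated by \<open>ln u \<le> u - 1\<close>. Its
  companion \<open>mean_expo\<close> is the integral of \<open>expo\<close> against v.\<close>

definition "expo y = (\<alpha>' - \<alpha>) * ln (a y) + ln Z + (\<alpha>' - 1) * (1 - u y)"
definition "mean_expo = ln Z + (\<alpha>' - \<alpha>) * E + (\<alpha>' - 1) * (1 - (\<integral>y. v y * u y \<partial>q))"

lemma integrand_ge:
  assumes y: "0 < v y"
  shows "ennreal (v y * exp (expo y)) \<le> renyi_integrand \<alpha>' (a y) (u y)"
    and "renyi_integrand \<alpha>' (a y) (u y) = ennreal (v y * exp (expo y)) \<Longrightarrow> u y = 1"
proof -
  have a: "0 < a y" using y v_pos_iff by simp
  have l: "v y * exp (expo y) = exp (\<alpha>' * ln (a y) + (\<alpha>' - 1) * (1 - u y))"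
  proof -
    have "v y = exp (\<alpha> * ln (a y) - ln Z)" using a Z_pos' by (simp add: v_def powr_def exp_diff)
    then show ?thesis by (simp add: expo_def mult_exp_exp algebra_simps)
  qed
  have r: "a y powr \<alpha>' * u y powr (1 - \<alpha>') = exp (\<alpha>' * ln (a y) + (1 - \<alpha>') * ln (u y))" if "0 < u y"
    using a that by (simp add: powr_def mult_exp_exp)
  have ln: "(\<alpha>' - 1) * (1 - u y) \<le> (1 - \<alpha>') * ln (u y)" if "0 < u y"
  proof -
    have "(\<alpha>' - 1) * ln (u y) \<le> (\<alpha>' - 1) * (u y - 1)"
      using \<alpha>' ln_le_minus_one[OF that] by (intro mult_left_mono) auto
    then show ?thesis by (simp add: algebra_simps)
  qed
  show "ennreal (v y * exp (expo y)) \<le> renyi_integrand \<alpha>' (a y) (u y)"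
    using a \<alpha>' u_nonneg[of y] ln unfolding l renyi_integrand_def
    by (auto simp: r less_le intro!: ennreal_leI)
  assume eq: "renyi_integrand \<alpha>' (a y) (u y) = ennreal (v y * exp (expo y))"
  then have u0: "0 < u y" using u_nonneg[of y] a \<alpha>' by (auto simp: renyi_integrand_def less_le split: if_splits)
  with eq have "exp (\<alpha>' * ln (a y) + (1 - \<alpha>') * ln (u y)) = exp (\<alpha>' * ln (a y) + (\<alpha>' - 1) * (1 - u y))"
    unfolding l renyi_integrand_def by (simp add: r)
  then have "(\<alpha>' - 1) * (ln (u y) - (u y - 1)) = 0" by (simp add: algebra_simps)
  then have "ln (u y) = u y - 1" using \<alpha>' by simp
  then show "u y = 1" using u0 by (simp add: ln_eq_minus_one)
qed

text \<open>Jensen's inequality is used in the form of the tangent of exp at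
  \<open>mean_expo\<close>. The tangent is integrable even when the Renyi integral is infinite, and
  the equality case can be read off pointwise.\<close>

lemma tangent_integrable: "integrable q (\<lambda>y. v y * exp mean_expo * (1 + expo y - mean_expo))"
    and tangent_integral: "(\<integral>y. v y * exp mean_expo * (1 + expo y - mean_expo) \<partial>q) = exp mean_expo"
proof -
  have eq: "v y * exp mean_expo * (1 + expo y - mean_expo)
      = exp mean_expo * ((1 + ln Z + (\<alpha>' - 1) - mean_expo) * v y + (\<alpha>' - \<alpha>) * (v y * ln (a y)) - (\<alpha>' - 1) * (v y * u y))" for y
    by (simp add: expo_def algebra_simps)
  have "has_bochner_integral q v 1" "has_bochner_integral q (\<lambda>y. v y * ln (a y)) E"
    "has_bochner_integral q (\<lambda>y. v y * u y) (\<integral>y. v y * u y \<partial>q)"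
    using integrable_v integral_v integrable_v_ln integrable_v_mult[OF u]
    by (auto simp: has_bochner_integral_iff E_def)
  then have "has_bochner_integral q (\<lambda>y. v y * exp mean_expo * (1 + expo y - mean_expo))
      (exp mean_expo * ((1 + ln Z + (\<alpha>' - 1) - mean_expo) * 1 + (\<alpha>' - \<alpha>) * E - (\<alpha>' - 1) * (\<integral>y. v y * u y \<partial>q)))"
    unfolding eq
    by (intro has_bochner_integral_diff has_bochner_integral_add has_bochner_integral_mult_right)
  also have "(1 + ln Z + (\<alpha>' - 1) - mean_expo) * 1 + (\<alpha>' - \<alpha>) * E - (\<alpha>' - 1) * (\<integral>y. v y * u y \<partial>q) = 1"
    by (simp add: mean_expo_def algebra_simps)
  finally show "integrable q (\<lambda>y. v y * exp mean_expo * (1 + expo y - mean_expo))" "(\<integral>y. v y * exp mean_expo * (1 + expo y - mean_expo) \<partial>q) = exp mean_expo"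
    by (auto simp: has_bochner_integral_iff)
qed

lemma tangent_le: "ennreal (v y * exp mean_expo * (1 + expo y - mean_expo)) \<le> renyi_integrand \<alpha>' (a y) (u y)"
proof (cases "0 < v y")
  case True
  have "exp mean_expo * (1 + expo y - mean_expo) \<le> exp mean_expo * exp (expo y - mean_expo)"
  proof (rule mult_left_mono)
    show "1 + expo y - mean_expo \<le> exp (expo y - mean_expo)" using exp_ge_add_one_self[of "expo y - mean_expo"] by linarith
  qed simp
  then have "v y * exp mean_expo * (1 + expo y - mean_expo) \<le> v y * exp (expo y)"
    using True by (simp add: mult_exp_exp mult.assoc)
  then have "ennreal (v y * exp mean_expo * (1 + expo y - mean_expo)) \<le> ennreal (v y * exp (expo y))" by (rule ennreal_leI)
  also have "\<dots> \<le> renyi_integrand \<alpha>' (a y) (u y)" by (rule integrand_ge(1)[OF True])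
  finally show ?thesis .
qed (use v_nonneg[of y] in \<open>simp add: less_le\<close>)

lemma renyi_integral_ge: "ennreal (exp mean_expo) \<le> (\<integral>\<^sup>+y. renyi_integrand \<alpha>' (a y) (u y) \<partial>q)"
proof -
  have "ennreal (exp mean_expo) \<le> (\<integral>\<^sup>+y. ennreal (v y * exp mean_expo * (1 + expo y - mean_expo)) \<partial>q)"
    using ennreal_integral_le_nn_integral[OF tangent_integrable] by (simp only: tangent_integral)
  also have "\<dots> \<le> (\<integral>\<^sup>+y. renyi_integrand \<alpha>' (a y) (u y) \<partial>q)"
    by (intro nn_integral_mono tangent_le)
  finally show ?thesis .
qed

text \<open>Nested inequalities with equal finite integrals agree almost everywhere. Equality in
  \<open>ln u \<le> u - 1\<close> forces u = 1, and equality with the tangent forces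
  \<open>expo\<close> to be constant; with u = 1 inserted, this constancy becomes the condition on
  \<open>ln (a y)\<close>.\<close>

lemma renyi_integral_eqD:
  assumes eq: "(\<integral>\<^sup>+y. renyi_integrand \<alpha>' (a y) (u y) \<partial>q) = ennreal (exp mean_expo)"
  shows "AE y in q. 0 < v y \<longrightarrow> u y = 1 \<and> (\<alpha>' - \<alpha>) * (ln (a y) - E) = 0"
proof -
  define r where "r y = enn2real (renyi_integrand \<alpha>' (a y) (u y))" for y
  have [measurable]: "u \<in> borel_measurable q" using u by simp
  have rm [measurable]: "r \<in> borel_measurable q" unfolding r_def by measurable
  have fin: "AE y in q. renyi_integrand \<alpha>' (a y) (u y) = ennreal (r y)"
  proof -
    have "AE y in q. renyi_integrand \<alpha>' (a y) (u y) \<noteq> \<infinity>"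
      using eq by (intro nn_integral_noteq_infinite) auto
    then show ?thesis by eventually_elim (simp add: r_def top.not_eq_extremum)
  qed
  have "(\<integral>\<^sup>+y. ennreal (r y) \<partial>q) = ennreal (exp mean_expo)"
    unfolding eq[symmetric] using fin by (intro nn_integral_cong_AE) auto
  then have "has_bochner_integral q r (exp mean_expo)"
    by (intro has_bochner_integral_nn_integral) (auto simp: r_def)
  then have ri: "integrable q r" "integral\<^sup>L q r = exp mean_expo" by (auto simp: has_bochner_integral_iff)
  define g where "g y = v y * exp mean_expo * (1 + expo y - mean_expo)" for y
  have gi: "integrable q g" "integral\<^sup>L q g = exp mean_expo"
    unfolding g_def by (rule tangent_integrable tangent_integral)+
  have ge: "AE y in q. 0 \<le> r y - g y"
    using fin
  proof eventually_elim
    case (elim y)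
    then have "ennreal (g y) \<le> ennreal (r y)" using tangent_le[of y] by (simp add: g_def)
    moreover have "0 \<le> r y" by (simp add: r_def)
    ultimately show ?case by (simp add: ennreal_le_iff)
  qed
  have "integral\<^sup>L q (\<lambda>y. r y - g y) = 0" using ri gi by simp
  then have "AE y in q. r y - g y = 0"
    by (rule integral_nonneg_eq_0_iff_AE[OF Bochner_Integration.integrable_diff[OF ri(1) gi(1)] ge, THEN iffD1])
  with fin have *: "AE y in q. 0 < v y \<longrightarrow> u y = 1 \<and> expo y = mean_expo"
  proof eventually_elim
    case (elim y)
    show ?case
    proof
      assume v: "0 < v y"
      have e1: "v y * exp (expo y) \<le> r y"
      proof -
        have "ennreal (v y * exp (expo y)) \<le> ennreal (r y)"
          using integrand_ge(1)[OF v] by (simp only: elim(1))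
        moreover have "0 \<le> r y" by (simp add: r_def)
        ultimately show ?thesis by (simp add: ennreal_le_iff)
      qed
      have "v y * exp mean_expo * (1 + (expo y - mean_expo)) \<le> v y * exp mean_expo * exp (expo y - mean_expo)"
        using v by (intro mult_left_mono exp_ge_add_one_self) auto
      also have e2: "v y * exp mean_expo * exp (expo y - mean_expo) = v y * exp (expo y)" by (simp add: mult_exp_exp mult.assoc)
      finally have e3: "g y \<le> v y * exp (expo y)" by (simp add: g_def algebra_simps)
      have re: "r y = v y * exp (expo y)" using e1 e3 elim by linarith
      then have "u y = 1" by (intro integrand_ge(2)[OF v]) (simp only: elim(1))
      moreover have "v y * exp mean_expo * (1 + (expo y - mean_expo)) = v y * exp mean_expo * exp (expo y - mean_expo)"
        unfolding e2 using re elim by (simp add: g_def algebra_simps)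
      then have "1 + (expo y - mean_expo) = exp (expo y - mean_expo)" using v by simp
      then have "expo y - mean_expo = 0" using exp_eq_one_plus_iff[of "expo y - mean_expo"] by simp
      ultimately show "u y = 1 \<and> expo y = mean_expo" by simp
    qed
  qed
  have "(\<integral>y. v y * u y \<partial>q) = (\<integral>y. v y \<partial>q)"
  proof (rule integral_cong_AE)
    show "AE y in q. v y * u y = v y"
      using * by eventually_elim (use v_nonneg in \<open>auto simp: less_le\<close>)
  qed simp_all
  then have "mean_expo = ln Z + (\<alpha>' - \<alpha>) * E" by (simp add: mean_expo_def integral_v)
  with * show ?thesis
    by (auto elim!: eventually_mono simp: expo_def algebra_simps)
qed

end

lemma renyi_dens_one: "\<alpha> \<noteq> 1 \<Longrightarrow> AE y in q. u y = 1 \<Longrightarrow> renyi_dens \<alpha> q a u = ereal (ln Z / (\<alpha> - 1))"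
proof -
  assume *: "\<alpha> \<noteq> 1" "AE y in q. u y = 1"
  have "(\<integral>\<^sup>+y. renyi_integrand \<alpha> (a y) (u y) \<partial>q) = (\<integral>\<^sup>+y. ennreal (a y powr \<alpha>) \<partial>q)"
    using *(2) by (intro nn_integral_cong_AE) (auto elim!: eventually_mono simp: renyi_integrand_def)
  also have "\<dots> = ennreal Z"
    unfolding Z_def using integrable_powr[of \<alpha>] \<alpha>_pos by (intro nn_integral_eq_integral) auto
  finally show ?thesis using * Z_pos' by (simp add: renyi_dens_def Let_def)
qed

end

section \<open>Divergence of order one\<close>

context bounded_density
begin

text \<open>The order-one counterpart of the previous bound, again from
  \<open>ln u \<le> u - 1\<close>. The term with u is kept because averaging over the letters makes
  it at most the 1 in front of it.\<close>

lemma kl_dens_ge: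
  assumes one: "integral\<^sup>L q a = 1" and u: "integrable q u" and u_nonneg: "\<And>y. 0 \<le> u y"
  shows "ereal ((\<integral>y. a y * ln (a y) \<partial>q) + 1 - (\<integral>y. a y * u y \<partial>q)) \<le> renyi_dens 1 q a u"
proof (cases "renyi_dens 1 q a u = \<infinity>")
  case False
  have [measurable]: "u \<in> borel_measurable q" using u by simp
  from False have null: "emeasure q {y \<in> space q. u y = 0 \<and> a y > 0} = 0"
    and int: "integrable q (\<lambda>y. a y * (ln (a y) - ln (u y)))"
    and val: "renyi_dens 1 q a u = ereal (\<integral>y. a y * (ln (a y) - ln (u y)) \<partial>q)"
    by (auto simp: renyi_dens_def split: if_splits)
  have ae: "AE y in q. \<not> (u y = 0 \<and> a y > 0)"
    using null by (subst AE_iff_measurable[OF _ refl]) auto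
  \<comment> \<open>Tilting of order 1 returns \<open>a\<close> itself, so the integrability facts
    about v apply to a.\<close>
  interpret t: tilting q a K 1
    by standard (use one a_nonneg in \<open>simp_all cong: Bochner_Integration.integral_cong\<close>)
  have p1: "a y powr 1 = a y" for y using a_nonneg[of y] by simp
  have "t.Z = 1" unfolding t.Z_def p1 by (rule one)
  then have tv: "t.v = a" by (intro ext) (simp add: t.v_def a_nonneg)
  have i: "integrable q a" "integrable q (\<lambda>y. a y * ln (a y))" "integrable q (\<lambda>y. a y * u y)"
    using t.integrable_v t.integrable_v_ln t.integrable_v_mult[OF u] by (simp_all add: tv)
  have "(\<integral>y. a y * ln (a y) + a y - a y * u y \<partial>q) \<le> (\<integral>y. a y * (ln (a y) - ln (u y)) \<partial>q)"
  proof (rule integral_mono_AE)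
    show "AE y in q. a y * ln (a y) + a y - a y * u y \<le> a y * (ln (a y) - ln (u y))"
      using ae
    proof eventually_elim
      case (elim y)
      show ?case
      proof (cases "a y = 0")
        case False
        then have "0 < u y" using elim u_nonneg[of y] a_nonneg[of y] by (auto simp: less_le)
        then have "a y * ln (u y) \<le> a y * (u y - 1)"
          using a_nonneg[of y] ln_le_minus_one[of "u y"] by (intro mult_left_mono) auto
        then show ?thesis by (simp add: algebra_simps)
      qed simp
    qed
  qed (use i int in auto)
  then show ?thesis using i by (simp add: val one)
qed simp

lemma kl_dens_one:
  assumes "AE y in q. u y = 1" and [measurable]: "u \<in> borel_measurable q"
  shows "renyi_dens 1 q a u = ereal (\<integral>y. a y * ln (a y) \<partial>q)"
proof -
  have "AE y in q. \<not> (u y = 0 \<and> a y > 0)" using assms(1) by eventually_elim simp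
  then have null: "emeasure q {y \<in> space q. u y = 0 \<and> a y > 0} = 0"
    by (subst (asm) AE_iff_measurable[OF _ refl]) auto
  have ae: "AE y in q. a y * (ln (a y) - ln (u y)) = a y * ln (a y)"
    using assms(1) by eventually_elim simp
  have "integrable q (\<lambda>y. a y powr 1 * ln (a y))" by (rule integrable_powr_ln) simp
  moreover have "a y powr 1 = a y" for y using a_nonneg[of y] by simp
  ultimately have "integrable q (\<lambda>y. a y * ln (a y))" by simp
  then have "integrable q (\<lambda>y. a y * (ln (a y) - ln (u y)))"
    by (subst integrable_cong_AE[OF _ _ ae]) auto
  moreover have "(\<integral>y. a y * (ln (a y) - ln (u y)) \<partial>q) = (\<integral>y. a y * ln (a y) \<partial>q)"
    by (rule integral_cong_AE[OF _ _ ae]) auto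
  ultimately show ?thesis using null by (simp add: renyi_dens_def)
qed

end

section \<open>A dual minimisation problem\<close>

lemma powr_tangent_le:
  fixes r z :: real
  assumes "0 \<le> r" "r \<le> 1" "0 < z"
  shows "z powr r \<le> 1 + r * (z - 1)"
proof -
  have "exp ((1 - r) *\<^sub>R 0 + r *\<^sub>R ln z) \<le> (1 - r) * exp 0 + r * exp (ln z)"
    using convex_onD[OF exp_convex assms(1,2), of 0 "ln z"] by simp
  then show ?thesis using assms by (simp add: powr_def algebra_simps)
qed

lemma powr_concave_tangent:
  fixes r s s' :: real
  assumes "0 \<le> r" "r \<le> 1" "0 < s" "0 < s'"
  shows "s' powr r \<le> s powr r + r * (s powr (r - 1) * (s' - s))"
proof -
  have "s powr r * (s' / s) powr r \<le> s powr r * (1 + r * (s' / s - 1))"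
    using assms by (intro mult_left_mono powr_tangent_le) auto
  also have "s powr r * (s' / s) powr r = s' powr r"
    using assms by (simp add: powr_divide)
  also have "s powr r * (1 + r * (s' / s - 1)) = s powr r + r * (s powr r / s * (s' - s))"
    using assms by (simp add: field_simps)
  also have "s powr r / s = s powr (r - 1)"
    using assms by (simp add: powr_diff)
  finally show ?thesis .
qed

text \<open>The dual of minimising the conditional Renyi divergence: the mean is determined by finitely
  many weights exp (\<theta> x), which minimise the convex function \<Psi>.\<close>
locale weighted_densities = prob_space \<nu> for \<nu> :: "'b measure" +
  fixes X :: "'a set" and p :: "'a \<Rightarrow> real" and w :: "'a \<Rightarrow> 'b \<Rightarrow> real" and \<alpha> K :: real
  assumes finX: "finite X" and p_pos: "\<And>x. x \<in> X \<Longrightarrow> 0 < p x" and p_sum: "(\<Sum>x\<in>X. p x) = 1"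
    and w_meas: "\<And>x. x \<in> X \<Longrightarrow> w x \<in> borel_measurable \<nu>" and w_nonneg: "\<And>x y. 0 \<le> w x y"
    and w_int: "\<And>x. x \<in> X \<Longrightarrow> integral\<^sup>L \<nu> (w x) = 1"
    and w_le: "\<And>x. x \<in> X \<Longrightarrow> AE y in \<nu>. w x y \<le> K"
    and w_sum: "AE y in \<nu>. (\<Sum>x\<in>X. p x * w x y) = 1"
    and \<alpha>: "1 < \<alpha>" and K: "1 \<le> K"
begin

text \<open>\<open>F\<close> is the density of the future mean before normalisation, as a function
  of log-weights, and \<open>\<Phi>\<close> is its mass. The linear term of \<open>\<Psi>\<close> is
  chosen so that stationarity makes each weight the reciprocal of the letter's normaliser.\<close>

definition "S \<theta> y = (\<Sum>x\<in>X. p x * exp (\<theta> x) * w x y powr \<alpha>)"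
definition "F \<theta> y = S \<theta> y powr (1 / \<alpha>)"
definition "\<Phi> \<theta> = (\<integral>y. F \<theta> y \<partial>\<nu>)"
definition "\<Psi> \<theta> = \<Phi> \<theta> - (\<Sum>x\<in>X. p x * \<theta> x) / \<alpha>"

lemma S_meas [measurable]: "S \<theta> \<in> borel_measurable \<nu>"
  unfolding S_def using w_meas by (intro borel_measurable_sum) auto

lemma F_meas [measurable]: "F \<theta> \<in> borel_measurable \<nu>"
  unfolding F_def by measurable

lemma S_nonneg: "0 \<le> S \<theta> y"
  unfolding S_def using p_pos by (intro sum_nonneg) (auto simp: less_imp_le)

lemma F_nonneg: "0 \<le> F \<theta> y" by (simp add: F_def)

lemma w_integrable: "x \<in> X \<Longrightarrow> integrable \<nu> (w x)"
  using w_int[of x] not_integrable_integral_eq[of \<nu> "w x"] by fastforce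

lemma S_pos: "AE y in \<nu>. \<forall>\<theta>. 0 < S \<theta> y"
  using w_sum
proof eventually_elim
  case (elim y)
  then obtain x where x: "x \<in> X" "0 < p x * w x y"
    using sum_nonpos[of X "\<lambda>x. p x * w x y"] by force
  then have "0 < w x y" using p_pos[of x] by (simp add: zero_less_mult_iff)
  show ?case
  proof
    fix \<theta>
    show "0 < S \<theta> y"
      unfolding S_def using x \<open>0 < w x y\<close> p_pos finX
      by (intro sum_pos2[of X x]) (auto simp: less_imp_le)
  qed
qed

lemma F_integrable: "integrable \<nu> (F \<theta>)"
proof (rule integrable_const_bound)
  have "AE y in \<nu>. \<forall>x\<in>X. w x y \<le> K" using w_le finX by (simp add: AE_finite_all)
  then show "AE y in \<nu>. norm (F \<theta> y) \<le> (\<Sum>x\<in>X. p x * exp (\<theta> x) * K powr \<alpha>) powr (1 / \<alpha>)"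
  proof eventually_elim
    case (elim y)
    have "S \<theta> y \<le> (\<Sum>x\<in>X. p x * exp (\<theta> x) * K powr \<alpha>)"
      unfolding S_def using elim p_pos \<alpha> w_nonneg
      by (intro sum_mono mult_left_mono powr_mono2) (auto simp: less_imp_le)
    then show ?case unfolding F_def using S_nonneg \<alpha> by (simp add: powr_mono2)
  qed
qed simp

text \<open>All other letters are dropped from S, and
  \<open>p x \<le> p x powr (1 / \<alpha>)\<close> because p x is at most 1.\<close>

lemma \<Phi>_ge: assumes x: "x \<in> X" shows "p x * exp (\<theta> x / \<alpha>) \<le> \<Phi> \<theta>"
proof -
  have px: "0 < p x" "p x \<le> 1"
    using p_pos[OF x] member_le_sum[of x X p] p_pos p_sum finX x by (auto simp: less_imp_le)
  have "(\<integral>y. p x * exp (\<theta> x / \<alpha>) * w x y \<partial>\<nu>) \<le> \<Phi> \<theta>"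
    unfolding \<Phi>_def
  proof (rule integral_mono)
    fix y
    have "p x \<le> p x powr (1 / \<alpha>)" using px \<alpha> powr_mono'[of "1 / \<alpha>" 1 "p x"] by simp
    then have "p x * exp (\<theta> x / \<alpha>) * w x y \<le> p x powr (1 / \<alpha>) * exp (\<theta> x / \<alpha>) * w x y"
      using w_nonneg by (intro mult_right_mono) auto
    also have "\<dots> = (p x * exp (\<theta> x) * w x y powr \<alpha>) powr (1 / \<alpha>)"
    proof -
      have "exp (\<theta> x) powr (1 / \<alpha>) = exp (\<theta> x / \<alpha>)" by (simp add: powr_def)
      moreover have "(w x y powr \<alpha>) powr (1 / \<alpha>) = w x y" using \<alpha> w_nonneg by (simp add: powr_powr)
      ultimately show ?thesis using px w_nonneg[of x y] by (simp add: powr_mult)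
    qed
    also have "\<dots> \<le> F \<theta> y"
      unfolding F_def S_def using \<alpha> finX x p_pos
      by (intro powr_mono2 member_le_sum) (auto simp: less_imp_le)
    finally show "p x * exp (\<theta> x / \<alpha>) * w x y \<le> F \<theta> y" .
  qed (use w_integrable[OF x] F_integrable in auto)
  then show ?thesis using w_int[OF x] by simp
qed

text \<open>Coercivity. With t = \<theta> x / \<alpha>, the tangent of \<open>p x * exp t\<close> at
  \<open>ln (2 / p x)\<close> has slope 2, which beats the subtracted t on the positive side; on the
  negative side - t itself grows.\<close>

lemma \<Psi>_ge: "(\<Sum>x\<in>X. p x * (\<bar>\<theta> x / \<alpha>\<bar> - 2 * ln (2 / p x))) \<le> \<Psi> \<theta>"
proof -
  have "p x * (\<bar>\<theta> x / \<alpha>\<bar> - 2 * ln (2 / p x)) \<le> p x * \<Phi> \<theta> - p x * \<theta> x / \<alpha>" if x: "x \<in> X" for x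
  proof -
    define t where "t = \<theta> x / \<alpha>"
    define s where "s = ln (2 / p x)"
    have px: "0 < p x" "p x \<le> 1"
      using p_pos[OF x] member_le_sum[of x X p] p_pos p_sum finX x by (auto simp: less_imp_le)
    have s: "0 \<le> s" "exp s = 2 / p x" using px by (auto simp: s_def field_simps)
    have "exp s * (1 + (t - s)) \<le> exp s * exp (t - s)" by (intro mult_left_mono exp_ge_add_one_self) auto
    then have "2 * (1 + (t - s)) \<le> p x * exp t"
      using px by (simp add: s(2) mult_exp_exp flip: s(2)) (simp add: s(2) field_simps)
    moreover have "0 \<le> p x * exp t" using px by simp
    ultimately have "\<bar>t\<bar> - 2 * s \<le> p x * exp t - t" using s by (auto simp: abs_if)
    also have "\<dots> \<le> \<Phi> \<theta> - t" using \<Phi>_ge[OF x, of \<theta>] by (simp add: t_def)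
    finally have "p x * (\<bar>t\<bar> - 2 * s) \<le> p x * (\<Phi> \<theta> - t)" using px by (intro mult_left_mono) auto
    then show ?thesis by (simp add: t_def s_def right_diff_distrib)
  qed
  then have "(\<Sum>x\<in>X. p x * (\<bar>\<theta> x / \<alpha>\<bar> - 2 * ln (2 / p x))) \<le> (\<Sum>x\<in>X. p x * \<Phi> \<theta> - p x * \<theta> x / \<alpha>)"
    by (rule sum_mono)
  also have "\<dots> = \<Psi> \<theta>"
    by (simp add: \<Psi>_def sum_subtractf sum_distrib_right[symmetric] p_sum sum_divide_distrib)
  finally show ?thesis .
qed

text \<open>A Lipschitz bound for the logarithm of \<open>\<Phi>\<close> in finitely many
  coordinates, from which continuity in the product topology follows.\<close>

lemma \<Phi>_ratio: "\<Phi> \<theta>' \<le> exp ((\<Sum>x\<in>X. \<bar>\<theta>' x - \<theta> x\<bar>) / \<alpha>) * \<Phi> \<theta>"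
proof -
  define d where "d = (\<Sum>x\<in>X. \<bar>\<theta>' x - \<theta> x\<bar>)"
  have "\<Phi> \<theta>' \<le> (\<integral>y. exp (d / \<alpha>) * F \<theta> y \<partial>\<nu>)"
    unfolding \<Phi>_def
  proof (rule integral_mono)
    fix y
    have "S \<theta>' y \<le> exp d * S \<theta> y"
      unfolding S_def sum_distrib_left
    proof (rule sum_mono)
      fix x assume x: "x \<in> X"
      have "\<bar>\<theta>' x - \<theta> x\<bar> \<le> d" unfolding d_def using x finX by (intro member_le_sum) auto
      then have "exp (\<theta>' x) \<le> exp (d + \<theta> x)" by simp
      then have "exp (\<theta>' x) \<le> exp d * exp (\<theta> x)" by (simp add: exp_add)
      then have "p x * w x y powr \<alpha> * exp (\<theta>' x) \<le> p x * w x y powr \<alpha> * (exp d * exp (\<theta> x))"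
        using p_pos[OF x] by (intro mult_left_mono) auto
      then show "p x * exp (\<theta>' x) * w x y powr \<alpha> \<le> exp d * (p x * exp (\<theta> x) * w x y powr \<alpha>)"
        by (simp add: mult_ac)
    qed
    then have "F \<theta>' y \<le> (exp d * S \<theta> y) powr (1 / \<alpha>)"
      unfolding F_def using S_nonneg \<alpha> by (intro powr_mono2) auto
    also have "\<dots> = exp (d / \<alpha>) * F \<theta> y"
      unfolding F_def using S_nonneg[of \<theta> y] by (simp add: powr_mult) (simp add: powr_def)
    finally show "F \<theta>' y \<le> exp (d / \<alpha>) * F \<theta> y" .
  qed (use F_integrable in auto)
  then show ?thesis by (simp add: \<Phi>_def d_def)
qed

lemma \<Phi>_nonneg: "0 \<le> \<Phi> \<theta>"
  unfolding \<Phi>_def by (rule Bochner_Integration.integral_nonneg) (rule F_nonneg)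

lemma continuous_\<Psi>: "continuous_on UNIV \<Psi>"
proof -
  have c: "continuous_on UNIV (\<lambda>\<theta>. \<theta> x :: real)" for x :: 'a
    by (rule continuous_on_product_coordinates)
  have "(\<Phi> \<longlongrightarrow> \<Phi> \<theta>0) (at \<theta>0)" for \<theta>0
  proof -
    define d where "d \<theta> = (\<Sum>x\<in>X. \<bar>\<theta> x - \<theta>0 x\<bar>)" for \<theta> :: "'a \<Rightarrow> real"
    have "continuous_on UNIV d" unfolding d_def by (intro continuous_intros c)
    then have "(d \<longlongrightarrow> d \<theta>0) (at \<theta>0)" by (simp add: continuous_on_def)
    then have d0: "(d \<longlongrightarrow> 0) (at \<theta>0)" by (simp add: d_def)
    show ?thesis
    proof (rule tendsto_sandwich)
      have "exp (- d \<theta> / \<alpha>) * \<Phi> \<theta>0 \<le> \<Phi> \<theta>" for \<theta>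
      proof -
        have "\<Phi> \<theta>0 \<le> exp (d \<theta> / \<alpha>) * \<Phi> \<theta>"
          using \<Phi>_ratio[of \<theta>0 \<theta>] by (simp add: d_def abs_minus_commute)
        then have "exp (- d \<theta> / \<alpha>) * \<Phi> \<theta>0 \<le> exp (- d \<theta> / \<alpha>) * (exp (d \<theta> / \<alpha>) * \<Phi> \<theta>)"
          by (intro mult_left_mono) auto
        also have "\<dots> = \<Phi> \<theta>" by (simp add: mult.assoc[symmetric] mult_exp_exp)
        finally show ?thesis .
      qed
      then show "\<forall>\<^sub>F \<theta> in at \<theta>0. exp (- d \<theta> / \<alpha>) * \<Phi> \<theta>0 \<le> \<Phi> \<theta>" by simp
      show "\<forall>\<^sub>F \<theta> in at \<theta>0. \<Phi> \<theta> \<le> exp (d \<theta> / \<alpha>) * \<Phi> \<theta>0"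
        using \<Phi>_ratio[of _ \<theta>0] by (simp add: d_def)
      have "((\<lambda>\<theta>. exp (- d \<theta> / \<alpha>) * \<Phi> \<theta>0) \<longlongrightarrow> exp (- 0 / \<alpha>) * \<Phi> \<theta>0) (at \<theta>0)"
        using \<alpha> by (intro tendsto_intros d0) auto
      then show "((\<lambda>\<theta>. exp (- d \<theta> / \<alpha>) * \<Phi> \<theta>0) \<longlongrightarrow> \<Phi> \<theta>0) (at \<theta>0)" by simp
      have "((\<lambda>\<theta>. exp (d \<theta> / \<alpha>) * \<Phi> \<theta>0) \<longlongrightarrow> exp (0 / \<alpha>) * \<Phi> \<theta>0) (at \<theta>0)"
        using \<alpha> by (intro tendsto_intros d0) auto
      then show "((\<lambda>\<theta>. exp (d \<theta> / \<alpha>) * \<Phi> \<theta>0) \<longlongrightarrow> \<Phi> \<theta>0) (at \<theta>0)" by simp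
    qed
  qed
  then have "continuous_on UNIV \<Phi>" by (simp add: continuous_on_def)
  then show ?thesis unfolding \<Psi>_def using \<alpha> by (intro continuous_intros c) auto
qed

text \<open>The weights are functions on the whole letter type, where a box over all coordinates is
  compact by Tychonoff's theorem. Coordinates outside the support are invisible to
  \<open>\<Psi>\<close> and pinned to 0; by coercivity the box then contains every such vector that
  does at least as well as the zero vector.\<close>

lemma \<Psi>_attains_min: "\<exists>\<theta>. \<forall>\<theta>'. \<Psi> \<theta> \<le> \<Psi> \<theta>'"
proof -
  define R where "R = \<Psi> (\<lambda>_. 0) + (\<Sum>x\<in>X. p x * (2 * ln (2 / p x)))"
  define B where "B x = (if x \<in> X then {- (\<alpha> * R / p x) .. \<alpha> * R / p x} else {0})" for x
  define box where "box = PiE UNIV B"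
  have in_box: "\<theta> \<in> box" if le: "\<Psi> \<theta> \<le> \<Psi> (\<lambda>_. 0)" and out: "\<And>x. x \<notin> X \<Longrightarrow> \<theta> x = 0" for \<theta>
  proof -
    have "(\<Sum>x\<in>X. p x * \<bar>\<theta> x / \<alpha>\<bar>) \<le> R"
      using le \<Psi>_ge[of \<theta>] by (simp add: R_def right_diff_distrib sum_subtractf)
    moreover have "p x * \<bar>\<theta> x / \<alpha>\<bar> \<le> (\<Sum>x\<in>X. p x * \<bar>\<theta> x / \<alpha>\<bar>)" if "x \<in> X" for x
      using that finX p_pos by (intro member_le_sum) (auto simp: less_imp_le)
    ultimately have "p x * \<bar>\<theta> x / \<alpha>\<bar> \<le> R" if "x \<in> X" for x using that by fastforce
    then have "\<bar>\<theta> x\<bar> \<le> \<alpha> * R / p x" if "x \<in> X" for x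
      using that p_pos[OF that] \<alpha> by (simp add: abs_divide field_simps)
    then show ?thesis using out by (force simp: box_def B_def abs_le_iff)
  qed
  have "compactin (product_topology (\<lambda>_::'a. euclidean :: real topology) UNIV) (PiE UNIV B)"
    unfolding compactin_PiE by (auto simp: B_def)
  then have "compact box" by (simp add: box_def euclidean_product_topology)
  moreover have "(\<lambda>_. 0) \<in> box" by (rule in_box) auto
  ultimately obtain \<theta> where \<theta>: "\<theta> \<in> box" "\<And>\<theta>'. \<theta>' \<in> box \<Longrightarrow> \<Psi> \<theta> \<le> \<Psi> \<theta>'"
    using continuous_attains_inf[of box \<Psi>] continuous_on_subset[OF continuous_\<Psi>, of box] by auto
  have "\<Psi> \<theta> \<le> \<Psi> \<theta>'" for \<theta>'
  proof -
    define \<theta>'' where "\<theta>'' x = (if x \<in> X then \<theta>' x else 0)" for x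
    have "S \<theta>'' = S \<theta>'" by (auto simp: S_def \<theta>''_def intro!: ext sum.cong)
    then have eq: "\<Psi> \<theta>'' = \<Psi> \<theta>'" by (simp add: \<Psi>_def \<Phi>_def F_def \<theta>''_def cong: sum.cong)
    show ?thesis
    proof (cases "\<Psi> \<theta>'' \<le> \<Psi> (\<lambda>_. 0)")
      case True
      then have "\<theta>'' \<in> box" by (rule in_box) (simp add: \<theta>''_def)
      then show ?thesis using \<theta>(2) eq by metis
    next
      case False
      then show ?thesis using \<theta>(2)[OF \<open>(\<lambda>_. 0) \<in> box\<close>] eq by linarith
    qed
  qed
  then show ?thesis by blast
qed

text \<open>\<open>F\<close> is at least \<open>c * w x\<close> and the exponent
  \<open>1 - \<alpha>\<close> is negative, so the integrand is at most a multiple of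
  \<open>w x\<close>.\<close>

lemma integrable_dual:
  assumes x: "x \<in> X"
  shows "integrable \<nu> (\<lambda>y. w x y powr \<alpha> * F \<theta> y powr (1 - \<alpha>))"
proof -
  define c where "c = (p x * exp (\<theta> x)) powr (1 / \<alpha>)"
  have c: "0 < c" using p_pos[OF x] by (simp add: c_def)
  have wm [measurable]: "w x \<in> borel_measurable \<nu>" by (rule w_meas[OF x])
  have bound: "w x y powr \<alpha> * F \<theta> y powr (1 - \<alpha>) \<le> c powr (1 - \<alpha>) * w x y" for y
  proof (cases "w x y = 0")
    case False
    then have w: "0 < w x y" using w_nonneg[of x y] by simp
    have "c * w x y = (p x * exp (\<theta> x) * w x y powr \<alpha>) powr (1 / \<alpha>)"
      using w p_pos[OF x] \<alpha> by (simp add: c_def powr_mult powr_powr)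
    also have "\<dots> \<le> F \<theta> y"
      unfolding F_def S_def using \<alpha> finX x p_pos
      by (intro powr_mono2 member_le_sum) (auto simp: less_imp_le)
    finally have "F \<theta> y powr (1 - \<alpha>) \<le> (c * w x y) powr (1 - \<alpha>)"
      using c w \<alpha> by (intro powr_mono2') auto
    then have "w x y powr \<alpha> * F \<theta> y powr (1 - \<alpha>) \<le> w x y powr \<alpha> * (c * w x y) powr (1 - \<alpha>)"
      by (intro mult_left_mono) auto
    also have "\<dots> = c powr (1 - \<alpha>) * (w x y powr \<alpha> * w x y powr (1 - \<alpha>))"
      using c w by (simp add: powr_mult)
    also have "w x y powr \<alpha> * w x y powr (1 - \<alpha>) = w x y" using w by (simp flip: powr_add)
    finally show ?thesis .
  qed simp
  show ?thesis
  proof (rule Bochner_Integration.integrable_bound)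
    show "integrable \<nu> (\<lambda>y. c powr (1 - \<alpha>) * w x y)" using w_integrable[OF x] by simp
    show "AE y in \<nu>. norm (w x y powr \<alpha> * F \<theta> y powr (1 - \<alpha>)) \<le> norm (c powr (1 - \<alpha>) * w x y)"
      using bound w_nonneg by simp
  qed simp
qed

text \<open>One coordinate is moved by t. Concavity of the root bounds \<open>\<Phi>\<close> from
  above by an expression exact at t = 0, so minimality yields
  \<open>0 \<le> (exp t - 1) * L - t\<close> for all t with equality at 0. Differentiating this
  explicit function, instead of the integral, gives L = 1.\<close>

lemma stationary:
  assumes min: "\<And>\<theta>'. \<Psi> \<theta> \<le> \<Psi> \<theta>'" and x: "x \<in> X"
  shows "exp (\<theta> x) * (\<integral>y. w x y powr \<alpha> * F \<theta> y powr (1 - \<alpha>) \<partial>\<nu>) = 1"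
proof -
  define N where "N = (\<integral>y. w x y powr \<alpha> * F \<theta> y powr (1 - \<alpha>) \<partial>\<nu>)"
  define L where "L = exp (\<theta> x) * N"
  have px: "0 < p x" by (rule p_pos[OF x])
  have k: "0 \<le> (exp t - 1) * L - t" for t
  proof -
    define \<theta>' where "\<theta>' = \<theta>(x := \<theta> x + t)"
    have S': "S \<theta>' y = S \<theta> y + (exp t - 1) * (p x * exp (\<theta> x)) * w x y powr \<alpha>" for y
    proof -
      have "S \<theta>' y - S \<theta> y = (\<Sum>z\<in>X. if z = x then (exp t - 1) * (p x * exp (\<theta> x)) * w x y powr \<alpha> else 0)"
        unfolding S_def sum_subtractf[symmetric] by (rule sum.cong) (auto simp: \<theta>'_def exp_add algebra_simps)
      then show ?thesis using finX x by simp
    qed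
    have "\<Phi> \<theta>' \<le> (\<integral>y. F \<theta> y + (1 / \<alpha>) * ((exp t - 1) * (p x * exp (\<theta> x))) * (w x y powr \<alpha> * F \<theta> y powr (1 - \<alpha>)) \<partial>\<nu>)"
      unfolding \<Phi>_def
    proof (rule integral_mono_AE)
      show "AE y in \<nu>. F \<theta>' y \<le> F \<theta> y + (1 / \<alpha>) * ((exp t - 1) * (p x * exp (\<theta> x))) * (w x y powr \<alpha> * F \<theta> y powr (1 - \<alpha>))"
        using S_pos
      proof eventually_elim
        case (elim y)
        then have s: "0 < S \<theta> y" "0 < S \<theta>' y" by auto
        have "S \<theta> y powr (1 / \<alpha> - 1) = F \<theta> y powr (1 - \<alpha>)"
          using \<alpha> by (simp add: F_def powr_powr field_simps)
        then show ?case
          using powr_concave_tangent[of "1 / \<alpha>" "S \<theta> y" "S \<theta>' y"] s \<alpha>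
          by (simp add: F_def[of \<theta>'] F_def[of \<theta>] S' mult_ac)
      qed
    qed (use F_integrable integrable_dual[OF x] in auto)
    also have "\<dots> = \<Phi> \<theta> + (1 / \<alpha>) * ((exp t - 1) * (p x * exp (\<theta> x))) * N"
      using F_integrable[of \<theta>] integrable_dual[OF x, of \<theta>]
      by (subst Bochner_Integration.integral_add) (auto simp: \<Phi>_def N_def)
    finally have "\<Phi> \<theta>' \<le> \<Phi> \<theta> + (1 / \<alpha>) * ((exp t - 1) * (p x * exp (\<theta> x))) * N" .
    moreover have "(\<Sum>z\<in>X. p z * \<theta>' z) = (\<Sum>z\<in>X. p z * \<theta> z) + p x * t"
    proof -
      have "(\<Sum>z\<in>X. p z * \<theta>' z) - (\<Sum>z\<in>X. p z * \<theta> z) = (\<Sum>z\<in>X. if z = x then p x * t else 0)"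
        unfolding sum_subtractf[symmetric] by (rule sum.cong) (auto simp: \<theta>'_def algebra_simps)
      then show ?thesis using finX x by simp
    qed
    ultimately have "0 \<le> (1 / \<alpha>) * ((exp t - 1) * (p x * exp (\<theta> x))) * N - p x * t / \<alpha>"
      using min[of \<theta>'] by (simp add: \<Psi>_def add_divide_distrib)
    also have "\<dots> = p x / \<alpha> * ((exp t - 1) * L - t)"
      by (simp add: L_def algebra_simps diff_divide_distrib add_divide_distrib)
    finally show ?thesis using px \<alpha> by (simp add: zero_le_divide_iff zero_le_mult_iff)
  qed
  have "((\<lambda>t. (exp t - 1) * L - t) has_real_derivative (L - 1)) (at 0)"
    by (auto intro!: derivative_eq_intros)
  then have "L - 1 = 0"
    by (rule DERIV_local_min[where d = 1]) (use k in auto)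
  then show ?thesis by (simp add: L_def N_def)
qed

text \<open>Stationarity also normalises the minimiser: writing F as
  \<open>F powr \<alpha> * F powr (1 - \<alpha>)\<close> and expanding the first factor, each letter
  contributes exactly p x to the integral.\<close>

lemma fixed_point:
  obtains f c where "f \<in> borel_measurable \<nu>" "\<And>y. 0 \<le> f y" "AE y in \<nu>. 0 < f y" "\<And>x. 0 < c x"
    "integrable \<nu> f" "integral\<^sup>L \<nu> f = 1"
    "\<And>y. f y powr \<alpha> = (\<Sum>x\<in>X. p x * c x * w x y powr \<alpha>)"
    "\<And>x. x \<in> X \<Longrightarrow> c x * (\<integral>y. w x y powr \<alpha> * f y powr (1 - \<alpha>) \<partial>\<nu>) = 1"
proof -
  obtain \<theta> where \<theta>: "\<And>\<theta>'. \<Psi> \<theta> \<le> \<Psi> \<theta>'" using \<Psi>_attains_min by blast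
  have pow: "F \<theta> y powr \<alpha> = S \<theta> y" for y
    using \<alpha> S_nonneg[of \<theta> y] by (simp add: F_def powr_powr)
  have pos: "AE y in \<nu>. 0 < F \<theta> y" using S_pos by eventually_elim (simp add: F_def less_le)
  have "integral\<^sup>L \<nu> (F \<theta>) = (\<integral>y. (\<Sum>x\<in>X. p x * exp (\<theta> x) * (w x y powr \<alpha> * F \<theta> y powr (1 - \<alpha>))) \<partial>\<nu>)"
  proof (rule integral_cong_AE)
    show "AE y in \<nu>. F \<theta> y = (\<Sum>x\<in>X. p x * exp (\<theta> x) * (w x y powr \<alpha> * F \<theta> y powr (1 - \<alpha>)))"
      using pos
    proof eventually_elim
      case (elim y)
      have "F \<theta> y = F \<theta> y powr \<alpha> * F \<theta> y powr (1 - \<alpha>)" using elim by (simp flip: powr_add)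
      then show ?case unfolding pow by (simp add: S_def sum_distrib_right mult.assoc)
    qed
  qed (use w_meas in measurable)
  also have "\<dots> = (\<Sum>x\<in>X. p x * (exp (\<theta> x) * (\<integral>y. w x y powr \<alpha> * F \<theta> y powr (1 - \<alpha>) \<partial>\<nu>)))"
    using integrable_dual by (subst Bochner_Integration.integral_sum) (auto simp: mult.assoc)
  also have "\<dots> = 1" using stationary[OF \<theta>] p_sum by simp
  finally show thesis
    using that[of "F \<theta>" "\<lambda>x. exp (\<theta> x)"] pos pow F_integrable stationary[OF \<theta>]
    by (simp add: F_nonneg S_def)
qed

end

section \<open>The Augustin mean\<close>

lemma prob_measures_iff: "Q \<in> prob_measures Y \<longleftrightarrow> prob_space Q \<and> sets Q = sets Y"
  by (simp add: prob_measures_def)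

locale channel_input =
  fixes Y :: "'b measure" and W :: "'a \<Rightarrow> 'b measure" and P :: "'a pmf"
  assumes W_prob: "\<And>x. prob_space (W x)" and W_sets: "\<And>x. sets (W x) = sets Y"
    and finP: "finite (set_pmf P)"
begin

abbreviation "X \<equiv> set_pmf P"

lemma P_pos: "x \<in> X \<Longrightarrow> 0 < pmf P x" by (simp add: pmf_positive)

lemma P_sum: "(\<Sum>x\<in>X. pmf P x) = 1" using finP by (simp add: sum_pmf_eq_1)

text \<open>The output distribution of the channel under P. It dominates W x for every letter in the
  support and serves as fixed reference measure.\<close>

definition outp :: "'b measure" where
  "outp = measure_pmf P \<bind> W"

lemma outp_sets: "sets outp = sets Y"
  unfolding outp_def using W_sets by (intro sets_bind) auto

lemma outp_emeasure: "A \<in> sets Y \<Longrightarrow> emeasure outp A = (\<Sum>x\<in>X. ennreal (pmf P x) * emeasure (W x) A)"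
proof -
  assume A: "A \<in> sets Y"
  have m: "W \<in> measurable (measure_pmf P) (subprob_algebra Y)"
    using W_prob W_sets by (auto simp: measurable_def space_subprob_algebra prob_space_imp_subprob_space)
  have "emeasure outp A = (\<integral>\<^sup>+x. emeasure (W x) A \<partial>measure_pmf P)"
    unfolding outp_def by (rule emeasure_bind[OF _ m A]) simp
  also have "\<dots> = (\<Sum>x\<in>X. ennreal (pmf P x) * emeasure (W x) A)"
    using finP by (subst nn_integral_measure_pmf_finite) (auto simp: mult.commute)
  finally show ?thesis .
qed

lemma outp_prob: "prob_space outp"
proof (rule prob_spaceI)
  have "emeasure (W x) (space Y) = 1" for x
    using prob_space.emeasure_space_1[OF W_prob[of x]] sets_eq_imp_space_eq[OF W_sets[of x]] by simp
  then have "emeasure outp (space Y) = (\<Sum>x\<in>X. ennreal (pmf P x))"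
    by (subst outp_emeasure) auto
  also have "\<dots> = 1" using P_sum by (subst sum_ennreal) auto
  finally show "emeasure outp (space outp) = 1"
    using sets_eq_imp_space_eq[OF outp_sets] by simp
qed

definition "wd x y = enn2real (RN_deriv outp (W x) y)"

lemma wd_meas [measurable]: "wd x \<in> borel_measurable outp"
  unfolding wd_def by measurable

lemma wd_nonneg: "0 \<le> wd x y" by (simp add: wd_def)

lemma wd_density: "x \<in> X \<Longrightarrow> density outp (\<lambda>y. ennreal (wd x y)) = W x"
proof -
  assume x: "x \<in> X"
  interpret outp: prob_space outp by (rule outp_prob)
  interpret Wx: prob_space "W x" by (rule W_prob)
  have ac: "absolutely_continuous outp (W x)"
    unfolding absolutely_continuous_def
  proof
    fix A assume "A \<in> null_sets outp"
    then have A: "A \<in> sets Y" "emeasure outp A = 0" using outp_sets by auto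
    then have "ennreal (pmf P x) * emeasure (W x) A = 0"
      using outp_emeasure[OF A(1)] finP x by (simp add: sum_nonneg_eq_0_iff)
    then show "A \<in> null_sets (W x)" using P_pos[OF x] A W_sets by (auto simp: null_sets_def)
  qed
  have s: "sets (W x) = sets outp" using W_sets outp_sets by simp
  have "AE y in outp. RN_deriv outp (W x) y \<noteq> \<infinity>"
    using outp.RN_deriv_finite[OF Wx.sigma_finite_measure_axioms ac s] .
  then have "density outp (\<lambda>y. ennreal (wd x y)) = density outp (RN_deriv outp (W x))"
    unfolding wd_def by (intro density_cong) (auto simp: top.not_eq_extremum)
  also have "\<dots> = W x" by (rule outp.density_RN_deriv[OF ac s])
  finally show ?thesis .
qed

lemma wd_sum: "AE y in outp. (\<Sum>x\<in>X. pmf P x * wd x y) = 1"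
proof (rule real_density_unique)
  interpret outp: prob_space outp by (rule outp_prob)
  show "density outp (\<lambda>y. ennreal (\<Sum>x\<in>X. pmf P x * wd x y)) = density outp (\<lambda>y. ennreal 1)"
  proof (rule measure_eqI)
    fix A assume "A \<in> sets (density outp (\<lambda>y. ennreal (\<Sum>x\<in>X. pmf P x * wd x y)))"
    then have A: "A \<in> sets outp" "A \<in> sets Y" using outp_sets by auto
    have "emeasure (density outp (\<lambda>y. ennreal (\<Sum>x\<in>X. pmf P x * wd x y))) A
      = (\<integral>\<^sup>+y. (\<Sum>x\<in>X. ennreal (pmf P x) * (ennreal (wd x y) * indicator A y)) \<partial>outp)"
      using A by (subst emeasure_density) (auto intro!: nn_integral_cong split: split_indicator
          simp: sum_ennreal[symmetric] wd_nonneg ennreal_mult)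
    also have "\<dots> = (\<Sum>x\<in>X. ennreal (pmf P x) * emeasure (density outp (\<lambda>y. ennreal (wd x y))) A)"
      using A by (subst nn_integral_sum) (auto simp: nn_integral_cmult emeasure_density)
    also have "\<dots> = emeasure outp A"
      using A by (simp add: outp_emeasure wd_density)
    finally show "emeasure (density outp (\<lambda>y. ennreal (\<Sum>x\<in>X. pmf P x * wd x y))) A = emeasure (density outp (\<lambda>y. ennreal 1)) A"
      by (simp add: density_1)
  qed simp
  then show "finite_measure (density outp (\<lambda>y. ennreal (\<Sum>x\<in>X. pmf P x * wd x y)))"
    by (simp add: density_1 outp.finite_measure_axioms)
qed (auto intro!: sum_nonneg simp: wd_nonneg)

text \<open>One bound for all letters: nonnegative values with P-average 1 are at most
  \<open>1 / pmf P x\<close>, and the sum exceeds each of these.\<close>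

definition "K0 = (\<Sum>x\<in>X. 1 / pmf P x)"

lemma K0_ge: "x \<in> X \<Longrightarrow> 1 / pmf P x \<le> K0"
  unfolding K0_def using finP P_pos by (intro member_le_sum) (auto simp: less_imp_le)

lemma K0_ge_1: "1 \<le> K0"
proof -
  obtain x where x: "x \<in> X" using set_pmf_not_empty[of P] by blast
  have "1 \<le> 1 / pmf P x" using P_pos[OF x] pmf_le_1[of P x] by simp
  then show ?thesis using K0_ge[OF x] by linarith
qed

lemma le_K0_if_sum_eq_1:
  assumes "(\<Sum>x\<in>X. pmf P x * g x) = 1" "\<And>x. 0 \<le> g x" "x \<in> X"
  shows "g x \<le> K0"
proof -
  have "pmf P x * g x \<le> 1"
    unfolding assms(1)[symmetric] using assms finP by (intro member_le_sum) auto
  then have "g x \<le> 1 / pmf P x" using P_pos[OF assms(3)] by (simp add: field_simps)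
  then show ?thesis using K0_ge[OF assms(3)] by linarith
qed

lemma wd_le: "x \<in> X \<Longrightarrow> AE y in outp. wd x y \<le> K0"
  using wd_sum by eventually_elim (rule le_K0_if_sum_eq_1, auto simp: wd_nonneg)

lemma density_integral_1:
  assumes q: "g \<in> borel_measurable q" "\<And>y. 0 \<le> g y" and d: "prob_space (density q (\<lambda>y. ennreal (g y)))"
  shows "integrable q g" "integral\<^sup>L q g = (1 :: real)"
proof -
  have "(\<integral>\<^sup>+y. ennreal (g y) \<partial>q) = emeasure (density q (\<lambda>y. ennreal (g y))) (space q)"
    using q by (subst emeasure_density) (auto intro!: nn_integral_cong)
  also have "\<dots> = ennreal 1" using prob_space.emeasure_space_1[OF d] by simp
  finally have "has_bochner_integral q g 1"
    using q by (intro has_bochner_integral_nn_integral) auto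
  then show "integrable q g" "integral\<^sup>L q g = 1" by (auto simp: has_bochner_integral_iff)
qed

lemma wd_int: "x \<in> X \<Longrightarrow> integrable outp (wd x)" "x \<in> X \<Longrightarrow> integral\<^sup>L outp (wd x) = 1"
  using density_integral_1[of "wd x" outp] wd_density[of x] W_prob[of x] wd_nonneg by auto

definition "Zq \<alpha> q x = (\<integral>y. ac_dens (W x) q y powr \<alpha> \<partial>q)"

text \<open>By the sum condition q is the average of the tilted outputs.\<close>
definition "is_mean \<alpha> q \<longleftrightarrow> prob_space q \<and> sets q = sets Y \<and>
    (\<forall>x\<in>X. W x = density q (\<lambda>y. ennreal (ac_dens (W x) q y)) \<and> 0 < Zq \<alpha> q x) \<and>
    (AE y in q. (\<Sum>x\<in>X. pmf P x * (ac_dens (W x) q y powr \<alpha> / Zq \<alpha> q x)) = 1)"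

text \<open>\<open>is_mean\<close> refers to the particular version \<open>ac_dens\<close>; this
  criterion accepts any densities g and identifies them almost everywhere.\<close>

lemma is_meanI:
  assumes q: "prob_space q" "sets q = sets Y"
    and g [measurable]: "\<And>x. x \<in> X \<Longrightarrow> g x \<in> borel_measurable q" and nonneg: "\<And>x y. 0 \<le> g x y"
    and W: "\<And>x. x \<in> X \<Longrightarrow> W x = density q (\<lambda>y. ennreal (g x y))"
    and Z: "\<And>x. x \<in> X \<Longrightarrow> Z x = (\<integral>y. g x y powr \<alpha> \<partial>q)" "\<And>x. x \<in> X \<Longrightarrow> 0 < Z x"
    and sum: "AE y in q. (\<Sum>x\<in>X. pmf P x * (g x y powr \<alpha> / Z x)) = 1"
  shows "is_mean \<alpha> q" "\<And>x. x \<in> X \<Longrightarrow> AE y in q. ac_dens (W x) q y = g x y" "\<And>x. x \<in> X \<Longrightarrow> Zq \<alpha> q x = Z x"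
proof -
  have s: "sets q = sets (W x)" for x using q W_sets by simp
  have m [measurable]: "ac_dens (W x) q \<in> borel_measurable q" for x
    using ac_dens_measurable[OF W_prob[of x] q(1) s[of x]] by (simp add: measurable_cong_sets[OF s[of x] refl])
  show ae: "AE y in q. ac_dens (W x) q y = g x y" if "x \<in> X" for x
    by (rule ac_dens_unique[OF W_prob q(1) g[OF that] nonneg W[OF that]])
  show Zq: "Zq \<alpha> q x = Z x" if x: "x \<in> X" for x
    unfolding Zq_def Z(1)[OF x] using ae[OF x] g[OF x] by (intro integral_cong_AE) auto
  have "W x = density q (\<lambda>y. ennreal (ac_dens (W x) q y))" if x: "x \<in> X" for x
  proof -
    have "density q (\<lambda>y. ennreal (ac_dens (W x) q y)) = density q (\<lambda>y. ennreal (g x y))"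
      using ae[OF x] g[OF x] by (intro density_cong) auto
    then show ?thesis using W[OF x] by simp
  qed
  moreover have "AE y in q. \<forall>x\<in>X. ac_dens (W x) q y = g x y"
    using ae finP by (simp add: AE_finite_all)
  with sum have "AE y in q. (\<Sum>x\<in>X. pmf P x * (ac_dens (W x) q y powr \<alpha> / Zq \<alpha> q x)) = 1"
    by eventually_elim (simp add: Zq cong: sum.cong)
  ultimately show "is_mean \<alpha> q" using q Z Zq by (simp add: is_mean_def)
qed

text \<open>Relative to the measure q with density f the letters have densities
  \<open>wd x y / f y\<close>, and the fixed-point equations of the dual problem become the mean
  condition with normalisers \<open>1 / c x\<close>.\<close>

lemma ex_mean:
  assumes \<alpha>: "1 < \<alpha>"
  shows "\<exists>q. is_mean \<alpha> q"
proof -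
  interpret outp: prob_space outp by (rule outp_prob)
  interpret weighted_densities outp X "pmf P" wd \<alpha> K0
    by unfold_locales (use finP P_pos P_sum wd_nonneg wd_int wd_le wd_sum \<alpha> K0_ge_1 in auto)
  obtain f c where f [measurable]: "f \<in> borel_measurable outp" and f_nonneg: "\<And>y. 0 \<le> f y"
    and f_pos: "AE y in outp. 0 < f y" and c: "\<And>x. 0 < c x"
    and fi: "integrable outp f" "integral\<^sup>L outp f = 1"
    and fp: "\<And>y. f y powr \<alpha> = (\<Sum>x\<in>X. pmf P x * c x * wd x y powr \<alpha>)"
    and cN: "\<And>x. x \<in> X \<Longrightarrow> c x * (\<integral>y. wd x y powr \<alpha> * f y powr (1 - \<alpha>) \<partial>outp) = 1"
    by (rule fixed_point) blast
  define q where "q = density outp (\<lambda>y. ennreal (f y))"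
  have q: "prob_space q"
  proof (rule prob_spaceI)
    have "emeasure q (space q) = (\<integral>\<^sup>+y. ennreal (f y) \<partial>outp)"
      unfolding q_def by (subst emeasure_density) (auto intro!: nn_integral_cong)
    also have "\<dots> = 1" using fi f_nonneg by (subst nn_integral_eq_integral) auto
    finally show "emeasure q (space q) = 1" .
  qed
  have "is_mean \<alpha> q"
  proof (rule is_meanI(1)[where g = "\<lambda>x y. wd x y / f y" and Z = "\<lambda>x. 1 / c x"])
    show "sets q = sets Y" by (simp add: q_def outp_sets)
    show "(\<lambda>y. wd x y / f y) \<in> borel_measurable q" for x by (simp add: q_def)
    show "0 \<le> wd x y / f y" for x y using f_nonneg wd_nonneg by simp
    show "W x = density q (\<lambda>y. ennreal (wd x y / f y))" if x: "x \<in> X" for x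
    proof -
      have "density q (\<lambda>y. ennreal (wd x y / f y)) = density outp (\<lambda>y. ennreal (f y) * ennreal (wd x y / f y))"
        unfolding q_def by (rule density_density_eq) auto
      also have "\<dots> = density outp (\<lambda>y. ennreal (wd x y))"
        using f_pos by (intro density_cong) (auto elim!: eventually_mono simp: ennreal_mult'[symmetric])
      finally show ?thesis using wd_density[OF x] by simp
    qed
    show "1 / c x = (\<integral>y. (wd x y / f y) powr \<alpha> \<partial>q)" if x: "x \<in> X" for x
    proof -
      have "(\<integral>y. (wd x y / f y) powr \<alpha> \<partial>q) = (\<integral>y. f y * (wd x y / f y) powr \<alpha> \<partial>outp)"
        unfolding q_def by (subst integral_density) (auto simp: f_nonneg)
      also have "\<dots> = (\<integral>y. wd x y powr \<alpha> * f y powr (1 - \<alpha>) \<partial>outp)"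
      proof (rule integral_cong_AE)
        show "AE y in outp. f y * (wd x y / f y) powr \<alpha> = wd x y powr \<alpha> * f y powr (1 - \<alpha>)"
          using f_pos
        proof eventually_elim
          case (elim y)
          then show ?case using wd_nonneg[of x y] by (simp add: powr_divide powr_diff)
        qed
      qed simp_all
      finally show ?thesis using cN[OF x] c[of x] by (simp add: field_simps)
    qed
    show "0 < 1 / c x" for x using c by simp
    have "AE y in outp. (\<Sum>x\<in>X. pmf P x * ((wd x y / f y) powr \<alpha> / (1 / c x))) = 1"
      using f_pos
    proof eventually_elim
      case (elim y)
      have "(\<Sum>x\<in>X. pmf P x * ((wd x y / f y) powr \<alpha> / (1 / c x))) = (\<Sum>x\<in>X. pmf P x * c x * wd x y powr \<alpha>) / f y powr \<alpha>"
        unfolding sum_divide_distrib using elim wd_nonneg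
        by (intro sum.cong) (auto simp: powr_divide mult_ac)
      then show ?case using elim by (simp flip: fp)
    qed
    then show "AE y in q. (\<Sum>x\<in>X. pmf P x * ((wd x y / f y) powr \<alpha> / (1 / c x))) = 1"
      unfolding q_def by (subst AE_density) (auto elim: eventually_mono)
  qed (rule q)
  then show ?thesis by blast
qed

end

lemma ereal_weighted_sum_ge:
  assumes "finite X" "\<And>x. x \<in> X \<Longrightarrow> 0 \<le> p x" "\<And>x. x \<in> X \<Longrightarrow> ereal (c x) \<le> R x"
  shows "ereal (\<Sum>x\<in>X. p x * c x) \<le> (\<Sum>x\<in>X. ereal (p x) * R x)"
proof -
  have "ereal (\<Sum>x\<in>X. p x * c x) = (\<Sum>x\<in>X. ereal (p x) * ereal (c x))" by simp
  also have "\<dots> \<le> (\<Sum>x\<in>X. ereal (p x) * R x)"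
    using assms by (intro sum_mono ereal_mult_left_mono) auto
  finally show ?thesis .
qed

text \<open>The lower bounds exclude - \<infinity>, so an infinite term could not be compensated and
  would make the total infinite.\<close>

lemma ereal_weighted_sum_finite:
  assumes fin: "finite X" and p: "\<And>x. x \<in> X \<Longrightarrow> 0 < p x" and R: "\<And>x. x \<in> X \<Longrightarrow> ereal (c x) \<le> R x"
    and s: "(\<Sum>x\<in>X. ereal (p x) * R x) = ereal s"
  shows "\<exists>r. (\<forall>x\<in>X. R x = ereal (r x)) \<and> s = (\<Sum>x\<in>X. p x * r x)"
proof -
  have "R x \<noteq> \<infinity>" if x: "x \<in> X" for x
  proof
    assume "R x = \<infinity>"
    then have "ereal (p x) * R x = \<infinity>" using p[OF x] by simp
    moreover have "ereal (p z) * R z \<noteq> - \<infinity>" if "z \<in> X" for z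
      using p[OF that] R[OF that] by (cases "R z") auto
    ultimately have "(\<Sum>x\<in>X. ereal (p x) * R x) = \<infinity>" using fin x by (auto simp: sum_Pinfty)
    then show False using s by simp
  qed
  moreover have "R x \<noteq> - \<infinity>" if "x \<in> X" for x using R[OF that] by auto
  ultimately have r: "R x = ereal (real_of_ereal (R x))" if "x \<in> X" for x
    using that by (cases "R x") auto
  have "ereal s = (\<Sum>x\<in>X. ereal (p x) * ereal (real_of_ereal (R x)))"
    unfolding s[symmetric] using r by (intro sum.cong) auto
  then have "s = (\<Sum>x\<in>X. p x * real_of_ereal (R x))" by simp
  with r show ?thesis by (intro exI[of _ "\<lambda>x. real_of_ereal (R x)"]) auto
qed

lemma ac_dens_self: "prob_space q \<Longrightarrow> AE y in q. ac_dens q q y = 1"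
  by (intro ac_dens_unique) (auto simp: density_1)

lemma ac_dens_integrable:
  assumes P: "prob_space q" "prob_space Q" and s: "sets Q = sets q"
  shows "integrable q (ac_dens Q q)" "integral\<^sup>L q (ac_dens Q q) \<le> 1"
proof -
  have [measurable]: "ac_dens Q q \<in> borel_measurable q"
    using ac_dens_measurable[OF P(2,1) s[symmetric]] by (simp add: measurable_cong_sets[OF s refl])
  have le: "(\<integral>\<^sup>+y. ennreal (ac_dens Q q y) \<partial>q) \<le> 1" by (rule ac_dens_integral_le(1)[OF P s])
  then show i: "integrable q (ac_dens Q q)"
    by (intro integrableI_nonneg AE_I2 ac_dens_nonneg le_less_trans[OF le]) auto
  have "ennreal (integral\<^sup>L q (ac_dens Q q)) \<le> ennreal 1"
    using le i by (subst nn_integral_eq_integral[symmetric]) (auto simp: ac_dens_nonneg)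
  then show "integral\<^sup>L q (ac_dens Q q) \<le> 1" by (subst (asm) ennreal_le_iff) auto
qed

context channel_input
begin

text \<open>Mutual information of a channel whose output distribution is q; only the inequality
  ln u \<le> u - 1 enters, so no chain rule for relative entropies is needed.\<close>
lemma augustin_info_1:
  assumes q: "prob_space q" "sets q = sets Y"
    and v [measurable]: "\<And>x. x \<in> X \<Longrightarrow> v x \<in> borel_measurable q" and nonneg: "\<And>x y. 0 \<le> v x y"
    and V: "\<And>x. x \<in> X \<Longrightarrow> V x = density q (\<lambda>y. ennreal (v x y))" "\<And>x. x \<in> X \<Longrightarrow> prob_space (V x)"
    and sum: "AE y in q. (\<Sum>x\<in>X. pmf P x * v x y) = 1"
  shows "augustin_info Y V P 1 = ereal (\<Sum>x\<in>X. pmf P x * (\<integral>y. v x y * ln (v x y) \<partial>q))"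
proof -
  interpret q: prob_space q by (rule q(1))
  have bd: "bounded_density q (v x) K0" if x: "x \<in> X" for x
  proof unfold_locales
    show "AE y in q. v x y \<le> K0"
      using sum by eventually_elim (rule le_K0_if_sum_eq_1, auto simp: nonneg x)
  qed (use x v nonneg K0_ge_1 in auto)
  have v1: "integrable q (v x)" "integral\<^sup>L q (v x) = 1" if x: "x \<in> X" for x
    using density_integral_1[of "v x" q] V[OF x] v[OF x] nonneg by auto
  have rd: "renyi_div 1 (V x) Q = renyi_dens 1 q (v x) (ac_dens Q q)" if "x \<in> X" "prob_space Q" "sets Q = sets q" for x Q
    using that V q v nonneg by (intro renyi_div_density) auto
  have lower: "ereal (\<Sum>x\<in>X. pmf P x * (\<integral>y. v x y * ln (v x y) \<partial>q)) \<le> cond_renyi 1 V Q P"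
    if Q: "Q \<in> prob_measures Y" for Q
  proof -
    have Q': "prob_space Q" "sets Q = sets q" using Q q by (auto simp: prob_measures_iff)
    define u where "u = ac_dens Q q"
    have u: "integrable q u" "integral\<^sup>L q u \<le> 1" "\<And>y. 0 \<le> u y"
      using ac_dens_integrable[OF q(1) Q'] by (auto simp: u_def ac_dens_nonneg)
    have vu: "integrable q (\<lambda>y. v x y * u y)" if x: "x \<in> X" for x
    proof -
      have "integrable q (\<lambda>y. K0 * u y)" using u by simp
      then show ?thesis
      proof (rule Bochner_Integration.integrable_bound)
        show "AE y in q. norm (v x y * u y) \<le> norm (K0 * u y)"
          using bounded_density.a_le[OF bd[OF x]]
        proof eventually_elim
          case (elim y)
          then have "\<bar>v x y\<bar> * \<bar>u y\<bar> \<le> \<bar>K0\<bar> * \<bar>u y\<bar>"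
            using nonneg[of x y] by (intro mult_right_mono) auto
          then show ?case unfolding real_norm_def abs_mult .
        qed
      qed (use u v[OF x] in auto)
    qed
    have "(\<Sum>x\<in>X. pmf P x * (\<integral>y. v x y * u y \<partial>q)) = (\<integral>y. (\<Sum>x\<in>X. pmf P x * (v x y * u y)) \<partial>q)"
      using vu by (subst Bochner_Integration.integral_sum) auto
    also have "\<dots> = (\<integral>y. u y \<partial>q)"
    proof (rule integral_cong_AE)
      show "AE y in q. (\<Sum>x\<in>X. pmf P x * (v x y * u y)) = u y"
        using sum
      proof eventually_elim
        case (elim y)
        have "(\<Sum>x\<in>X. pmf P x * (v x y * u y)) = (\<Sum>x\<in>X. pmf P x * v x y) * u y"
          by (simp add: sum_distrib_right mult.assoc)
        then show ?case using elim by simp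
      qed
    qed (use u v in \<open>auto intro!: borel_measurable_sum borel_measurable_times\<close>)
    finally have "(\<Sum>x\<in>X. pmf P x * (\<integral>y. v x y * u y \<partial>q)) \<le> 1" using u by simp
    then have "(\<Sum>x\<in>X. pmf P x * (\<integral>y. v x y * ln (v x y) \<partial>q))
        \<le> (\<Sum>x\<in>X. pmf P x * ((\<integral>y. v x y * ln (v x y) \<partial>q) + 1 - (\<integral>y. v x y * u y \<partial>q)))"
      using P_sum by (simp add: distrib_left right_diff_distrib sum.distrib sum_subtractf)
    then have "ereal (\<Sum>x\<in>X. pmf P x * (\<integral>y. v x y * ln (v x y) \<partial>q))
        \<le> ereal (\<Sum>x\<in>X. pmf P x * ((\<integral>y. v x y * ln (v x y) \<partial>q) + 1 - (\<integral>y. v x y * u y \<partial>q)))" by simp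
    also have "\<dots> \<le> cond_renyi 1 V Q P"
      unfolding cond_renyi_def
    proof (rule ereal_weighted_sum_ge[OF finP])
      fix x assume x: "x \<in> X"
      show "ereal ((\<integral>y. v x y * ln (v x y) \<partial>q) + 1 - (\<integral>y. v x y * u y \<partial>q)) \<le> renyi_div 1 (V x) Q"
        unfolding rd[OF x Q'] u_def[symmetric]
        by (rule bounded_density.kl_dens_ge[OF bd[OF x] v1(2)[OF x] u(1,3)])
    qed simp
    finally show ?thesis .
  qed
  have "cond_renyi 1 V q P = ereal (\<Sum>x\<in>X. pmf P x * (\<integral>y. v x y * ln (v x y) \<partial>q))"
  proof -
    have [measurable]: "ac_dens q q \<in> borel_measurable q" using ac_dens_measurable[OF q(1) q(1)] by simp
    have "renyi_div 1 (V x) q = ereal (\<integral>y. v x y * ln (v x y) \<partial>q)" if x: "x \<in> X" for x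
      unfolding rd[OF x q(1) refl] by (rule bounded_density.kl_dens_one[OF bd[OF x] ac_dens_self[OF q(1)]]) simp
    then show ?thesis by (simp add: cond_renyi_def)
  qed
  moreover have "q \<in> prob_measures Y" using q by (simp add: prob_measures_iff)
  ultimately show ?thesis
    unfolding augustin_info_def using lower by (intro antisym INF_greatest INF_lower2[of q]) auto
qed

end

section \<open>Optimality and uniqueness of the mean\<close>

locale channel_mean = channel_input +
  fixes \<alpha> :: real and q :: "'a measure"
  assumes \<alpha>: "1 < \<alpha>" and mean: "is_mean \<alpha> q"
begin

lemma q_prob: "prob_space q" and q_sets: "sets q = sets Y"
  using mean by (auto simp: is_mean_def)

definition "a x = ac_dens (W x) q"
definition "Zx x = Zq \<alpha> q x"
text \<open>The mean condition bounds the tilted density \<open>a x y powr \<alpha> / Zx x\<close>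
  by K0; this is the resulting bound for a, raised to at least 1 as \<open>bounded_density\<close>
  asks.\<close>

definition "Kx x = max 1 ((K0 * Zx x) powr (1 / \<alpha>))"

lemma a_meas: "a x \<in> borel_measurable q"
proof -
  have s: "sets q = sets (W x)" using q_sets W_sets by simp
  show ?thesis unfolding a_def
    using ac_dens_measurable[OF W_prob[of x] q_prob s] by (simp add: measurable_cong_sets[OF s refl])
qed

lemma a_nonneg: "0 \<le> a x y" by (simp add: a_def ac_dens_nonneg)

lemma W_density: "x \<in> X \<Longrightarrow> W x = density q (\<lambda>y. ennreal (a x y))"
  using mean by (simp add: is_mean_def a_def)

lemma Zx_pos: "x \<in> X \<Longrightarrow> 0 < Zx x"
  using mean by (simp add: is_mean_def Zx_def)

lemma a_int: "x \<in> X \<Longrightarrow> integrable q (a x)" "x \<in> X \<Longrightarrow> integral\<^sup>L q (a x) = 1"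
  using density_integral_1[OF a_meas a_nonneg, of x] W_density[of x] W_prob[of x] by auto

lemma v_sum: "AE y in q. (\<Sum>x\<in>X. pmf P x * (if x \<in> X then a x y powr \<alpha> / Zx x else 0)) = 1"
  using mean by (simp add: is_mean_def a_def Zx_def cong: sum.cong)

lemma bounded_density_a: "x \<in> X \<Longrightarrow> bounded_density q (a x) (Kx x)"
proof -
  assume x: "x \<in> X"
  interpret q: prob_space q by (rule q_prob)
  show ?thesis
  proof unfold_locales
    show "AE y in q. a x y \<le> Kx x"
      using v_sum
    proof eventually_elim
      case (elim y)
      have "(if x \<in> X then a x y powr \<alpha> / Zx x else 0) \<le> K0"
        by (rule le_K0_if_sum_eq_1[OF elim _ x]) (use Zx_pos in \<open>auto simp: less_imp_le\<close>)
      then have "a x y powr \<alpha> \<le> K0 * Zx x" using x Zx_pos[OF x] by (simp add: field_simps)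
      then have "(a x y powr \<alpha>) powr (1 / \<alpha>) \<le> (K0 * Zx x) powr (1 / \<alpha>)"
        using \<alpha> by (intro powr_mono2) auto
      then show ?case using \<alpha> a_nonneg[of x y] by (simp add: powr_powr Kx_def)
    qed
  qed (auto simp: a_meas a_nonneg Kx_def)
qed

lemma powr_integral_pos:
  assumes x: "x \<in> X" and \<beta>: "0 < \<beta>"
  shows "0 < (\<integral>y. a x y powr \<beta> \<partial>q)"
proof -
  interpret bounded_density q "a x" "Kx x" by (rule bounded_density_a[OF x])
  have "(\<integral>y. a x y powr \<beta> \<partial>q) \<noteq> 0"
  proof
    assume "(\<integral>y. a x y powr \<beta> \<partial>q) = 0"
    then have "AE y in q. a x y powr \<beta> = 0"
      using integrable_powr[of \<beta>] \<beta> by (subst (asm) integral_nonneg_eq_0_iff_AE) auto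
    then have "AE y in q. a x y = 0" by eventually_elim simp
    then have "integral\<^sup>L q (a x) = 0" by (rule integral_eq_zero_AE)
    then show False using a_int[OF x] by simp
  qed
  moreover have "0 \<le> (\<integral>y. a x y powr \<beta> \<partial>q)" by simp
  ultimately show ?thesis by linarith
qed

lemma tilting_a: "x \<in> X \<Longrightarrow> 0 < \<beta> \<Longrightarrow> tilting q (a x) (Kx x) \<beta>"
  using bounded_density_a powr_integral_pos by (simp add: tilting_def tilting_axioms_def)

lemmas tilting = tilting_a[of _ \<alpha>]

lemma \<alpha>0: "0 < \<alpha>" using \<alpha> by simp

definition "v x = tilting.v q (a x) \<alpha>"
definition "e x = tilting.E q (a x) \<alpha>"

lemma Z_eq:
  assumes x: "x \<in> X"
  shows "tilting.Z q (a x) \<alpha> = Zx x"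
proof -
  interpret t: tilting q "a x" "Kx x" \<alpha> by (rule tilting[OF x \<alpha>0])
  show ?thesis unfolding t.Z_def unfolding Zx_def Zq_def a_def ..
qed

lemma v_eq:
  assumes x: "x \<in> X"
  shows "v x y = a x y powr \<alpha> / Zx x"
proof -
  interpret t: tilting q "a x" "Kx x" \<alpha> by (rule tilting[OF x \<alpha>0])
  show ?thesis unfolding v_def t.v_def Z_eq[OF x] ..
qed

lemma v_sum': "AE y in q. (\<Sum>x\<in>X. pmf P x * v x y) = 1"
  using v_sum by (simp add: v_eq cong: sum.cong)

definition "log_Z = (\<Sum>x\<in>X. pmf P x * ln (Zx x))"
definition "mean_llr = (\<Sum>x\<in>X. pmf P x * e x)"

context
  fixes \<alpha>' :: real and Q :: "'a measure"
  assumes \<alpha>': "1 < \<alpha>'" and Q: "Q \<in> prob_measures Y"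
begin

private definition "u = ac_dens Q q"
private definition "c x = tilting.mean_expo q (a x) \<alpha> \<alpha>' u"

private lemma Q': "prob_space Q" "sets Q = sets q"
  using Q q_sets by (auto simp: prob_measures_iff)

private lemma u: "integrable q u" "integral\<^sup>L q u \<le> 1" "0 \<le> u y"
  using ac_dens_integrable[OF q_prob Q'] by (auto simp: u_def ac_dens_nonneg)

private lemma rd: "x \<in> X \<Longrightarrow> renyi_div \<alpha>' (W x) Q = renyi_dens \<alpha>' q (a x) u"
  unfolding u_def by (rule renyi_div_density[OF q_prob Q'(1) W_prob Q'(2) a_meas a_nonneg W_density])

private lemma I_ge: "x \<in> X \<Longrightarrow> ennreal (exp (c x)) \<le> (\<integral>\<^sup>+y. renyi_integrand \<alpha>' (a x y) (u y) \<partial>q)"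
  unfolding c_def by (rule tilting.renyi_integral_ge[OF tilting[OF _ \<alpha>0] \<alpha>' u(1,3)])

private lemma rd_ge: "x \<in> X \<Longrightarrow> ereal (c x / (\<alpha>' - 1)) \<le> renyi_div \<alpha>' (W x) Q"
proof -
  assume x: "x \<in> X"
  define I where "I = (\<integral>\<^sup>+y. renyi_integrand \<alpha>' (a x y) (u y) \<partial>q)"
  show ?thesis
  proof (cases "I = \<infinity>")
    case False
    then have I: "I = ennreal (enn2real I)" by (simp add: top.not_eq_extremum)
    have le: "exp (c x) \<le> enn2real I"
    proof -
      have "ennreal (exp (c x)) \<le> ennreal (enn2real I)"
        using I_ge[OF x] unfolding I_def[symmetric] I[symmetric] .
      then show ?thesis by (subst (asm) ennreal_le_iff) auto
    qed
    then have pos: "0 < enn2real I" using exp_gt_zero[of "c x"] by linarith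
    have "c x \<le> ln (enn2real I)" using le pos by (simp add: ln_ge_iff)
    then have "c x / (\<alpha>' - 1) \<le> ln (enn2real I) / (\<alpha>' - 1)" using \<alpha>' by (intro divide_right_mono) auto
    moreover have "I \<noteq> 0" using pos by auto
    ultimately show ?thesis using False \<alpha>' x
      by (simp add: rd renyi_dens_def Let_def I_def)
  qed (use x \<alpha>' in \<open>simp add: rd renyi_dens_def Let_def I_def\<close>)
qed

text \<open>This is where the mean condition acts: the tilted densities average to 1, so the terms
  in u add up to the mass of the absolutely continuous part of Q, which is at most 1. What depends
  on Q thus drops out with the right sign.\<close>

private lemma sum_c: "log_Z + (\<alpha>' - \<alpha>) * mean_llr \<le> (\<Sum>x\<in>X. pmf P x * c x)"
proof -
  have vu: "integrable q (\<lambda>y. v x y * u y)" if x: "x \<in> X" for x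
    unfolding v_def by (rule tilting.integrable_v_mult[OF tilting[OF x \<alpha>0] u(1)])
  have vm: "v x \<in> borel_measurable q" if x: "x \<in> X" for x
    unfolding v_def by (rule tilting.v_meas[OF tilting[OF x \<alpha>0]])
  have "(\<Sum>x\<in>X. pmf P x * (\<integral>y. v x y * u y \<partial>q)) = (\<integral>y. (\<Sum>x\<in>X. pmf P x * (v x y * u y)) \<partial>q)"
    using vu by (subst Bochner_Integration.integral_sum) auto
  also have "\<dots> = (\<integral>y. u y \<partial>q)"
  proof (rule integral_cong_AE)
    show "AE y in q. (\<Sum>x\<in>X. pmf P x * (v x y * u y)) = u y"
      using v_sum'
    proof eventually_elim
      case (elim y)
      have "(\<Sum>x\<in>X. pmf P x * (v x y * u y)) = (\<Sum>x\<in>X. pmf P x * v x y) * u y"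
        by (simp add: sum_distrib_right mult.assoc)
      then show ?case using elim by simp
    qed
  qed (use u vm in \<open>auto intro!: borel_measurable_sum borel_measurable_times\<close>)
  finally have le: "(\<Sum>x\<in>X. pmf P x * (\<integral>y. v x y * u y \<partial>q)) \<le> 1" using u by simp
  have cx: "c x = ln (Zx x) + (\<alpha>' - \<alpha>) * e x + (\<alpha>' - 1) * (1 - (\<integral>y. v x y * u y \<partial>q))" if x: "x \<in> X" for x
    unfolding c_def tilting.mean_expo_def[OF tilting[OF x \<alpha>0] \<alpha>' u(1,3)] Z_eq[OF x] e_def v_def ..
  have "(\<Sum>x\<in>X. pmf P x * c x) = (\<Sum>x\<in>X. pmf P x * ln (Zx x) + (\<alpha>' - \<alpha>) * (pmf P x * e x)
      + (\<alpha>' - 1) * (pmf P x - pmf P x * (\<integral>y. v x y * u y \<partial>q)))"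
    by (intro sum.cong) (auto simp: cx algebra_simps)
  also have "\<dots> = log_Z + (\<alpha>' - \<alpha>) * mean_llr + (\<alpha>' - 1) * (1 - (\<Sum>x\<in>X. pmf P x * (\<integral>y. v x y * u y \<partial>q)))"
    by (simp add: sum.distrib sum_distrib_left[symmetric] sum_subtractf P_sum log_Z_def mean_llr_def)
  finally show ?thesis using le \<alpha>' by simp
qed

lemma cond_renyi_ge: "ereal ((log_Z + (\<alpha>' - \<alpha>) * mean_llr) / (\<alpha>' - 1)) \<le> cond_renyi \<alpha>' W Q P"
proof -
  have "(log_Z + (\<alpha>' - \<alpha>) * mean_llr) / (\<alpha>' - 1) \<le> (\<Sum>x\<in>X. pmf P x * c x) / (\<alpha>' - 1)"
    using sum_c \<alpha>' by (intro divide_right_mono) auto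
  also have "\<dots> = (\<Sum>x\<in>X. pmf P x * (c x / (\<alpha>' - 1)))" by (simp add: sum_divide_distrib)
  finally have "ereal ((log_Z + (\<alpha>' - \<alpha>) * mean_llr) / (\<alpha>' - 1)) \<le> ereal (\<Sum>x\<in>X. pmf P x * (c x / (\<alpha>' - 1)))" by simp
  also have "\<dots> \<le> cond_renyi \<alpha>' W Q P"
    unfolding cond_renyi_def by (rule ereal_weighted_sum_ge[OF finP]) (auto simp: rd_ge)
  finally show ?thesis .
qed

text \<open>Positive weights turn equality of the sums into equality letter by letter. Almost every
  point has positive v x for some letter, since these densities average to 1; this extends u = 1
  from the separate supports to almost everywhere, and then Q = q.\<close>

lemma cond_renyi_eqD:
  assumes eq: "cond_renyi \<alpha>' W Q P = ereal ((log_Z + (\<alpha>' - \<alpha>) * mean_llr) / (\<alpha>' - 1))"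
  shows "Q = q" "\<And>x. x \<in> X \<Longrightarrow> \<alpha>' \<noteq> \<alpha> \<Longrightarrow> AE y in q. 0 < a x y \<longrightarrow> ln (a x y) = e x"
proof -
  obtain r where r: "\<And>x. x \<in> X \<Longrightarrow> renyi_div \<alpha>' (W x) Q = ereal (r x)"
    and s: "(log_Z + (\<alpha>' - \<alpha>) * mean_llr) / (\<alpha>' - 1) = (\<Sum>x\<in>X. pmf P x * r x)"
    using ereal_weighted_sum_finite[OF finP P_pos rd_ge eq[unfolded cond_renyi_def]] by blast
  have rc: "c x / (\<alpha>' - 1) \<le> r x" if "x \<in> X" for x using rd_ge[OF that] r[OF that] by simp
  have "(\<Sum>x\<in>X. pmf P x * (r x - c x / (\<alpha>' - 1))) \<le> 0"
  proof -
    have "(\<Sum>x\<in>X. pmf P x * r x) \<le> (\<Sum>x\<in>X. pmf P x * c x) / (\<alpha>' - 1)"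
      unfolding s[symmetric] using sum_c \<alpha>' by (intro divide_right_mono) auto
    then show ?thesis by (simp add: right_diff_distrib sum_subtractf sum_divide_distrib)
  qed
  moreover have nn: "0 \<le> pmf P x * (r x - c x / (\<alpha>' - 1))" if "x \<in> X" for x
    using rc[OF that] by simp
  ultimately have "(\<Sum>x\<in>X. pmf P x * (r x - c x / (\<alpha>' - 1))) = 0"
    by (meson antisym sum_nonneg)
  then have "\<forall>x\<in>X. pmf P x * (r x - c x / (\<alpha>' - 1)) = 0"
    by (subst (asm) sum_nonneg_eq_0_iff[OF finP]) (use nn in auto)
  then have rc': "r x = c x / (\<alpha>' - 1)" if "x \<in> X" for x
    using that P_pos[OF that] by (force simp del: mult_eq_0_iff simp: mult_eq_0_iff)
  have "(\<integral>\<^sup>+y. renyi_integrand \<alpha>' (a x y) (u y) \<partial>q) = ennreal (exp (c x))" if x: "x \<in> X" for x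
  proof -
    define I where "I = (\<integral>\<^sup>+y. renyi_integrand \<alpha>' (a x y) (u y) \<partial>q)"
    have I: "I \<noteq> \<infinity>" "I \<noteq> 0" "ln (enn2real I) / (\<alpha>' - 1) = c x / (\<alpha>' - 1)"
      using r[OF x] \<alpha>' x by (auto simp: rd renyi_dens_def Let_def I_def[symmetric] rc' split: if_splits)
    have "0 < enn2real I" using I by (simp add: enn2real_positive_iff top.not_eq_extremum zero_less_iff_neq_zero)
    then have "exp (ln (enn2real I)) = enn2real I" by (rule exp_ln)
    moreover have "ln (enn2real I) = c x" using I(3) \<alpha>' by simp
    ultimately have "enn2real I = exp (c x)" by simp
    moreover have "ennreal (enn2real I) = I" using I(1) by (simp add: top.not_eq_extremum)
    ultimately show ?thesis unfolding I_def[symmetric] by simp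
  qed
  then have ae: "AE y in q. 0 < v x y \<longrightarrow> u y = 1 \<and> (\<alpha>' - \<alpha>) * (ln (a x y) - e x) = 0" if x: "x \<in> X" for x
    unfolding v_def e_def using x by (intro tilting.renyi_integral_eqD[OF tilting[OF x \<alpha>0] \<alpha>' u(1,3)]) (auto simp: c_def)
  show "AE y in q. 0 < a x y \<longrightarrow> ln (a x y) = e x" if x: "x \<in> X" and ne: "\<alpha>' \<noteq> \<alpha>" for x
    using ae[OF x]
  proof eventually_elim
    case (elim y)
    then show ?case using ne tilting.v_pos_iff[OF tilting[OF x \<alpha>0]] by (simp add: v_def)
  qed
  have "AE y in q. \<forall>x\<in>X. 0 < v x y \<longrightarrow> u y = 1"
  proof (rule AE_finite_allI[OF finP])
    fix x assume "x \<in> X"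
    from ae[OF this] show "AE y in q. 0 < v x y \<longrightarrow> u y = 1" by eventually_elim simp
  qed
  with v_sum' have "AE y in q. ac_dens Q q y = 1"
  proof eventually_elim
    case (elim y)
    obtain x where x: "x \<in> X" "0 < pmf P x * v x y"
      using elim(1) sum_nonpos[of X "\<lambda>x. pmf P x * v x y"] by force
    then have "0 < v x y" using P_pos[OF x(1)] by (simp add: zero_less_mult_iff)
    then show ?case using elim(2) x(1) unfolding u_def by blast
  qed
  then show "Q = q" by (rule ac_dens_integral_le(2)[OF q_prob Q'])
qed

end

lemma renyi_div_self: "x \<in> X \<Longrightarrow> 1 < \<beta> \<Longrightarrow> renyi_div \<beta> (W x) q = ereal (ln (\<integral>y. a x y powr \<beta> \<partial>q) / (\<beta> - 1))"
proof -
  assume x: "x \<in> X" and \<beta>: "1 < \<beta>"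
  have t: "tilting q (a x) (Kx x) \<beta>" using \<beta> by (intro tilting_a[OF x]) simp
  have "renyi_div \<beta> (W x) q = renyi_dens \<beta> q (a x) (ac_dens q q)"
    by (rule renyi_div_density[OF q_prob q_prob W_prob refl a_meas a_nonneg W_density[OF x]])
  also have "\<dots> = ereal (ln (tilting.Z q (a x) \<beta>) / (\<beta> - 1))"
    using \<beta> ac_dens_self[OF q_prob] by (intro tilting.renyi_dens_one[OF t]) auto
  finally show ?thesis by (simp add: tilting.Z_def[OF t])
qed

lemma cond_renyi_self: "1 < \<beta> \<Longrightarrow> cond_renyi \<beta> W q P = ereal ((\<Sum>x\<in>X. pmf P x * ln (\<integral>y. a x y powr \<beta> \<partial>q)) / (\<beta> - 1))"
  by (simp add: cond_renyi_def renyi_div_self sum_divide_distrib)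

lemma Zx_eq: "Zx x = (\<integral>y. a x y powr \<alpha> \<partial>q)" by (simp add: Zx_def Zq_def a_def)

lemma q_in: "q \<in> prob_measures Y" using q_prob q_sets by (simp add: prob_measures_iff)

lemma augustin_info_eq: "augustin_info Y W P \<alpha> = ereal (log_Z / (\<alpha> - 1))"
proof -
  have "cond_renyi \<alpha> W q P = ereal (log_Z / (\<alpha> - 1))"
    using cond_renyi_self[OF \<alpha>] by (simp add: log_Z_def Zx_eq)
  then show ?thesis
    unfolding augustin_info_def using cond_renyi_ge[OF \<alpha>] q_in
    by (intro antisym INF_greatest INF_lower2[of q]) auto
qed

lemma augustin_mean_eq: "augustin_mean Y W P \<alpha> = q"
  unfolding augustin_mean_def
proof (rule the_equality)
  show "q \<in> prob_measures Y \<and> cond_renyi \<alpha> W q P = augustin_info Y W P \<alpha>"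
    using q_in cond_renyi_self[OF \<alpha>] by (simp add: augustin_info_eq log_Z_def Zx_eq)
  fix Q assume "Q \<in> prob_measures Y \<and> cond_renyi \<alpha> W Q P = augustin_info Y W P \<alpha>"
  then show "Q = q" using cond_renyi_eqD(1)[OF \<alpha>, of Q] by (simp add: augustin_info_eq)
qed

text \<open>A letter in the support has output dominated by q, so \<open>tilt1\<close> returns W x
  itself and the exponential of the Renyi divergence is \<open>1 / Zx x\<close>.\<close>

lemma tilted_eq: "x \<in> X \<Longrightarrow> tilted \<alpha> (W x) q = density q (\<lambda>y. ennreal (v x y))"
proof -
  assume x: "x \<in> X"
  have t1: "tilt1_dens (W x) q = a x"
    using a_int(2)[OF x] by (auto simp: tilt1_dens_def a_def)
  then have t: "tilt1 (W x) q = W x" using W_density[OF x] by (simp add: tilt1_def)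
  have "exp ((1 - \<alpha>) * real_of_ereal (renyi_div \<alpha> (W x) q)) = exp (- ln (Zx x))"
    using \<alpha> by (simp add: renyi_div_self[OF x \<alpha>] Zx_eq field_simps)
  also have "\<dots> = 1 / Zx x" using Zx_pos[OF x] by (simp add: exp_minus inverse_eq_divide)
  finally show ?thesis by (simp add: tilted_def t t1 v_eq[OF x])
qed

lemma v_prob: "x \<in> X \<Longrightarrow> prob_space (density q (\<lambda>y. ennreal (v x y)))"
proof (rule prob_spaceI)
  assume x: "x \<in> X"
  note t = tilting[OF x \<alpha>0]
  have [measurable]: "v x \<in> borel_measurable q" unfolding v_def by (rule tilting.v_meas[OF t])
  have "emeasure (density q (\<lambda>y. ennreal (v x y))) (space q) = (\<integral>\<^sup>+y. ennreal (v x y) \<partial>q)"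
    by (subst emeasure_density) (auto intro!: nn_integral_cong)
  also have "\<dots> = 1"
    using tilting.integrable_v[OF t] tilting.integral_v[OF t] tilting.v_nonneg[OF t]
    by (subst nn_integral_eq_integral) (auto simp: v_def)
  finally show "emeasure (density q (\<lambda>y. ennreal (v x y))) (space (density q (\<lambda>y. ennreal (v x y)))) = 1" by simp
qed

text \<open>The tilted channel has output distribution q again, so \<open>augustin_info_1\<close>
  applies with q as reference; inserting \<open>ln v = \<alpha> * ln a - ln Z\<close> gives a
  Legendre-type expression.\<close>

lemma tilted_channel_info: "augustin_info Y (tilted_channel Y W P \<alpha>) P 1 = ereal (\<alpha> * mean_llr - log_Z)"
proof -
  \<comment> \<open>The density is set to 0 outside the support because
    \<open>augustin_info_1\<close> asks for nonnegativity at every letter.\<close>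
  have "augustin_info Y (tilted_channel Y W P \<alpha>) P 1 = ereal (\<Sum>x\<in>X. pmf P x * (\<integral>y. (if x \<in> X then v x y else 0) * ln (if x \<in> X then v x y else 0) \<partial>q))"
  proof (rule augustin_info_1[OF q_prob q_sets])
    fix x assume x: "x \<in> X"
    note t = tilting[OF x \<alpha>0]
    show "(\<lambda>y. if x \<in> X then v x y else 0) \<in> borel_measurable q"
      using tilting.v_meas[OF t] x by (simp add: v_def)
    show "tilted_channel Y W P \<alpha> x = density q (\<lambda>y. ennreal (if x \<in> X then v x y else 0))"
      using x by (simp add: tilted_channel_def augustin_mean_eq tilted_eq)
    show "prob_space (tilted_channel Y W P \<alpha> x)"
      using x v_prob by (simp add: tilted_channel_def augustin_mean_eq tilted_eq)
  next
    show "0 \<le> (if x \<in> X then v x y else 0)" for x y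
      using tilting.v_nonneg[OF tilting[OF _ \<alpha>0]] by (simp add: v_def)
    show "AE y in q. (\<Sum>x\<in>X. pmf P x * (if x \<in> X then v x y else 0)) = 1"
      using v_sum' by (simp cong: sum.cong)
  qed
  also have "(\<Sum>x\<in>X. pmf P x * (\<integral>y. (if x \<in> X then v x y else 0) * ln (if x \<in> X then v x y else 0) \<partial>q))
      = (\<Sum>x\<in>X. \<alpha> * (pmf P x * e x) - pmf P x * ln (Zx x))"
  proof (rule sum.cong[OF refl])
    fix x assume x: "x \<in> X"
    interpret t: tilting q "a x" "Kx x" \<alpha> by (rule tilting[OF x \<alpha>0])
    have vv: "v x y = t.v y" for y by (simp add: v_def)
    have "t.v y * ln (t.v y) = \<alpha> * (t.v y * ln (a x y)) - ln (Zx x) * t.v y" for y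
    proof (cases "a x y = 0")
      case False
      then have "0 < a x y" using a_nonneg[of x y] by simp
      then have "ln (t.v y) = \<alpha> * ln (a x y) - ln (Zx x)"
        unfolding t.v_def Z_eq[OF x] using Zx_pos[OF x] by (simp add: ln_div ln_powr)
      then show ?thesis by (simp only: right_diff_distrib mult.left_commute mult.commute[of "ln (Zx x)"])
    qed (simp add: t.v_def)
    then have E: "(\<integral>y. t.v y * ln (t.v y) \<partial>q) = \<alpha> * t.E - ln (Zx x)"
      using t.integrable_v t.integrable_v_ln t.integral_v by (simp add: t.E_def)
    then show "pmf P x * (\<integral>y. (if x \<in> X then v x y else 0) * ln (if x \<in> X then v x y else 0) \<partial>q)
        = \<alpha> * (pmf P x * e x) - pmf P x * ln (Zx x)"
      using x by (simp add: vv e_def E right_diff_distrib mult.left_commute)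
  qed
  also have "\<dots> = \<alpha> * mean_llr - log_Z"
    by (simp add: sum_subtractf sum_distrib_left[symmetric] mean_llr_def log_Z_def)
  finally show ?thesis .
qed

end

section \<open>The strong converse exponent\<close>

text \<open>The derivative has the sign of \<open>r - g\<close>, so an increasing g makes the
  expression unimodal in the order.\<close>

lemma exponent_derivative:
  fixes J :: "real \<Rightarrow> real"
  assumes "0 < \<alpha>" and J: "(J has_real_derivative e) (at \<alpha>)" and g: "g = \<alpha> * e - J \<alpha>"
  shows "((\<lambda>\<alpha>. ((\<alpha> - 1) * r - J \<alpha>) / \<alpha>) has_real_derivative ((r - g) / \<alpha>\<^sup>2)) (at \<alpha>)"
proof -
  have "((\<lambda>\<alpha>. ((\<alpha> - 1) * r - J \<alpha>) / \<alpha>) has_real_derivative (((1 * r - e) * \<alpha> - ((\<alpha> - 1) * r - J \<alpha>) * 1) / (\<alpha> * \<alpha>))) (at \<alpha>)"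
    using assms(1) by (auto intro!: derivative_eq_intros J)
  also have "((1 * r - e) * \<alpha> - ((\<alpha> - 1) * r - J \<alpha>) * 1) / (\<alpha> * \<alpha>) = (r - g) / \<alpha>\<^sup>2"
    by (simp add: g power2_eq_square algebra_simps)
  finally show ?thesis .
qed

text \<open>The envelope theorem behind the strong converse exponent: writing s = (\<alpha> - 1)/\<alpha>, the exponent
  is a supremum of affine functions of the rate with slopes s, attained only at the root of g = R.\<close>
lemma envelope_derivative:
  fixes J e g :: "real \<Rightarrow> real" and \<phi> :: "real \<Rightarrow> real \<Rightarrow> real" and Es :: "real \<Rightarrow> real"
  assumes J_deriv: "\<And>\<alpha>. 1 < \<alpha> \<Longrightarrow> (J has_real_derivative e \<alpha>) (at \<alpha>)"
    and g: "\<And>\<alpha>. 1 < \<alpha> \<Longrightarrow> g \<alpha> = \<alpha> * e \<alpha> - J \<alpha>"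
    and g_mono: "\<And>\<alpha> \<beta>. 1 < \<alpha> \<Longrightarrow> \<alpha> < \<beta> \<Longrightarrow> g \<alpha> < g \<beta>"
    and \<phi>: "\<And>r \<alpha>. \<phi> r \<alpha> = ((\<alpha> - 1) * r - J \<alpha>) / \<alpha>"
    and Es: "\<And>r. Es r = (SUP \<alpha>\<in>{1<..}. \<phi> r \<alpha>)"
    and \<alpha>s: "1 < \<alpha>s" "g \<alpha>s = R"
  shows "Es R = \<phi> R \<alpha>s" "(Es has_real_derivative ((\<alpha>s - 1) / \<alpha>s)) (at R)"
proof -
  define s :: "real \<Rightarrow> real" where "s \<alpha> = (\<alpha> - 1) / \<alpha>" for \<alpha>
  have s_mono: "s \<alpha> \<le> s \<beta>" if "1 < \<alpha>" "\<alpha> \<le> \<beta>" for \<alpha> \<beta> using that by (simp add: s_def field_simps)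
  have \<phi>_deriv: "(\<phi> r has_real_derivative ((r - g \<alpha>) / \<alpha>\<^sup>2)) (at \<alpha>)" if \<alpha>: "1 < \<alpha>" for r \<alpha>
    unfolding \<phi>[abs_def] using \<alpha> by (intro exponent_derivative[OF _ J_deriv[OF \<alpha>] g[OF \<alpha>]]) simp
  have g_mono': "g \<alpha> \<le> g \<beta>" if "1 < \<alpha>" "\<alpha> \<le> \<beta>" for \<alpha> \<beta>
    using g_mono[of \<alpha> \<beta>] that by (cases "\<alpha> = \<beta>") auto
  have up: "\<phi> r \<alpha> \<le> \<phi> r \<beta>" if "1 < \<alpha>" "\<alpha> \<le> \<beta>" "g \<beta> \<le> r" for r \<alpha> \<beta>
  proof (rule DERIV_nonneg_imp_nondecreasing[OF that(2)])
    fix x assume "\<alpha> \<le> x" "x \<le> \<beta>"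
    then show "\<exists>d. (\<phi> r has_real_derivative d) (at x) \<and> 0 \<le> d"
      using \<phi>_deriv[of x r] g_mono'[of x \<beta>] that by (intro exI[of _ "(r - g x) / x\<^sup>2"]) auto
  qed
  have down: "\<phi> r \<beta> \<le> \<phi> r \<alpha>" if "1 < \<alpha>" "\<alpha> \<le> \<beta>" "r \<le> g \<alpha>" for r \<alpha> \<beta>
  proof (rule DERIV_nonpos_imp_nonincreasing[OF that(2)])
    fix x assume "\<alpha> \<le> x" "x \<le> \<beta>"
    then show "\<exists>d. (\<phi> r has_real_derivative d) (at x) \<and> d \<le> 0"
      using \<phi>_deriv[of x r] g_mono'[of \<alpha> x] that
      by (intro exI[of _ "(r - g x) / x\<^sup>2"]) (auto simp: divide_nonpos_nonneg)
  qed
  have max: "\<phi> R \<alpha> \<le> \<phi> R \<alpha>s" if "1 < \<alpha>" for \<alpha>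
    using up[of \<alpha> \<alpha>s R] down[of \<alpha>s \<alpha> R] \<alpha>s that by (cases "\<alpha> \<le> \<alpha>s") auto
  show EsR: "Es R = \<phi> R \<alpha>s"
    unfolding Es by (rule cSup_eq_maximum) (use max \<alpha>s in auto)
  have \<phi>_shift: "\<phi> r \<alpha> = \<phi> R \<alpha> + s \<alpha> * (r - R)" if "1 < \<alpha>" for r \<alpha>
    using that by (simp add: \<phi> s_def field_simps)
  have lower: "Es R + s \<alpha>s * (r - R) \<le> Es r" if "bdd_above (\<phi> r ` {1<..})" for r
  proof -
    have "\<phi> r \<alpha>s \<le> Es r"
      unfolding Es by (rule cSUP_upper[OF _ that]) (use \<alpha>s in simp)
    then show ?thesis unfolding \<phi>_shift[OF \<alpha>s(1), of r] EsR .
  qed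
  \<comment> \<open>A real supremum is informative only for bounded sets, so boundedness is proved
    along with the bound. For r between R and \<open>g \<beta>\<close>, \<phi> r only falls when the
    order moves past \<beta> away from \<alpha>s; on the other side of \<beta> the slopes are
    compared with \<open>s \<beta>\<close>.\<close>
  have upper: "Es r \<le> Es R + s \<beta> * (r - R) \<and> bdd_above (\<phi> r ` {1<..})"
    if \<beta>: "1 < \<beta>" and c: "(R \<le> r \<and> r \<le> g \<beta>) \<or> (g \<beta> \<le> r \<and> r \<le> R)" for r \<beta>
  proof -
    have "\<phi> r \<alpha> \<le> Es R + s \<beta> * (r - R)" if \<alpha>: "1 < \<alpha>" for \<alpha>
    proof -
      have b: "\<phi> r \<gamma> \<le> Es R + s \<beta> * (r - R)" if \<gamma>: "1 < \<gamma>" and d: "(R \<le> r \<and> \<gamma> \<le> \<beta>) \<or> (r \<le> R \<and> \<beta> \<le> \<gamma>)" for \<gamma>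
      proof -
        have "s \<gamma> * (r - R) \<le> s \<beta> * (r - R)"
          using d s_mono[of \<gamma> \<beta>] s_mono[of \<beta> \<gamma>] \<gamma> \<beta> by (auto intro: mult_right_mono mult_right_mono_neg)
        then show ?thesis using max[OF \<gamma>] by (simp add: \<phi>_shift[OF \<gamma>, of r] EsR)
      qed
      show ?thesis
      proof (cases "(R \<le> r \<and> \<alpha> \<le> \<beta>) \<or> (r \<le> R \<and> \<beta> \<le> \<alpha>)")
        case True
        then show ?thesis by (rule b[OF \<alpha>])
      next
        case False
        then have "\<phi> r \<alpha> \<le> \<phi> r \<beta>"
          using c up[of \<alpha> \<beta> r] down[of \<beta> \<alpha> r] \<alpha> \<beta> by auto
        also have "\<phi> r \<beta> \<le> Es R + s \<beta> * (r - R)" by (rule b[OF \<beta>]) (use c in auto)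
        finally show ?thesis .
      qed
    qed
    then show ?thesis unfolding Es by (auto intro!: cSUP_least bdd_aboveI2)
  qed
  have "((\<lambda>h. (Es (R + h) - Es R) / h) \<longlongrightarrow> s \<alpha>s) (at 0)"
  proof (rule LIM_I)
    fix \<epsilon> :: real assume \<epsilon>: "0 < \<epsilon>"
    have "isCont s \<alpha>s" unfolding s_def using \<alpha>s by (intro continuous_intros) auto
    then obtain \<eta> where \<eta>: "0 < \<eta>" "\<And>x. \<bar>x - \<alpha>s\<bar> < \<eta> \<Longrightarrow> \<bar>s x - s \<alpha>s\<bar> < \<epsilon>"
      using \<epsilon> unfolding continuous_at_eps_delta by (auto simp: dist_real_def)
    \<comment> \<open>The half distance to 1 keeps b1 above 1. As g is strictly increasing, the
      values between g b1 and g b2 surround R, and for rates there the difference quotient lies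
      between \<open>s \<alpha>s\<close> and the slope at b1 or b2.\<close>
    define \<zeta> where "\<zeta> = min (\<eta> / 2) ((\<alpha>s - 1) / 2)"
    define b1 where "b1 = \<alpha>s - \<zeta>"
    define b2 where "b2 = \<alpha>s + \<zeta>"
    have "0 < \<zeta>" "\<zeta> < \<eta>" "\<zeta> < \<alpha>s - 1" using \<eta> \<alpha>s by (auto simp: \<zeta>_def min_def)
    then have b: "1 < b1" "b1 < \<alpha>s" "\<alpha>s < b2" "\<bar>s b1 - s \<alpha>s\<bar> < \<epsilon>" "\<bar>s b2 - s \<alpha>s\<bar> < \<epsilon>"
      using \<eta>(2)[of b1] \<eta>(2)[of b2] by (auto simp: b1_def b2_def)
    define \<delta> where "\<delta> = min (g b2 - R) (R - g b1)"
    have \<delta>: "0 < \<delta>" using g_mono[of b1 \<alpha>s] g_mono[of \<alpha>s b2] b \<alpha>s by (auto simp: \<delta>_def)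
    show "\<exists>r>0. \<forall>h. h \<noteq> 0 \<and> norm (h - 0) < r \<longrightarrow> norm ((Es (R + h) - Es R) / h - s \<alpha>s) < \<epsilon>"
    proof (intro exI[of _ \<delta>] conjI allI impI \<delta>)
      fix h :: real assume "h \<noteq> 0 \<and> norm (h - 0) < \<delta>"
      then have h: "h \<noteq> 0" "\<bar>h\<bar> < \<delta>" by auto
      define \<beta> where "\<beta> = (if 0 < h then b2 else b1)"
      have "1 < \<beta>" "(R \<le> R + h \<and> R + h \<le> g \<beta>) \<or> (g \<beta> \<le> R + h \<and> R + h \<le> R)"
        using h b \<alpha>s by (auto simp: \<beta>_def \<delta>_def)
      note u = upper[OF this]
      then have "Es R + s \<alpha>s * h \<le> Es (R + h)" "Es (R + h) \<le> Es R + s \<beta> * h"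
        using lower[of "R + h"] by auto
      then have "\<bar>(Es (R + h) - Es R) / h - s \<alpha>s\<bar> \<le> \<bar>s \<beta> - s \<alpha>s\<bar>"
      proof -
        assume *: "Es R + s \<alpha>s * h \<le> Es (R + h)" "Es (R + h) \<le> Es R + s \<beta> * h"
        define q where "q = (Es (R + h) - Es R) / h"
        have "(s \<alpha>s \<le> q \<and> q \<le> s \<beta>) \<or> (q \<le> s \<alpha>s \<and> s \<beta> \<le> q)"
        proof (cases "0 < h")
          case True
          then show ?thesis using * by (auto simp: q_def pos_le_divide_eq pos_divide_le_eq)
        next
          case False
          then have "h < 0" using h(1) by simp
          then show ?thesis using * by (auto simp: q_def neg_le_divide_eq neg_divide_le_eq)
        qed
        then show ?thesis unfolding q_def[symmetric] by (auto simp: abs_if)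
      qed
      also have "\<dots> < \<epsilon>" using b by (simp add: \<beta>_def)
      finally show "norm ((Es (R + h) - Es R) / h - s \<alpha>s) < \<epsilon>" by simp
    qed
  qed
  then show "(Es has_real_derivative ((\<alpha>s - 1) / \<alpha>s)) (at R)"
    by (simp add: DERIV_def s_def)
qed

lemma DERIV_quadratic_bound:
  fixes J :: "real \<Rightarrow> real"
  assumes \<delta>: "0 < \<delta>" and b: "\<And>h. \<bar>h\<bar> < \<delta> \<Longrightarrow> \<bar>J (x + h) - J x - h * d\<bar> \<le> C * h\<^sup>2"
  shows "(J has_real_derivative d) (at x)"
  unfolding DERIV_def
proof (rule LIM_I)
  fix \<epsilon> :: real assume \<epsilon>: "0 < \<epsilon>"
  have C: "0 \<le> C" using order_trans[OF abs_ge_zero b[of "\<delta> / 2"]] \<delta> by (simp add: zero_le_mult_iff)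
  show "\<exists>r>0. \<forall>h. h \<noteq> 0 \<and> norm (h - 0) < r \<longrightarrow> norm ((J (x + h) - J x) / h - d) < \<epsilon>"
  proof (intro exI[of _ "min \<delta> (\<epsilon> / (C + 1))"] conjI allI impI)
    fix h :: real assume "h \<noteq> 0 \<and> norm (h - 0) < min \<delta> (\<epsilon> / (C + 1))"
    then have h: "h \<noteq> 0" "\<bar>h\<bar> < \<delta>" "\<bar>h\<bar> < \<epsilon> / (C + 1)" by auto
    have "(J (x + h) - J x) / h - d = (J (x + h) - J x - h * d) / h" using h(1) by (simp add: field_simps)
    then have "\<bar>(J (x + h) - J x) / h - d\<bar> = \<bar>J (x + h) - J x - h * d\<bar> / \<bar>h\<bar>" by simp
    also have "\<dots> \<le> C * h\<^sup>2 / \<bar>h\<bar>" using b[OF h(2)] by (intro divide_right_mono) auto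
    also have "\<dots> = C * \<bar>h\<bar>" using h(1) by (simp add: power2_eq_square abs_if)
    also have "\<dots> \<le> (C + 1) * \<bar>h\<bar>" by (simp add: algebra_simps)
    also have "\<dots> < \<epsilon>" using h(3) C by (simp add: field_simps)
    finally show "norm ((J (x + h) - J x) / h - d) < \<epsilon>" by simp
  qed (use \<delta> \<epsilon> C in auto)
qed

section \<open>Convexity and differentiability of \<open>J\<close>\<close>

context channel_input
begin

lemma channel_mean: "1 < \<alpha> \<Longrightarrow> channel_mean Y W P \<alpha> (augustin_mean Y W P \<alpha>)"
proof -
  assume \<alpha>: "1 < \<alpha>"
  obtain q where q: "is_mean \<alpha> q" using ex_mean[OF \<alpha>] by blast
  interpret channel_mean Y W P \<alpha> q by unfold_locales (use \<alpha> q in auto)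
  show ?thesis using augustin_mean_eq channel_mean_axioms by simp
qed

definition "J \<alpha> = (\<alpha> - 1) * real_of_ereal (augustin_info Y W P \<alpha>)"
definition "tilted_info \<alpha> = real_of_ereal (augustin_info Y (tilted_channel Y W P \<alpha>) P 1)"
text \<open>For orders above 1 this is the tilted mean of the log-likelihood ratio, see
  \<open>slope_eq\<close>; the form chosen mentions no particular mean and makes sense for all
  orders at once.\<close>

definition "slope \<alpha> = (tilted_info \<alpha> + J \<alpha>) / \<alpha>"

context
  fixes \<alpha> :: real
  assumes \<alpha>: "1 < \<alpha>"
begin

interpretation m: channel_mean Y W P \<alpha> "augustin_mean Y W P \<alpha>" by (rule channel_mean[OF \<alpha>])

lemma J_eq: "J \<alpha> = m.log_Z" using \<alpha> by (simp add: J_def m.augustin_info_eq)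

lemma tilted_info_eq: "tilted_info \<alpha> = \<alpha> * m.mean_llr - m.log_Z" by (simp add: tilted_info_def m.tilted_channel_info)

lemma slope_eq: "slope \<alpha> = m.mean_llr" using \<alpha> by (simp add: slope_def tilted_info_eq J_eq)

lemma augustin_info_J: "augustin_info Y W P \<alpha> = ereal (J \<alpha> / (\<alpha> - 1))"
  by (simp add: J_eq m.augustin_info_eq)

lemma augustin_info_tilted: "augustin_info Y (tilted_channel Y W P \<alpha>) P 1 = ereal (tilted_info \<alpha>)"
  by (simp add: tilted_info_eq m.tilted_channel_info)

text \<open>Young's inequality \<open>a \<le> 1 - 1 / \<alpha> + a powr \<alpha> / \<alpha>\<close>
  integrates to \<open>1 \<le> Zx x\<close>, so every logarithm in \<open>log_Z\<close> is
  nonnegative.\<close>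

lemma J_nonneg: "0 \<le> J \<alpha>"
proof -
  have "0 \<le> ln (m.Zx x)" if x: "x \<in> X" for x
  proof -
    interpret t: tilting "augustin_mean Y W P \<alpha>" "m.a x" "m.Kx x" \<alpha> by (rule m.tilting[OF x m.\<alpha>0])
    have "integral\<^sup>L (augustin_mean Y W P \<alpha>) (m.a x) \<le> (\<integral>y. 1 - 1 / \<alpha> + 1 / \<alpha> * m.a x y powr \<alpha> \<partial>augustin_mean Y W P \<alpha>)"
    proof (rule integral_mono)
      fix y
      show "m.a x y \<le> 1 - 1 / \<alpha> + 1 / \<alpha> * m.a x y powr \<alpha>"
      proof (cases "m.a x y = 0")
        case False
        then have a: "0 < m.a x y" using m.a_nonneg[of x y] by simp
        have "(m.a x y powr \<alpha>) powr (1 / \<alpha>) \<le> 1 + 1 / \<alpha> * (m.a x y powr \<alpha> - 1)"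
          using a \<alpha> by (intro powr_tangent_le) auto
        then show ?thesis using a \<alpha> by (simp add: powr_powr right_diff_distrib)
      qed (use \<alpha> in simp)
    qed (use m.a_int[OF x] t.integrable_powr[of \<alpha>] \<alpha> in auto)
    also have "\<dots> = 1 - 1 / \<alpha> + 1 / \<alpha> * m.Zx x"
      using t.integrable_powr[of \<alpha>] \<alpha> by (simp add: m.Zx_eq t.prob_space)
    finally have "1 \<le> m.Zx x" using m.a_int(2)[OF x] \<alpha> by (simp add: field_simps)
    then show ?thesis by simp
  qed
  then show ?thesis unfolding J_eq m.log_Z_def by (intro sum_nonneg mult_nonneg_nonneg) auto
qed

text \<open>The mean of order \<open>\<alpha>'\<close> is the competitor in the lower bound that
  belongs to order \<alpha>; its own conditional divergence is
  \<open>J \<alpha>' / (\<alpha>' - 1)\<close>.\<close>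

lemma J_ge: assumes \<alpha>': "1 < \<alpha>'" shows "J \<alpha> + (\<alpha>' - \<alpha>) * slope \<alpha> \<le> J \<alpha>'"
proof -
  interpret m': channel_mean Y W P \<alpha>' "augustin_mean Y W P \<alpha>'" by (rule channel_mean[OF \<alpha>'])
  have "ereal ((m.log_Z + (\<alpha>' - \<alpha>) * m.mean_llr) / (\<alpha>' - 1)) \<le> cond_renyi \<alpha>' W (augustin_mean Y W P \<alpha>') P"
    by (rule m.cond_renyi_ge[OF \<alpha>' m'.q_in])
  also have "\<dots> = ereal (m'.log_Z / (\<alpha>' - 1))"
    using m'.cond_renyi_self[OF \<alpha>'] by (simp add: m'.log_Z_def m'.Zx_eq)
  also have "m'.log_Z = J \<alpha>'" using \<alpha>' by (simp add: J_def m'.augustin_info_eq)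
  finally show ?thesis using \<alpha>' by (simp add: J_eq slope_eq divide_le_cancel)
qed

text \<open>If \<open>ln a\<close> is constant where a is positive, each density takes a single
  nonzero value and its powers are proportional to it. The same measure is then the mean at every
  order above 1, and tilting reproduces the channel.\<close>

lemma degenerate_tilted_channel:
  assumes deg: "\<And>x. x \<in> X \<Longrightarrow> AE y in augustin_mean Y W P \<alpha>. 0 < m.a x y \<longrightarrow> ln (m.a x y) = m.e x"
    and \<beta>: "1 < \<beta>" and x: "x \<in> X"
  shows "tilted_channel Y W P \<beta> x = W x"
proof -
  let ?q = "augustin_mean Y W P \<alpha>"
  have pw: "m.a x y powr \<gamma> = exp ((\<gamma> - 1) * m.e x) * m.a x y" if "0 < m.a x y \<longrightarrow> ln (m.a x y) = m.e x" for x y \<gamma>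
  proof (cases "m.a x y = 0")
    case False
    then have a: "0 < m.a x y" using m.a_nonneg[of x y] by simp
    then have "m.a x y = exp (m.e x)" using that exp_ln[OF a] by simp
    then show ?thesis by (simp add: powr_def mult_exp_exp algebra_simps)
  qed simp
  have aeZ: "(\<integral>y. m.a x y powr \<gamma> \<partial>?q) = exp ((\<gamma> - 1) * m.e x)" if x: "x \<in> X" for x \<gamma>
  proof -
    have [measurable]: "m.a x \<in> borel_measurable ?q" by (rule m.a_meas)
    have "(\<integral>y. m.a x y powr \<gamma> \<partial>?q) = (\<integral>y. exp ((\<gamma> - 1) * m.e x) * m.a x y \<partial>?q)"
    proof (rule integral_cong_AE)
      show "AE y in ?q. m.a x y powr \<gamma> = exp ((\<gamma> - 1) * m.e x) * m.a x y"
        using deg[OF x] by eventually_elim (rule pw)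
    qed simp_all
    then show ?thesis using m.a_int[OF x] by simp
  qed
  have q: "is_mean \<beta> ?q"
    unfolding is_mean_def
  proof (intro conjI ballI)
    show "prob_space ?q" "sets ?q = sets Y" by (rule m.q_prob m.q_sets)+
    show "W x = density ?q (\<lambda>y. ennreal (ac_dens (W x) ?q y))" if "x \<in> X" for x
      using m.W_density[OF that] by (simp add: m.a_def)
    show "0 < Zq \<beta> ?q x" if "x \<in> X" for x
      using aeZ[OF that, of \<beta>] by (simp add: Zq_def m.a_def)
    have "AE y in ?q. \<forall>x\<in>X. 0 < m.a x y \<longrightarrow> ln (m.a x y) = m.e x"
      by (rule AE_finite_allI[OF finP]) (rule deg)
    with m.v_sum show "AE y in ?q. (\<Sum>x\<in>X. pmf P x * (ac_dens (W x) ?q y powr \<beta> / Zq \<beta> ?q x)) = 1"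
    proof eventually_elim
      case (elim y)
      have "m.a x y powr \<beta> / Zq \<beta> ?q x = m.a x y powr \<alpha> / m.Zx x" if x: "x \<in> X" for x
        using aeZ[OF x, of \<beta>] aeZ[OF x, of \<alpha>] pw[of x y \<beta>] pw[of x y \<alpha>] elim(2) x
        by (simp add: Zq_def m.Zx_eq flip: m.a_def)
      then have "(\<Sum>x\<in>X. pmf P x * (m.a x y powr \<beta> / Zq \<beta> ?q x)) = (\<Sum>x\<in>X. pmf P x * (if x \<in> X then m.a x y powr \<alpha> / m.Zx x else 0))"
        by (intro sum.cong) auto
      then show ?case using elim(1) by (simp add: m.a_def)
    qed
  qed
  interpret m': channel_mean Y W P \<beta> ?q by unfold_locales (use \<beta> q in auto)
  have "tilted_channel Y W P \<beta> x = density ?q (\<lambda>y. ennreal (m'.v x y))"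
    by (simp add: tilted_channel_def m'.augustin_mean_eq m'.tilted_eq[OF x])
  also have "\<dots> = density ?q (\<lambda>y. ennreal (m.a x y))"
  proof (rule density_cong)
    show "AE y in ?q. ennreal (m'.v x y) = ennreal (m.a x y)"
      using deg[OF x]
    proof eventually_elim
      case (elim y)
      have "m'.a x y = m.a x y" by (simp add: m'.a_def m.a_def)
      then have "m'.v x y = m.a x y powr \<beta> / exp ((\<beta> - 1) * m.e x)"
        using aeZ[OF x, of \<beta>] by (simp add: m'.v_eq[OF x] m'.Zx_def Zq_def m.a_def)
      then show ?case using pw[OF elim, of \<beta>] by simp
    qed
    show "(\<lambda>y. ennreal (m'.v x y)) \<in> borel_measurable ?q"
      using tilting.v_meas[OF m'.tilting[OF x m'.\<alpha>0]] by (simp add: m'.v_def)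
    show "(\<lambda>y. ennreal (m.a x y)) \<in> borel_measurable ?q" using m.a_meas by simp
  qed
  also have "\<dots> = W x" using m.W_density[OF x] by simp
  finally show ?thesis .
qed

text \<open>Equality would mean the degenerate case, where the tilted information has the value
  \<open>augustin_info Y W P 1\<close> at every order above 1 and hence in the limit; the gap below
  \<open>Llim\<close> excludes this.\<close>

lemma J_gt:
  assumes nondeg: "((\<lambda>\<beta>. augustin_info Y (tilted_channel Y W P \<beta>) P 1) \<longlongrightarrow> Llim) at_top" "augustin_info Y W P 1 < Llim"
    and \<alpha>': "1 < \<alpha>'" "\<alpha>' \<noteq> \<alpha>"
  shows "J \<alpha> + (\<alpha>' - \<alpha>) * slope \<alpha> < J \<alpha>'"
proof (rule ccontr)
  assume "\<not> ?thesis"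
  then have eq: "J \<alpha>' = J \<alpha> + (\<alpha>' - \<alpha>) * slope \<alpha>" using J_ge[OF \<alpha>'(1)] by simp
  interpret m': channel_mean Y W P \<alpha>' "augustin_mean Y W P \<alpha>'" by (rule channel_mean[OF \<alpha>'(1)])
  have "m'.log_Z = J \<alpha>'" using \<alpha>' by (simp add: J_def m'.augustin_info_eq)
  then have "cond_renyi \<alpha>' W (augustin_mean Y W P \<alpha>') P = ereal ((m.log_Z + (\<alpha>' - \<alpha>) * m.mean_llr) / (\<alpha>' - 1))"
    using m'.cond_renyi_self[OF \<alpha>'(1)] eq by (simp add: m'.log_Z_def m'.Zx_eq J_eq slope_eq)
  then have deg: "AE y in augustin_mean Y W P \<alpha>. 0 < m.a x y \<longrightarrow> ln (m.a x y) = m.e x" if "x \<in> X" for x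
    using that \<alpha>' by (intro m.cond_renyi_eqD(2)[OF \<alpha>'(1) m'.q_in]) auto
  have info: "augustin_info Y (tilted_channel Y W P \<beta>) P 1 = augustin_info Y W P 1" if \<beta>: "1 < \<beta>" for \<beta>
    unfolding augustin_info_def cond_renyi_def
    by (intro INF_cong sum.cong) (auto simp: degenerate_tilted_channel[OF deg \<beta>])
  have "\<forall>\<^sub>F \<beta> in at_top. augustin_info Y (tilted_channel Y W P \<beta>) P 1 = augustin_info Y W P 1"
    by (rule eventually_mono[OF eventually_gt_at_top[of 1]]) (rule info)
  then have L: "((\<lambda>\<beta>. augustin_info Y (tilted_channel Y W P \<beta>) P 1) \<longlongrightarrow> augustin_info Y W P 1) at_top"
    by (rule tendsto_eventually)
  have "Llim = augustin_info Y W P 1"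
    by (rule tendsto_unique[OF _ nondeg(1) L]) simp
  then show False using nondeg(2) by simp
qed

text \<open>The test measure stays the mean of order \<alpha>, so only the exponent moves and the
  uniform Taylor bound applies. The range of h keeps the order above 1 and h within half of
  \<alpha>.\<close>

lemma J_le: "\<exists>C. \<forall>h. \<bar>h\<bar> < min (\<alpha> / 2) (\<alpha> - 1) \<longrightarrow> J (\<alpha> + h) \<le> J \<alpha> + h * slope \<alpha> + C * h\<^sup>2"
proof -
  let ?q = "augustin_mean Y W P \<alpha>"
  define C where "C x = (4 / \<alpha>\<^sup>2 + (m.Kx x)\<^sup>2 * m.Kx x powr (2 * \<alpha>)) / m.Zx x" for x
  have "J (\<alpha> + h) \<le> J \<alpha> + h * slope \<alpha> + (\<Sum>x\<in>X. pmf P x * C x) * h\<^sup>2" if h: "\<bar>h\<bar> < min (\<alpha> / 2) (\<alpha> - 1)" for h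
  proof -
    have ah: "1 < \<alpha> + h" "\<bar>h\<bar> \<le> \<alpha> / 2" using h by auto
    interpret m': channel_mean Y W P "\<alpha> + h" "augustin_mean Y W P (\<alpha> + h)" by (rule channel_mean[OF ah(1)])
    have "augustin_info Y W P (\<alpha> + h) \<le> cond_renyi (\<alpha> + h) W ?q P"
      unfolding augustin_info_def by (rule INF_lower[OF m.q_in])
    then have "ereal (m'.log_Z / (\<alpha> + h - 1)) \<le> ereal ((\<Sum>x\<in>X. pmf P x * ln (\<integral>y. m.a x y powr (\<alpha> + h) \<partial>?q)) / (\<alpha> + h - 1))"
      unfolding m'.augustin_info_eq m.cond_renyi_self[OF ah(1)] .
    then have "m'.log_Z \<le> (\<Sum>x\<in>X. pmf P x * ln (\<integral>y. m.a x y powr (\<alpha> + h) \<partial>?q))"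
      using ah by (simp add: divide_le_cancel)
    also have "\<dots> \<le> (\<Sum>x\<in>X. pmf P x * (ln (m.Zx x) + h * m.e x + C x * h\<^sup>2))"
    proof (intro sum_mono mult_left_mono)
      fix x assume x: "x \<in> X"
      interpret t: tilting ?q "m.a x" "m.Kx x" \<alpha> by (rule m.tilting[OF x m.\<alpha>0])
      define I where "I = (\<integral>y. m.a x y powr (\<alpha> + h) \<partial>?q)"
      have Z: "0 < m.Zx x" by (rule m.Zx_pos[OF x])
      have I: "0 < I" unfolding I_def using ah by (intro m.powr_integral_pos[OF x]) auto
      have "m.e x = (\<integral>y. m.a x y powr \<alpha> * ln (m.a x y) / m.Zx x \<partial>?q)"
        unfolding m.e_def t.E_def t.v_def m.Z_eq[OF x] by simp
      then have e: "(\<integral>y. m.a x y powr \<alpha> * ln (m.a x y) \<partial>?q) = m.Zx x * m.e x" using Z by simp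
      have "I \<le> m.Zx x + h * (m.Zx x * m.e x) + (4 / \<alpha>\<^sup>2 + (m.Kx x)\<^sup>2 * m.Kx x powr (2 * \<alpha>)) * h\<^sup>2"
        using t.integral_powr_taylor_le[OF m.\<alpha>0 ah(2)] unfolding e by (simp add: I_def m.Zx_eq)
      then have "I / m.Zx x \<le> 1 + h * m.e x + C x * h\<^sup>2" using Z by (simp add: C_def field_simps)
      moreover have "ln (I / m.Zx x) \<le> I / m.Zx x - 1" using I Z by (intro ln_le_minus_one) simp
      ultimately have "ln (I / m.Zx x) \<le> h * m.e x + C x * h\<^sup>2" by linarith
      then show "ln (\<integral>y. m.a x y powr (\<alpha> + h) \<partial>?q) \<le> ln (m.Zx x) + h * m.e x + C x * h\<^sup>2"
        using I Z by (simp add: ln_div I_def)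
    qed simp
    also have "\<dots> = m.log_Z + h * m.mean_llr + (\<Sum>x\<in>X. pmf P x * C x) * h\<^sup>2"
      by (simp add: m.log_Z_def m.mean_llr_def distrib_left sum.distrib sum_distrib_left sum_distrib_right mult_ac)
    also have "m'.log_Z = J (\<alpha> + h)" using ah by (simp add: J_def m'.augustin_info_eq)
    finally show ?thesis by (simp add: J_eq slope_eq)
  qed
  then show ?thesis by blast
qed

lemma J_deriv: "(J has_real_derivative slope \<alpha>) (at \<alpha>)"
proof -
  obtain C where C: "\<And>h. \<bar>h\<bar> < min (\<alpha> / 2) (\<alpha> - 1) \<Longrightarrow> J (\<alpha> + h) \<le> J \<alpha> + h * slope \<alpha> + C * h\<^sup>2"
    using J_le by blast
  show ?thesis
  proof (rule DERIV_quadratic_bound)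
    show "0 < min (\<alpha> / 2) (\<alpha> - 1)" using \<alpha> by simp
    fix h :: real assume h: "\<bar>h\<bar> < min (\<alpha> / 2) (\<alpha> - 1)"
    have "J \<alpha> + (\<alpha> + h - \<alpha>) * slope \<alpha> \<le> J (\<alpha> + h)" using h by (intro J_ge) auto
    then show "\<bar>J (\<alpha> + h) - J \<alpha> - h * slope \<alpha>\<bar> \<le> C * h\<^sup>2" using C[OF h] by simp
  qed
qed

end

text \<open>The output distribution is the test measure: its divergence of order 1 is the mutual
  information I1, and expansion at exponent 1 gives \<open>J (1 + h) \<le> h * I1 + C * h^2\<close>,
  which is below \<open>h * R\<close> for small h.\<close>

lemma J_near_1:
  assumes R: "augustin_info Y W P 1 < ereal R"
  shows "\<exists>\<alpha>>1. J \<alpha> < (\<alpha> - 1) * R"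
proof -
  interpret outp: prob_space outp by (rule outp_prob)
  define I1 where "I1 = (\<Sum>x\<in>X. pmf P x * (\<integral>y. wd x y * ln (wd x y) \<partial>outp))"
  have "augustin_info Y W P 1 = ereal I1"
    unfolding I1_def
    by (rule augustin_info_1[OF outp_prob outp_sets]) (use wd_density W_prob wd_sum wd_nonneg in auto)
  then have I1: "I1 < R" using R by simp
  have bd: "bounded_density outp (wd x) K0" if x: "x \<in> X" for x
    by unfold_locales (use wd_nonneg wd_le[OF x] K0_ge_1 in auto)
  define C where "C = 4 + K0\<^sup>2 * K0 powr 2"
  have C: "0 \<le> C" by (simp add: C_def)
  define h where "h = min (1 / 2) ((R - I1) / (C + 1) / 2)"
  have h: "0 < h" "h \<le> 1 / 2" "C * h < R - I1"
  proof -
    show "0 < h" using I1 C by (simp add: h_def)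
    show "h \<le> 1 / 2" unfolding h_def by (rule min.cobounded1)
    have "C * h \<le> (C + 1) * ((R - I1) / (C + 1) / 2)"
      using C I1 by (intro mult_mono) (auto simp: h_def)
    also have "\<dots> = (R - I1) / 2"
    proof -
      have cancel: "d * (z / d / 2) = z / 2" if "d \<noteq> 0" for d z :: real using that by simp
      show ?thesis by (rule cancel) (use C in simp)
    qed
    also have "\<dots> < R - I1" using I1 by simp
    finally show "C * h < R - I1" .
  qed
  define \<alpha> where "\<alpha> = 1 + h"
  have \<alpha>: "1 < \<alpha>" using h by (simp add: \<alpha>_def)
  have one: "\<bar>h\<bar> \<le> 1 / 2" using h by simp
  have int: "(\<integral>y. wd x y powr \<alpha> \<partial>outp) \<le> 1 + h * (\<integral>y. wd x y * ln (wd x y) \<partial>outp) + C * h\<^sup>2" if x: "x \<in> X" for x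
    using bounded_density.integral_powr_taylor_le[OF bd[OF x], of 1 h] one wd_nonneg wd_int(2)[OF x]
    by (simp add: \<alpha>_def C_def)
  have pos: "0 < (\<integral>y. wd x y powr \<alpha> \<partial>outp)" if x: "x \<in> X" for x
  proof -
    interpret bounded_density outp "wd x" K0 by (rule bd[OF x])
    have "(\<integral>y. wd x y powr \<alpha> \<partial>outp) \<noteq> 0"
    proof
      assume "(\<integral>y. wd x y powr \<alpha> \<partial>outp) = 0"
      then have "AE y in outp. wd x y powr \<alpha> = 0"
        using integrable_powr[of \<alpha>] \<alpha> by (subst (asm) integral_nonneg_eq_0_iff_AE) auto
      then have "AE y in outp. wd x y = 0" by eventually_elim simp
      then have "integral\<^sup>L outp (wd x) = 0" by (rule integral_eq_zero_AE)
      then show False using wd_int[OF x] by simp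
    qed
    moreover have "0 \<le> (\<integral>y. wd x y powr \<alpha> \<partial>outp)" by simp
    ultimately show ?thesis by linarith
  qed
  have div: "renyi_div \<alpha> (W x) outp = ereal (ln (\<integral>y. wd x y powr \<alpha> \<partial>outp) / (\<alpha> - 1))" if x: "x \<in> X" for x
  proof -
    have t: "tilting outp (wd x) K0 \<alpha>"
      using bd[OF x] pos[OF x] \<alpha> by (simp add: tilting_def tilting_axioms_def)
    have "renyi_div \<alpha> (W x) outp = renyi_dens \<alpha> outp (wd x) (ac_dens outp outp)"
      by (rule renyi_div_density[OF outp_prob outp_prob W_prob refl wd_meas wd_nonneg wd_density[OF x, symmetric]])
    also have "\<dots> = ereal (ln (tilting.Z outp (wd x) \<alpha>) / (\<alpha> - 1))"
      using \<alpha> ac_dens_self[OF outp_prob] by (intro tilting.renyi_dens_one[OF t]) auto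
    finally show ?thesis by (simp add: tilting.Z_def[OF t])
  qed
  have "augustin_info Y W P \<alpha> \<le> cond_renyi \<alpha> W outp P"
    unfolding augustin_info_def by (rule INF_lower) (simp add: prob_measures_iff outp_prob outp_sets)
  also have "\<dots> = ereal ((\<Sum>x\<in>X. pmf P x * ln (\<integral>y. wd x y powr \<alpha> \<partial>outp)) / (\<alpha> - 1))"
    by (simp add: cond_renyi_def div sum_divide_distrib)
  finally have "J \<alpha> / (\<alpha> - 1) \<le> (\<Sum>x\<in>X. pmf P x * ln (\<integral>y. wd x y powr \<alpha> \<partial>outp)) / (\<alpha> - 1)"
    by (simp add: augustin_info_J[OF \<alpha>])
  then have "J \<alpha> \<le> (\<Sum>x\<in>X. pmf P x * ln (\<integral>y. wd x y powr \<alpha> \<partial>outp))"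
    using \<alpha> by (simp add: divide_le_cancel)
  also have "\<dots> \<le> (\<Sum>x\<in>X. pmf P x * (h * (\<integral>y. wd x y * ln (wd x y) \<partial>outp) + C * h\<^sup>2))"
  proof (intro sum_mono mult_left_mono)
    fix x assume x: "x \<in> X"
    have "ln (\<integral>y. wd x y powr \<alpha> \<partial>outp) \<le> (\<integral>y. wd x y powr \<alpha> \<partial>outp) - 1"
      by (rule ln_le_minus_one[OF pos[OF x]])
    then show "ln (\<integral>y. wd x y powr \<alpha> \<partial>outp) \<le> h * (\<integral>y. wd x y * ln (wd x y) \<partial>outp) + C * h\<^sup>2"
      using int[OF x] by linarith
  qed simp
  also have "\<dots> = h * I1 + C * h\<^sup>2"
  proof -
    have "(\<Sum>x\<in>X. pmf P x * (h * (\<integral>y. wd x y * ln (wd x y) \<partial>outp) + C * h\<^sup>2))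
      = (\<Sum>x\<in>X. h * (pmf P x * (\<integral>y. wd x y * ln (wd x y) \<partial>outp)) + pmf P x * (C * h\<^sup>2))"
      by (intro sum.cong) (auto simp: algebra_simps)
    then show ?thesis by (simp add: sum.distrib I1_def sum_distrib_left[symmetric] sum_distrib_right[symmetric] P_sum)
  qed
  also have "\<dots> = h * (I1 + C * h)" by (simp add: power2_eq_square algebra_simps)
  also have "\<dots> < h * R" using h by (intro mult_strict_left_mono) auto
  finally show ?thesis using \<alpha> by (intro exI[of _ \<alpha>]) (simp add: \<alpha>_def)
qed

lemma ex_optimal_order:
  assumes lower: "augustin_info Y W P 1 < ereal R"
    and lim: "((\<lambda>\<alpha>. augustin_info Y (tilted_channel Y W P \<alpha>) P 1) \<longlongrightarrow> Llim) at_top"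
    and upper: "ereal R < Llim"
  shows "\<exists>\<alpha>s>1. tilted_info \<alpha>s = R \<and> E_sc Y W P R = ((\<alpha>s - 1) * R - J \<alpha>s) / \<alpha>s
    \<and> (E_sc Y W P has_real_derivative ((\<alpha>s - 1) / \<alpha>s)) (at R)"
proof -
  have nd: "augustin_info Y W P 1 < Llim" using lower upper by (rule less_trans)
  note J_gt = J_gt[OF _ lim nd]
  have tilted_info: "tilted_info \<alpha> = \<alpha> * slope \<alpha> - J \<alpha>" if "1 < \<alpha>" for \<alpha> using that by (simp add: slope_def)
  \<comment> \<open>The tilted information is minus the value at 0 of the tangent of
    \<open>J\<close>; strict convexity makes it increase with the point of tangency.\<close>
  have mono: "tilted_info \<alpha> < tilted_info \<beta>" if "1 < \<alpha>" "\<alpha> < \<beta>" for \<alpha> \<beta>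
  proof -
    have 1: "J \<alpha> + (\<beta> - \<alpha>) * slope \<alpha> < J \<beta>" and 2: "J \<beta> + (\<alpha> - \<beta>) * slope \<beta> < J \<alpha>"
      using J_gt[of \<alpha> \<beta>] J_gt[of \<beta> \<alpha>] that by auto
    have "0 < (\<beta> - \<alpha>) * (slope \<beta> - slope \<alpha>)" using 1 2 by (simp add: algebra_simps)
    then have "slope \<alpha> < slope \<beta>" using that by (simp add: zero_less_mult_iff)
    then have "\<alpha> * slope \<alpha> < \<alpha> * slope \<beta>" using that by simp
    moreover have "tilted_info \<alpha> = \<alpha> * slope \<alpha> - J \<alpha>" "tilted_info \<beta> = \<beta> * slope \<beta> - J \<beta>" using that by (auto intro: tilted_info)
    ultimately show ?thesis using 2 unfolding left_diff_distrib by linarith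
  qed
  define \<phi> where "\<phi> r \<alpha> = ((\<alpha> - 1) * r - J \<alpha>) / \<alpha>" for r \<alpha>
  have \<phi>_deriv: "(\<phi> r has_real_derivative ((r - tilted_info \<alpha>) / \<alpha>\<^sup>2)) (at \<alpha>)" if \<alpha>: "1 < \<alpha>" for r \<alpha>
    unfolding \<phi>_def[abs_def] using \<alpha> by (intro exponent_derivative[OF _ J_deriv[OF \<alpha>] tilted_info[OF \<alpha>]]) simp
  obtain \<alpha>2 where \<alpha>2: "1 < \<alpha>2" "R < tilted_info \<alpha>2"
  proof -
    have "\<forall>\<^sub>F \<alpha> in at_top. ereal R < augustin_info Y (tilted_channel Y W P \<alpha>) P 1"
      by (rule order_tendstoD(1)[OF lim upper])
    then have "\<forall>\<^sub>F \<alpha> in at_top. 1 < \<alpha> \<and> ereal R < augustin_info Y (tilted_channel Y W P \<alpha>) P 1"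
      using eventually_gt_at_top[of 1] by eventually_elim simp
    then obtain \<alpha> where "1 < \<alpha>" "ereal R < augustin_info Y (tilted_channel Y W P \<alpha>) P 1"
      by (auto simp: eventually_at_top_linorder)
    then show thesis using that augustin_info_tilted by auto
  qed
  \<comment> \<open>Otherwise \<phi> R would be nonincreasing on all orders above 1 and its value at
    1 + \<epsilon> at least the positive value at \<beta>; but nonnegativity of \<open>J\<close>
    bounds it there by \<open>\<epsilon> * R\<close>.\<close>
  obtain \<alpha>1 where \<alpha>1: "1 < \<alpha>1" "tilted_info \<alpha>1 < R"
  proof (rule ccontr)
    assume no: "\<not> thesis"
    then have ge: "R \<le> tilted_info \<alpha>" if "1 < \<alpha>" for \<alpha> using that \<open>\<And>\<alpha>1. 1 < \<alpha>1 \<Longrightarrow> tilted_info \<alpha>1 < R \<Longrightarrow> thesis\<close> by force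
    obtain \<beta> where \<beta>: "1 < \<beta>" "J \<beta> < (\<beta> - 1) * R" using J_near_1[OF lower] by blast
    have "0 < \<phi> R \<beta>" using \<beta> by (simp add: \<phi>_def)
    have R0: "0 < R"
    proof (rule ccontr)
      assume "\<not> 0 < R"
      then have "(\<beta> - 1) * R \<le> 0" using \<beta> by (intro mult_nonneg_nonpos) auto
      then show False using \<beta>(2) J_nonneg[OF \<beta>(1)] by linarith
    qed
    define \<epsilon> where "\<epsilon> = min (\<beta> - 1) (\<phi> R \<beta> / (2 * R))"
    have \<epsilon>: "0 < \<epsilon>" "1 + \<epsilon> \<le> \<beta>" "\<epsilon> * R < \<phi> R \<beta>"
    proof -
      show "0 < \<epsilon>" "1 + \<epsilon> \<le> \<beta>" using \<beta> \<open>0 < \<phi> R \<beta>\<close> R0 by (auto simp: \<epsilon>_def)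
      have "\<epsilon> * R \<le> \<phi> R \<beta> / (2 * R) * R" using R0 by (intro mult_right_mono) (auto simp: \<epsilon>_def)
      also have "\<dots> < \<phi> R \<beta>" using R0 \<open>0 < \<phi> R \<beta>\<close> by simp
      finally show "\<epsilon> * R < \<phi> R \<beta>" .
    qed
    have "\<phi> R \<beta> \<le> \<phi> R (1 + \<epsilon>)"
    proof (rule DERIV_nonpos_imp_nonincreasing[OF \<epsilon>(2)])
      fix x assume "1 + \<epsilon> \<le> x" "x \<le> \<beta>"
      then show "\<exists>d. (\<phi> R has_real_derivative d) (at x) \<and> d \<le> 0"
        using \<phi>_deriv[of x R] ge[of x] \<epsilon> by (intro exI[of _ "(R - tilted_info x) / x\<^sup>2"]) (auto simp: divide_nonpos_nonneg)
    qed
    also have "\<phi> R (1 + \<epsilon>) \<le> \<epsilon> * R / (1 + \<epsilon>)"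
      unfolding \<phi>_def using J_nonneg[of "1 + \<epsilon>"] \<epsilon> by (intro divide_right_mono) auto
    also have "\<dots> \<le> \<epsilon> * R" using \<epsilon> R0 by (simp add: field_simps)
    finally show False using \<epsilon>(3) by linarith
  qed
  have 12: "\<alpha>1 < \<alpha>2"
  proof (rule ccontr)
    assume "\<not> \<alpha>1 < \<alpha>2"
    then have "tilted_info \<alpha>2 \<le> tilted_info \<alpha>1" using mono[of \<alpha>2 \<alpha>1] \<alpha>2(1) by (cases "\<alpha>1 = \<alpha>2") auto
    then show False using \<alpha>1 \<alpha>2 by linarith
  qed
  \<comment> \<open>Darboux argument: the derivative of \<phi> R has the sign of
    \<open>R - tilted_info\<close>, positive at \<alpha>1 and negative at \<alpha>2, so the maximum
    on the interval is interior and the derivative vanishes there.\<close>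
  have "\<exists>\<alpha>s>1. tilted_info \<alpha>s = R"
  proof -
    have cont: "continuous_on {\<alpha>1..\<alpha>2} (\<phi> R)"
      using \<phi>_deriv \<alpha>1(1) by (intro DERIV_continuous_on[of _ _ "\<lambda>\<alpha>. (R - tilted_info \<alpha>) / \<alpha>\<^sup>2"]) (auto intro: has_field_derivative_at_within)
    have ne: "{\<alpha>1..\<alpha>2} \<noteq> {}" using 12 by simp
    obtain m where m: "m \<in> {\<alpha>1..\<alpha>2}" "\<And>x. x \<in> {\<alpha>1..\<alpha>2} \<Longrightarrow> \<phi> R x \<le> \<phi> R m"
      using continuous_attains_sup[OF compact_Icc ne cont] by blast
    have m1: "1 < m" using m \<alpha>1 by auto
    have "m \<noteq> \<alpha>1"
    proof
      assume eq: "m = \<alpha>1"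
      have "0 < (R - tilted_info \<alpha>1) / \<alpha>1\<^sup>2" using \<alpha>1 by simp
      from DERIV_pos_inc_right[OF \<phi>_deriv[OF \<alpha>1(1)] this]
      obtain d where d: "0 < d" "\<And>h. 0 < h \<Longrightarrow> h < d \<Longrightarrow> \<phi> R \<alpha>1 < \<phi> R (\<alpha>1 + h)" by blast
      define h where "h = min (d / 2) (\<alpha>2 - \<alpha>1)"
      have "\<phi> R \<alpha>1 < \<phi> R (\<alpha>1 + h)" using d 12 by (intro d(2)) (auto simp: h_def)
      moreover have "\<alpha>1 + h \<in> {\<alpha>1..\<alpha>2}" using d 12 by (auto simp: h_def)
      ultimately show False using m(2)[of "\<alpha>1 + h"] eq by simp
    qed
    moreover have "m \<noteq> \<alpha>2"
    proof
      assume eq: "m = \<alpha>2"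
      have "(R - tilted_info \<alpha>2) / \<alpha>2\<^sup>2 < 0" using \<alpha>2 by (simp add: divide_neg_pos)
      from DERIV_neg_dec_left[OF \<phi>_deriv[OF \<alpha>2(1)] this]
      obtain d where d: "0 < d" "\<And>h. 0 < h \<Longrightarrow> h < d \<Longrightarrow> \<phi> R \<alpha>2 < \<phi> R (\<alpha>2 - h)" by blast
      define h where "h = min (d / 2) (\<alpha>2 - \<alpha>1)"
      have "\<phi> R \<alpha>2 < \<phi> R (\<alpha>2 - h)" using d 12 by (intro d(2)) (auto simp: h_def)
      moreover have "\<alpha>2 - h \<in> {\<alpha>1..\<alpha>2}" using d 12 by (auto simp: h_def)
      ultimately show False using m(2)[of "\<alpha>2 - h"] eq by simp
    qed
    ultimately have in12: "\<alpha>1 < m" "m < \<alpha>2" using m by auto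
    have "(R - tilted_info m) / m\<^sup>2 = 0"
    proof (rule DERIV_local_max[OF \<phi>_deriv[OF m1]])
      show "0 < min (m - \<alpha>1) (\<alpha>2 - m)" using in12 by simp
      show "\<forall>y. \<bar>m - y\<bar> < min (m - \<alpha>1) (\<alpha>2 - m) \<longrightarrow> \<phi> R y \<le> \<phi> R m"
        by (auto intro!: m(2))
    qed
    then show ?thesis using m1 by auto
  qed
  then obtain \<alpha>s where \<alpha>s: "1 < \<alpha>s" "tilted_info \<alpha>s = R" by blast
  have Es: "E_sc Y W P r = (SUP \<alpha>\<in>{1<..}. \<phi> r \<alpha>)" for r
    unfolding E_sc_def
  proof (rule SUP_cong[OF refl])
    fix \<alpha> :: real assume "\<alpha> \<in> {1<..}"
    then have \<alpha>: "1 < \<alpha>" by simp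
    define t where "t = J \<alpha> / (\<alpha> - 1)"
    have "(1 - \<alpha>) / \<alpha> * (t - r) = ((\<alpha> - 1) * r - (\<alpha> - 1) * t) / \<alpha>"
      by (simp add: algebra_simps)
    also have "(\<alpha> - 1) * t = J \<alpha>" using \<alpha> by (simp add: t_def)
    finally have "(1 - \<alpha>) / \<alpha> * (J \<alpha> / (\<alpha> - 1) - r) = \<phi> r \<alpha>" by (simp add: t_def \<phi>_def)
    then show "(1 - \<alpha>) / \<alpha> * (real_of_ereal (augustin_info Y W P \<alpha>) - r) = \<phi> r \<alpha>"
      by (simp add: augustin_info_J[OF \<alpha>])
  qed
  note env = envelope_derivative[of J slope tilted_info \<phi> "E_sc Y W P" \<alpha>s R, OF J_deriv tilted_info mono \<phi>_def Es \<alpha>s]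
  show ?thesis
    using \<alpha>s env by (intro exI[of _ \<alpha>s]) (simp add: \<phi>_def)
qed

end

section \<open>List codes\<close>

text \<open>Both measures are compared on rectangles, where the integral factorises. One-point
  spaces fill the indices outside I for the product locale.\<close>

lemma PiM_density:
  fixes f :: "'i \<Rightarrow> 'b \<Rightarrow> real"
  assumes fin: "finite I" and N: "\<And>i. i \<in> I \<Longrightarrow> prob_space (N i)"
    and f: "\<And>i. i \<in> I \<Longrightarrow> f i \<in> borel_measurable (N i)" and nonneg: "\<And>i y. i \<in> I \<Longrightarrow> 0 \<le> f i y"
    and D: "\<And>i. i \<in> I \<Longrightarrow> prob_space (density (N i) (\<lambda>y. ennreal (f i y)))"
  shows "Pi\<^sub>M I (\<lambda>i. density (N i) (\<lambda>y. ennreal (f i y))) = density (Pi\<^sub>M I N) (\<lambda>y. ennreal (\<Prod>i\<in>I. f i (y i)))"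
proof -
  define N' where "N' i = (if i \<in> I then N i else count_space {undefined})" for i
  define D' where "D' i = (if i \<in> I then density (N i) (\<lambda>y. ennreal (f i y)) else count_space {undefined})" for i
  have pN: "prob_space (N' i)" and pD: "prob_space (D' i)" for i
    using N D by (auto simp: N'_def D'_def intro!: prob_spaceI)
  interpret N: product_prob_space N' I using pN by (intro product_prob_spaceI)
  interpret D: product_prob_space D' I using pD by (intro product_prob_spaceI)
  have eqN: "Pi\<^sub>M I N = Pi\<^sub>M I N'" by (rule PiM_cong) (auto simp: N'_def)
  have eqD: "Pi\<^sub>M I (\<lambda>i. density (N i) (\<lambda>y. ennreal (f i y))) = Pi\<^sub>M I D'" by (rule PiM_cong) (auto simp: D'_def)
  have sND: "sets (N' i) = sets (D' i)" for i by (simp add: N'_def D'_def)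
  have fm: "f i \<in> borel_measurable (N' i)" if "i \<in> I" for i using f[OF that] that by (simp add: N'_def)
  have Fm [measurable]: "(\<lambda>y. ennreal (\<Prod>i\<in>I. f i (y i))) \<in> borel_measurable (Pi\<^sub>M I N')"
  proof -
    have "(\<lambda>y. f i (y i)) \<in> borel_measurable (Pi\<^sub>M I N')" if "i \<in> I" for i
      by (rule measurable_compose[OF measurable_component_singleton[where M = N', OF that] fm[OF that]])
    then have "(\<lambda>y. \<Prod>i\<in>I. f i (y i)) \<in> borel_measurable (Pi\<^sub>M I N')" by (intro borel_measurable_prod) auto
    then show ?thesis by measurable
  qed
  have "density (Pi\<^sub>M I N') (\<lambda>y. ennreal (\<Prod>i\<in>I. f i (y i))) = Pi\<^sub>M I D'"
  proof (rule D.PiM_eqI[OF fin])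
    show "sets (density (Pi\<^sub>M I N') (\<lambda>y. ennreal (\<Prod>i\<in>I. f i (y i)))) = sets (Pi\<^sub>M I D')"
      by (simp add: sets_PiM_cong[OF refl sND])
    fix A assume A: "\<And>i. i \<in> I \<Longrightarrow> A i \<in> sets (D' i)"
    have A': "A i \<in> sets (N' i)" if "i \<in> I" for i using A[OF that] sND by simp
    have AP: "Pi\<^sub>E I A \<in> sets (Pi\<^sub>M I N')" using A' fin by (intro sets_PiM_I_finite) auto
    have "emeasure (density (Pi\<^sub>M I N') (\<lambda>y. ennreal (\<Prod>i\<in>I. f i (y i)))) (Pi\<^sub>E I A)
        = (\<integral>\<^sup>+y. ennreal (\<Prod>i\<in>I. f i (y i)) * indicator (Pi\<^sub>E I A) y \<partial>Pi\<^sub>M I N')"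
      using AP by (subst emeasure_density) auto
    also have "\<dots> = (\<integral>\<^sup>+y. (\<Prod>i\<in>I. ennreal (f i (y i)) * indicator (A i) (y i)) \<partial>Pi\<^sub>M I N')"
    proof (rule nn_integral_cong)
      fix y assume y: "y \<in> space (Pi\<^sub>M I N')"
      have "indicator (Pi\<^sub>E I A) y = (\<Prod>i\<in>I. indicator (A i) (y i) :: ennreal)"
        using y fin by (auto simp: space_PiM PiE_iff indicator_def prod_zero_iff)
      then show "ennreal (\<Prod>i\<in>I. f i (y i)) * indicator (Pi\<^sub>E I A) y = (\<Prod>i\<in>I. ennreal (f i (y i)) * indicator (A i) (y i))"
        using nonneg by (simp add: prod.distrib prod_ennreal)
    qed
    also have "\<dots> = (\<Prod>i\<in>I. \<integral>\<^sup>+y. ennreal (f i y) * indicator (A i) y \<partial>N' i)"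
    proof (rule N.product_nn_integral_prod[OF fin])
      fix i assume "i \<in> I"
      note [measurable] = fm[OF this] A'[OF this]
      show "(\<lambda>y. ennreal (f i y) * indicator (A i) y) \<in> borel_measurable (N' i)" by measurable
    qed
    also have "\<dots> = (\<Prod>i\<in>I. emeasure (D' i) (A i))"
    proof (rule prod.cong[OF refl])
      fix i assume i: "i \<in> I"
      then show "(\<integral>\<^sup>+y. ennreal (f i y) * indicator (A i) y \<partial>N' i) = emeasure (D' i) (A i)"
        using A'[OF i] f[OF i] by (simp add: D'_def N'_def emeasure_density)
    qed
    finally show "emeasure (density (Pi\<^sub>M I N') (\<lambda>y. ennreal (\<Prod>i\<in>I. f i (y i)))) (Pi\<^sub>E I A) = (\<Prod>i\<in>I. emeasure (D' i) (A i))" .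
  qed
  then show ?thesis using eqN eqD by simp
qed

lemma composition_in_support:
  assumes "has_composition n P x" "t < n"
  shows "x t \<in> set_pmf P"
proof -
  have "t \<in> {s \<in> {..<n}. x s = x t}" using assms by simp
  then have "0 < card {s \<in> {..<n}. x s = x t}" by (auto simp: card_gt_0_iff)
  then have "0 < real n * pmf P (x t)" using assms(1) unfolding has_composition_def by (metis of_nat_0_less_iff)
  then show ?thesis by (auto simp: set_pmf_iff)
qed

text \<open>Positions are grouped by letter. All codewords of composition P thus share the same
  normaliser and the same moments.\<close>

lemma sum_composition:
  fixes h :: "'a \<Rightarrow> real"
  assumes c: "has_composition n P x" and fin: "finite (set_pmf P)"
  shows "(\<Sum>t<n. h (x t)) = real n * (\<Sum>z\<in>set_pmf P. pmf P z * h z)"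
proof -
  have "(\<Sum>t<n. h (x t)) = (\<Sum>z\<in>set_pmf P. \<Sum>t\<in>{t \<in> {..<n}. x t = z}. h (x t))"
    using composition_in_support[OF c] fin by (intro sum.group[symmetric]) auto
  also have "\<dots> = (\<Sum>z\<in>set_pmf P. real (card {t \<in> {..<n}. x t = z}) * h z)"
    by (intro sum.cong) auto
  also have "\<dots> = real n * (\<Sum>z\<in>set_pmf P. pmf P z * h z)"
    using c by (simp add: has_composition_def sum_distrib_left mult.assoc)
  finally show ?thesis .
qed

section \<open>Codes of constant composition\<close>

context channel_mean
begin

definition "Vx x = density q (\<lambda>y. ennreal (v x y))"
definition "mx x = (\<integral>y. ln (a x y) \<partial>Vx x)"
definition "var x = (\<integral>y. (ln (a x y) - mx x)\<^sup>2 \<partial>Vx x)"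
definition "third x = (\<integral>y. \<bar>ln (a x y) - mx x\<bar> ^ 3 \<partial>Vx x)"
definition "A2 = (\<Sum>x\<in>X. pmf P x * var x)"
definition "A3 = (\<Sum>x\<in>X. pmf P x * third x)"

lemma v_meas: "x \<in> X \<Longrightarrow> v x \<in> borel_measurable q"
  unfolding v_def by (rule tilting.v_meas[OF tilting[OF _ \<alpha>0]])

lemma v_nonneg: "x \<in> X \<Longrightarrow> 0 \<le> v x y"
  unfolding v_def by (rule tilting.v_nonneg[OF tilting[OF _ \<alpha>0]])

lemma ln_a_meas: "(\<lambda>y. ln (a x y)) \<in> borel_measurable (Vx x)"
  using a_meas[of x] by (simp add: Vx_def)

lemma abs_moment_eq: "abs_moment Y W P \<alpha> k = (\<Sum>x\<in>X. ennreal (pmf P x) * (\<integral>\<^sup>+y. ennreal (\<bar>ln (a x y) - mx x\<bar> ^ k) \<partial>Vx x))"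
  unfolding abs_moment_def
  by (intro sum.cong) (auto simp: tilted_channel_def augustin_mean_eq tilted_eq llr_def[abs_def] a_def mx_def Vx_def)

lemma third_integrable:
  assumes fin: "abs_moment Y W P \<alpha> 3 < \<infinity>" and x: "x \<in> X"
  shows "integrable (Vx x) (\<lambda>y. \<bar>ln (a x y) - mx x\<bar> ^ 3)"
proof -
  have [measurable]: "(\<lambda>y. ln (a x y)) \<in> borel_measurable (Vx x)" by (rule ln_a_meas)
  have "ennreal (pmf P x) * (\<integral>\<^sup>+y. ennreal (\<bar>ln (a x y) - mx x\<bar> ^ 3) \<partial>Vx x) \<le> abs_moment Y W P \<alpha> 3"
    unfolding abs_moment_eq using finP x by (intro member_le_sum) auto
  then have "ennreal (pmf P x) * (\<integral>\<^sup>+y. ennreal (\<bar>ln (a x y) - mx x\<bar> ^ 3) \<partial>Vx x) < \<infinity>"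
    using fin by (rule le_less_trans)
  then have "(\<integral>\<^sup>+y. ennreal (\<bar>ln (a x y) - mx x\<bar> ^ 3) \<partial>Vx x) < \<infinity>"
    using P_pos[OF x] by (auto simp: ennreal_mult_less_top)
  then show ?thesis by (intro integrableI_nonneg) auto
qed

lemma Vx_prob: "x \<in> X \<Longrightarrow> prob_space (Vx x)" unfolding Vx_def by (rule v_prob)

text \<open>A finite third moment makes the second finite, so both extended moments of the statement
  become the real ones that the tail bound uses.\<close>

lemma abs_moments:
  assumes fin: "abs_moment Y W P \<alpha> 3 < \<infinity>"
  shows "abs_moment Y W P \<alpha> 2 = ennreal A2" "abs_moment Y W P \<alpha> 3 = ennreal A3"
proof -
  have sq: "integrable (Vx x) (\<lambda>y. (ln (a x y) - mx x)\<^sup>2)" if x: "x \<in> X" for x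
    using prob_space.integrable_moments_le3(2)[OF Vx_prob[OF x] _ third_integrable[OF fin x]] ln_a_meas by simp
  have "abs_moment Y W P \<alpha> 2 = (\<Sum>x\<in>X. ennreal (pmf P x * var x))"
    unfolding abs_moment_eq var_def
    using sq by (intro sum.cong) (auto simp: nn_integral_eq_integral ennreal_mult)
  also have "\<dots> = ennreal A2" unfolding A2_def by (rule sum_ennreal) (auto simp: var_def)
  finally show "abs_moment Y W P \<alpha> 2 = ennreal A2" .
  have "abs_moment Y W P \<alpha> 3 = (\<Sum>x\<in>X. ennreal (pmf P x * third x))"
    unfolding abs_moment_eq third_def
    using third_integrable[OF fin] by (intro sum.cong) (auto simp: nn_integral_eq_integral ennreal_mult)
  also have "\<dots> = ennreal A3" unfolding A3_def by (rule sum_ennreal) (auto simp: third_def)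
  finally show "abs_moment Y W P \<alpha> 3 = ennreal A3" .
qed

lemma A_nonneg: "0 \<le> A2" "0 \<le> A3"
  unfolding A2_def A3_def by (auto intro!: sum_nonneg simp: var_def third_def)

definition "qn n = Pi\<^sub>M {..<n} (\<lambda>_::nat. q)"

context
  fixes n :: nat and x :: "nat \<Rightarrow> 'b"
  assumes n: "0 < n" and comp: "has_composition n P x" and fin3: "abs_moment Y W P \<alpha> 3 < \<infinity>" and A2pos: "0 < A2"
begin

private lemma xX: "t < n \<Longrightarrow> x t \<in> X" by (rule composition_in_support[OF comp])

private lemma channel_density: "prod_channel W n x = density (qn n) (\<lambda>y. ennreal (\<Prod>t<n. a (x t) (y t)))"
proof -
  have "prod_channel W n x = Pi\<^sub>M {..<n} (\<lambda>t. density q (\<lambda>y. ennreal (a (x t) y)))"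
    unfolding prod_channel_def using W_density[OF xX] by (intro PiM_cong) auto
  also have "\<dots> = density (qn n) (\<lambda>y. ennreal (\<Prod>t<n. a (x t) (y t)))"
    unfolding qn_def
  proof (rule PiM_density)
    show "prob_space (density q (\<lambda>y. ennreal (a (x t) y)))" if "t \<in> {..<n}" for t
      using W_prob[of "x t"] W_density[OF xX[of t]] that by simp
  qed (use a_meas a_nonneg q_prob in auto)
  finally show ?thesis .
qed

private lemma tilted_density: "Pi\<^sub>M {..<n} (\<lambda>t. Vx (x t)) = density (qn n) (\<lambda>y. ennreal (\<Prod>t<n. v (x t) (y t)))"
  unfolding qn_def Vx_def
  using v_prob[OF xX] v_meas[OF xX] v_nonneg[OF xX] q_prob by (intro PiM_density) auto

private definition "LL y = (\<Sum>t<n. ln (a (x t) (y t)))"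

private lemma component_meas:
  assumes "f \<in> borel_measurable q" "t < n"
  shows "(\<lambda>y. f (y t)) \<in> borel_measurable (qn n)"
  unfolding qn_def using assms by (intro measurable_compose[OF measurable_component_singleton]) auto

private lemma LL_meas [measurable]: "LL \<in> borel_measurable (qn n)"
  unfolding LL_def using a_meas by (intro borel_measurable_sum component_meas) auto

private lemma prod_a_meas [measurable]: "(\<lambda>y. \<Prod>t<n. a (x t) (y t)) \<in> borel_measurable (qn n)"
  using a_meas by (intro borel_measurable_prod component_meas) auto

private lemma prod_v_meas [measurable]: "(\<lambda>y. \<Prod>t<n. v (x t) (y t)) \<in> borel_measurable (qn n)"
  using v_meas[OF xX] by (intro borel_measurable_prod component_meas) auto

text \<open>Where \<open>LL\<close> exceeds \<tau>, the likelihood \<open>exp (LL y)\<close> is the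
  product of the tilted densities times \<open>exp (real n * log_Z - (\<alpha> - 1) * LL y)\<close>.
  If some factor a vanishes, the left side is 0 and the value of \<open>ln 0\<close> inside
  \<open>LL\<close> does no harm.\<close>

private lemma likelihood_split:
  "ennreal (\<Prod>t<n. a (x t) (y t))
    \<le> ennreal (exp \<tau>) + ennreal (exp (real n * log_Z - (\<alpha> - 1) * \<tau>)) *
      (ennreal (\<Prod>t<n. v (x t) (y t)) * ennreal (exp (- (\<alpha> - 1) * (LL y - \<tau>)) * indicator {\<tau><..} (LL y)))"
proof (cases "\<forall>t<n. 0 < a (x t) (y t)")
  case False
  then obtain t where t: "t < n" "a (x t) (y t) = 0" using a_nonneg by (metis less_le)
  then have z: "(\<Prod>t<n. a (x t) (y t)) = 0" by (intro prod_zero) auto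
  show ?thesis unfolding z by simp
next
  case True
  have pa: "(\<Prod>t<n. a (x t) (y t)) = exp (LL y)"
    unfolding LL_def using True by (simp add: exp_sum)
  show ?thesis
  proof (cases "LL y \<le> \<tau>")
    case True
    then have "ennreal (\<Prod>t<n. a (x t) (y t)) \<le> ennreal (exp \<tau>)" unfolding pa by (intro ennreal_leI) simp
    then show ?thesis by (rule order_trans) simp
  next
    case False
    have "(\<Prod>t<n. v (x t) (y t)) = (\<Prod>t<n. exp (\<alpha> * ln (a (x t) (y t)) - ln (Zx (x t))))"
    proof (rule prod.cong[OF refl])
      fix t assume "t \<in> {..<n}"
      then show "v (x t) (y t) = exp (\<alpha> * ln (a (x t) (y t)) - ln (Zx (x t)))"
        using \<open>\<forall>t<n. 0 < a (x t) (y t)\<close>[rule_format, of t] xX[of t] Zx_pos[of "x t"]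
        by (simp add: v_eq powr_def exp_diff)
    qed
    also have "\<dots> = exp (\<alpha> * LL y - (\<Sum>t<n. ln (Zx (x t))))"
      by (simp add: exp_sum[symmetric] LL_def sum_subtractf sum_distrib_left)
    also have "(\<Sum>t<n. ln (Zx (x t))) = real n * log_Z"
      unfolding log_Z_def by (rule sum_composition[OF comp finP])
    finally have pv: "(\<Prod>t<n. v (x t) (y t)) = exp (\<alpha> * LL y - real n * log_Z)" .
    have "exp (LL y) = exp (real n * log_Z - (\<alpha> - 1) * \<tau>) * (exp (\<alpha> * LL y - real n * log_Z) * exp (- (\<alpha> - 1) * (LL y - \<tau>)))"
      unfolding mult_exp_exp by (rule arg_cong[of _ _ exp]) (simp add: algebra_simps)
    then have "ennreal (\<Prod>t<n. a (x t) (y t)) = ennreal (exp (real n * log_Z - (\<alpha> - 1) * \<tau>)) *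
        (ennreal (\<Prod>t<n. v (x t) (y t)) * ennreal (exp (- (\<alpha> - 1) * (LL y - \<tau>)) * indicator {\<tau><..} (LL y)))"
      unfolding pa pv using False by (simp add: ennreal_mult[symmetric])
    then show ?thesis by (metis add.commute le_iff_add)
  qed
qed

text \<open>The term with \<open>exp \<tau>\<close> keeps the restriction to A, so that summing over
  messages can exploit the list size. The other term drops it and is an exponential tail under the
  product of the tilted outputs.\<close>

lemma success_prob_le:
  assumes A: "A \<in> sets (qn n)"
  shows "measure (prod_channel W n x) A
    \<le> exp \<tau> * measure (qn n) A + exp (real n * log_Z - (\<alpha> - 1) * \<tau>) * (tail_const (\<alpha> - 1) (A3 / A2) / sqrt (real n * A2))"
proof -
  define T where "T = tail_const (\<alpha> - 1) (A3 / A2) / sqrt (real n * A2)"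
  define \<mu> where "\<mu> = \<alpha> - 1"
  interpret qn: prob_space "qn n" unfolding qn_def by (intro prob_space_PiM q_prob)
  have pc: "prob_space (prod_channel W n x)" unfolding prod_channel_def by (intro prob_space_PiM W_prob)
  interpret pc: prob_space "prod_channel W n x" by (rule pc)
  have T0: "0 \<le> T"
    unfolding T_def tail_const_def using \<alpha> A_nonneg A2pos n by (intro divide_nonneg_nonneg mult_nonneg_nonneg add_nonneg_nonneg) auto
  have tail: "(\<integral>\<^sup>+y. ennreal (exp (- \<mu> * (LL y - \<tau>)) * indicator {\<tau><..} (LL y)) \<partial>Pi\<^sub>M {..<n} (\<lambda>t. Vx (x t))) \<le> ennreal T"
  proof -
    have "(\<integral>\<^sup>+y. ennreal (exp (- \<mu> * ((\<Sum>t<n. ln (a (x t) (y t))) - \<tau>)) * indicator {\<tau><..} (\<Sum>t<n. ln (a (x t) (y t)))) \<partial>Pi\<^sub>M {..<n} (\<lambda>t. Vx (x t)))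
      \<le> ennreal (tail_const \<mu> ((real n * A3) / (real n * A2)) / sqrt (real n * A2))"
    proof (rule exp_tail_sum_le_tail_const[where m = "\<lambda>t. mx (x t)"])
      show "real n * A2 = (\<Sum>t<n. \<integral>y. (ln (a (x t) y) - mx (x t))\<^sup>2 \<partial>Vx (x t))"
        using sum_composition[OF comp finP, of var] by (simp add: A2_def var_def)
      show "real n * A3 = (\<Sum>t<n. \<integral>y. \<bar>ln (a (x t) y) - mx (x t)\<bar> ^ 3 \<partial>Vx (x t))"
        using sum_composition[OF comp finP, of third] by (simp add: A3_def third_def)
      show "integrable (Vx (x t)) (\<lambda>y. \<bar>ln (a (x t) y) - mx (x t)\<bar> ^ 3)" if "t \<in> {..<n}" for t
        using third_integrable[OF fin3 xX] that by simp
      show "0 < real n * A2" using n A2pos by simp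
    qed (use \<alpha> Vx_prob[OF xX] ln_a_meas in \<open>auto simp: mx_def \<mu>_def\<close>)
    then show ?thesis using n by (simp add: LL_def T_def \<mu>_def)
  qed
  have "ennreal (measure (prod_channel W n x) A) = emeasure (prod_channel W n x) A"
    by (simp add: pc.emeasure_eq_measure)
  also have "\<dots> = (\<integral>\<^sup>+y. ennreal (\<Prod>t<n. a (x t) (y t)) * indicator A y \<partial>qn n)"
    unfolding channel_density using A by (subst emeasure_density) auto
  also have "\<dots> \<le> (\<integral>\<^sup>+y. ennreal (exp \<tau>) * indicator A y + ennreal (exp (real n * log_Z - \<mu> * \<tau>)) *
      (ennreal (\<Prod>t<n. v (x t) (y t)) * ennreal (exp (- \<mu> * (LL y - \<tau>)) * indicator {\<tau><..} (LL y))) \<partial>qn n)"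
  proof (rule nn_integral_mono)
    fix y
    show "ennreal (\<Prod>t<n. a (x t) (y t)) * indicator A y \<le> ennreal (exp \<tau>) * indicator A y + ennreal (exp (real n * log_Z - \<mu> * \<tau>)) *
        (ennreal (\<Prod>t<n. v (x t) (y t)) * ennreal (exp (- \<mu> * (LL y - \<tau>)) * indicator {\<tau><..} (LL y)))"
      using likelihood_split[of y \<tau>] by (auto simp: \<mu>_def split: split_indicator)
  qed
  also have "\<dots> = ennreal (exp \<tau>) * emeasure (qn n) A + ennreal (exp (real n * log_Z - \<mu> * \<tau>)) *
      (\<integral>\<^sup>+y. ennreal (\<Prod>t<n. v (x t) (y t)) * ennreal (exp (- \<mu> * (LL y - \<tau>)) * indicator {\<tau><..} (LL y)) \<partial>qn n)"
    using A by (subst nn_integral_add) (auto simp: nn_integral_cmult nn_integral_cmult_indicator)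
  also have "(\<integral>\<^sup>+y. ennreal (\<Prod>t<n. v (x t) (y t)) * ennreal (exp (- \<mu> * (LL y - \<tau>)) * indicator {\<tau><..} (LL y)) \<partial>qn n)
      = (\<integral>\<^sup>+y. ennreal (exp (- \<mu> * (LL y - \<tau>)) * indicator {\<tau><..} (LL y)) \<partial>Pi\<^sub>M {..<n} (\<lambda>t. Vx (x t)))"
    unfolding tilted_density by (subst nn_integral_density) auto
  also have "ennreal (exp \<tau>) * emeasure (qn n) A + ennreal (exp (real n * log_Z - \<mu> * \<tau>)) * \<dots>
      \<le> ennreal (exp \<tau>) * emeasure (qn n) A + ennreal (exp (real n * log_Z - \<mu> * \<tau>)) * ennreal T"
    using tail by (intro add_left_mono mult_left_mono) auto
  also have "\<dots> = ennreal (exp \<tau> * measure (qn n) A + exp (real n * log_Z - \<mu> * \<tau>) * T)"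
    using T0 by (simp add: qn.emeasure_eq_measure ennreal_mult)
  finally have "measure (prod_channel W n x) A \<le> exp \<tau> * measure (qn n) A + exp (real n * log_Z - \<mu> * \<tau>) * T"
    using T0 by (subst (asm) ennreal_le_iff) auto
  then show ?thesis by (simp add: T_def \<mu>_def)
qed

end

text \<open>Each output point lies in at most L of the decoding sets, and \<open>qn\<close> is the
  same for all messages, so the \<open>qn\<close> measures sum to at most L. The threshold \<tau> is
  left free.\<close>

lemma list_code_error_ge:
  fixes n M L :: nat
  assumes pos: "0 < n" "0 < M" "0 < L"
    and code: "is_list_code Y n M L \<Psi> \<Theta>" and comp: "\<And>m. m \<in> {1..M} \<Longrightarrow> has_composition n P (\<Psi> m)"
    and fin3: "abs_moment Y W P \<alpha> 3 < \<infinity>" and A2pos: "0 < A2"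
  defines "R \<equiv> ln (real M / real L) / real n"
  shows "1 - (exp (\<tau> - real n * R) + exp (real n * log_Z - (\<alpha> - 1) * \<tau>) * (tail_const (\<alpha> - 1) (A3 / A2) / sqrt (real n * A2)))
    \<le> error_prob W n M \<Psi> \<Theta>"
proof -
  define T where "T = exp (real n * log_Z - (\<alpha> - 1) * \<tau>) * (tail_const (\<alpha> - 1) (A3 / A2) / sqrt (real n * A2))"
  interpret qn: prob_space "qn n" unfolding qn_def by (intro prob_space_PiM q_prob)
  have sq: "sets (qn n) = sets (Pi\<^sub>M {..<n} (\<lambda>_. Y))" unfolding qn_def by (intro sets_PiM_cong) (auto simp: q_sets)
  have sp: "space (qn n) = space (Pi\<^sub>M {..<n} (\<lambda>_. Y))" by (rule sets_eq_imp_space_eq[OF sq])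
  have spc: "sets (prod_channel W n x) = sets (Pi\<^sub>M {..<n} (\<lambda>_. Y))" for x
    unfolding prod_channel_def by (intro sets_PiM_cong) (auto simp: W_sets)
  have spc': "space (prod_channel W n x) = space (Pi\<^sub>M {..<n} (\<lambda>_. Y))" for x
    by (rule sets_eq_imp_space_eq[OF spc])
  define A where "A m = {y \<in> space (Pi\<^sub>M {..<n} (\<lambda>_. Y)). m \<in> \<Theta> y}" for m
  have A: "A m \<in> sets (qn n)" if "m \<in> {1..M}" for m
    using code that unfolding is_list_code_def A_def sq by blast
  have err: "measure (prod_channel W n (\<Psi> m)) {y \<in> space (prod_channel W n (\<Psi> m)). m \<notin> \<Theta> y} = 1 - measure (prod_channel W n (\<Psi> m)) (A m)"
    if m: "m \<in> {1..M}" for m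
  proof -
    interpret pc: prob_space "prod_channel W n (\<Psi> m)" unfolding prod_channel_def by (intro prob_space_PiM W_prob)
    have "{y \<in> space (prod_channel W n (\<Psi> m)). m \<notin> \<Theta> y} = space (prod_channel W n (\<Psi> m)) - A m"
      by (auto simp: A_def spc')
    then show ?thesis using A[OF m] by (simp add: pc.prob_compl spc sq)
  qed
  have "(\<Sum>m=1..M. measure (qn n) (A m)) = (\<integral>y. (\<Sum>m=1..M. indicator (A m) y) \<partial>qn n)"
    using A by (subst Bochner_Integration.integral_sum) (auto intro!: integrable_real_indicator simp: qn.emeasure_eq_measure)
  also have "\<dots> \<le> (\<integral>y. real L \<partial>qn n)"
  proof (rule integral_mono)
    show "integrable (qn n) (\<lambda>y. \<Sum>m=1..M. indicator (A m) y :: real)"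
      using A by (intro Bochner_Integration.integrable_sum integrable_real_indicator) (auto simp: qn.emeasure_eq_measure)
    fix y assume "y \<in> space (qn n)"
    then have y: "y \<in> space (Pi\<^sub>M {..<n} (\<lambda>_. Y))" by (simp add: sp)
    then have th: "\<Theta> y \<subseteq> {1..M}" "card (\<Theta> y) \<le> L" using code unfolding is_list_code_def by auto
    have "(\<Sum>m=1..M. indicator (A m) y :: real) = (\<Sum>m=1..M. indicator (\<Theta> y) m)"
      using y by (intro sum.cong) (auto simp: A_def indicator_def)
    also have "\<dots> = real (card (\<Theta> y))"
      using th(1) by (simp add: indicator_def sum_of_bool_eq Int_absorb1)
    finally show "(\<Sum>m=1..M. indicator (A m) y :: real) \<le> real L" using th by simp
  qed simp
  finally have sumQ: "(\<Sum>m=1..M. measure (qn n) (A m)) \<le> real L" by (simp add: qn.prob_space)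
  have "(\<Sum>m=1..M. measure (prod_channel W n (\<Psi> m)) (A m)) \<le> (\<Sum>m=1..M. exp \<tau> * measure (qn n) (A m) + T)"
    unfolding T_def using success_prob_le[OF pos(1) comp fin3 A2pos] A by (intro sum_mono) auto
  also have "\<dots> = exp \<tau> * (\<Sum>m=1..M. measure (qn n) (A m)) + real M * T"
    by (simp add: sum.distrib sum_distrib_left)
  also have "\<dots> \<le> exp \<tau> * real L + real M * T" using sumQ by simp
  finally have "(1 / real M) * (\<Sum>m=1..M. measure (prod_channel W n (\<Psi> m)) (A m)) \<le> (1 / real M) * (exp \<tau> * real L + real M * T)"
    by (intro mult_left_mono) auto
  also have "\<dots> = exp \<tau> * (real L / real M) + T" using pos by (simp add: field_simps)
  also have "real L / real M = exp (- (real n * R))"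
    using pos by (simp add: R_def exp_minus ln_div exp_diff)
  also have "exp \<tau> * exp (- (real n * R)) = exp (\<tau> - real n * R)" by (simp add: mult_exp_exp)
  finally have "(1 / real M) * (\<Sum>m=1..M. measure (prod_channel W n (\<Psi> m)) (A m)) \<le> exp (\<tau> - real n * R) + T" .
  moreover have "error_prob W n M \<Psi> \<Theta> = 1 - (1 / real M) * (\<Sum>m=1..M. measure (prod_channel W n (\<Psi> m)) (A m))"
  proof -
    have "error_prob W n M \<Psi> \<Theta> = (1 / real M) * (\<Sum>m=1..M. 1 - measure (prod_channel W n (\<Psi> m)) (A m))"
      unfolding error_prob_def using err by (intro arg_cong[where f = "\<lambda>z. 1 / real M * z"] sum.cong) auto
    then show ?thesis using pos by (simp add: sum_subtractf right_diff_distrib)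
  qed
  ultimately show ?thesis unfolding T_def by linarith
qed

text \<open>The threshold \<tau> balancing the two terms; tail_const is normalised so that the optimum is
  exactly the constant of the theorem.\<close>
lemma list_code_error_ge_optimised:
  fixes n M L :: nat
  assumes pos: "0 < n" "0 < M" "0 < L"
    and code: "is_list_code Y n M L \<Psi> \<Theta>" and comp: "\<And>m. m \<in> {1..M} \<Longrightarrow> has_composition n P (\<Psi> m)"
    and fin3: "abs_moment Y W P \<alpha> 3 < \<infinity>" and A2pos: "0 < A2"
  defines "R \<equiv> ln (real M / real L) / real n"
  defines "\<delta> \<equiv> 1 / (exp 1 * sqrt A2) * (1 / sqrt (2 * pi) + 2 * (0.56 * A3 / A2))"
  shows "1 - 2 * exp \<alpha> * (\<delta> / (\<alpha> - 1)) powr (1 / \<alpha>) * real n powr (- 1 / (2 * \<alpha>)) * exp (- real n * (((\<alpha> - 1) * R - log_Z) / \<alpha>))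
    \<le> error_prob W n M \<Psi> \<Theta>"
proof -
  define \<mu> where "\<mu> = \<alpha> - 1"
  \<comment> \<open>The base of the power in \<open>tail_const\<close> for \<mu> = \<alpha> - 1. The
    root of order \<alpha> returns it, and \<open>\<alpha> / \<mu> * c\<close> is then
    \<open>2 * exp \<alpha>\<close>.\<close>
  define c where "c = 2 * exp \<alpha> * \<mu> / \<alpha>"
  define T where "T = tail_const \<mu> (A3 / A2) / sqrt (real n * A2)"
  have \<mu>: "0 < \<mu>" using \<alpha> by (simp add: \<mu>_def)
  have c: "0 < c" using \<mu> \<alpha> by (simp add: c_def)
  have \<delta>: "0 < \<delta>"
    unfolding \<delta>_def using A2pos A_nonneg by (intro mult_pos_pos add_pos_nonneg) auto
  have T: "T = c powr \<alpha> / \<mu>\<^sup>2 * \<delta> / sqrt (real n)"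
    unfolding T_def tail_const_def \<delta>_def c_def using A2pos
    by (simp add: \<mu>_def real_sqrt_mult exp_minus inverse_eq_divide mult_ac)
  have T0: "0 < T" unfolding T using c \<mu> \<delta> pos by simp
  \<comment> \<open>The zero of the derivative in \<tau>: the first term B becomes \<mu> times the
    second, so the sum is \<open>\<alpha> / \<mu> * B\<close>.\<close>
  define \<tau> where "\<tau> = (ln (\<mu> * T) + real n * (log_Z + R)) / \<alpha>"
  define E where "E = ((\<alpha> - 1) * R - log_Z) / \<alpha>"
  define B where "B = (\<mu> * T) powr (1 / \<alpha>) * exp (- real n * E)"
  have lnmT: "\<alpha> * \<tau> = ln (\<mu> * T) + real n * (log_Z + R)" using \<alpha> by (simp add: \<tau>_def)
  have t1: "exp (\<tau> - real n * R) = B"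
  proof -
    have "\<tau> - real n * R = ln (\<mu> * T) / \<alpha> + (- real n * E)"
      using \<alpha> by (simp add: \<tau>_def E_def field_simps)
    then show ?thesis using \<mu> T0 by (simp add: B_def powr_def mult_exp_exp)
  qed
  have t2: "exp (real n * log_Z - \<mu> * \<tau>) * T = B / \<mu>"
  proof -
    have "real n * log_Z - \<mu> * \<tau> = (\<tau> - real n * R) - ln (\<mu> * T)"
      using lnmT by (simp add: \<mu>_def algebra_simps)
    then have "exp (real n * log_Z - \<mu> * \<tau>) = B / (\<mu> * T)"
      using \<mu> T0 by (simp add: exp_diff t1[symmetric])
    then show ?thesis using T0 by simp
  qed
  have pw: "(\<mu> * T) powr (1 / \<alpha>) = c * (\<delta> / \<mu>) powr (1 / \<alpha>) * real n powr (- 1 / (2 * \<alpha>))"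
  proof -
    have eq: "\<mu> * T = c powr \<alpha> * (\<delta> / \<mu>) * real n powr (- 1 / 2)"
      unfolding T using \<mu> pos by (simp add: power2_eq_square powr_minus_divide powr_half_sqrt)
    have "(\<mu> * T) powr (1 / \<alpha>) = (c powr \<alpha>) powr (1 / \<alpha>) * (\<delta> / \<mu>) powr (1 / \<alpha>) * (real n powr (- 1 / 2)) powr (1 / \<alpha>)"
      unfolding eq powr_mult ..
    also have "(c powr \<alpha>) powr (1 / \<alpha>) = c" using c \<alpha> by (simp add: powr_powr)
    also have "(real n powr (- 1 / 2)) powr (1 / \<alpha>) = real n powr (- 1 / (2 * \<alpha>))" by (simp add: powr_powr)
    finally show ?thesis .
  qed
  have "B + B / \<mu> = \<alpha> / \<mu> * B" using \<mu> by (simp add: \<mu>_def field_simps)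
  also have "\<dots> = \<alpha> / \<mu> * c * ((\<delta> / \<mu>) powr (1 / \<alpha>) * real n powr (- 1 / (2 * \<alpha>)) * exp (- real n * E))"
    unfolding B_def pw by (simp only: mult.assoc)
  also have "\<alpha> / \<mu> * c = 2 * exp \<alpha>" using \<mu> \<alpha> by (simp add: c_def)
  finally have "B + B / \<mu> = 2 * exp \<alpha> * (\<delta> / \<mu>) powr (1 / \<alpha>) * real n powr (- 1 / (2 * \<alpha>)) * exp (- real n * E)"
    by (simp only: mult.assoc)
  moreover have "1 - (exp (\<tau> - real n * R) + exp (real n * log_Z - \<mu> * \<tau>) * T) \<le> error_prob W n M \<Psi> \<Theta>"
    using list_code_error_ge[OF pos code comp fin3 A2pos, of \<tau>] by (simp add: R_def T_def \<mu>_def)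
  ultimately show ?thesis unfolding t1 t2 by (simp add: E_def \<mu>_def)
qed

end

theorem theorem1:
  fixes Y :: "'b measure" and W :: "'a \<Rightarrow> 'b measure" and P :: "'a pmf"
    and M L n :: nat and Llim :: ereal
  assumes chan: "is_channel Y W"
    and pos: "0 < M" "0 < L" "0 < n"
    and finP: "finite (set_pmf P)"
    and typeP: "\<forall>x. \<exists>k::nat. real n * pmf P x = real k"
    and lower: "augustin_info Y W P 1 < ereal (ln (real M / real L) / real n)"
    and lim: "((\<lambda>\<alpha>. augustin_info Y (tilted_channel Y W P \<alpha>) P 1) \<longlongrightarrow> Llim) at_top"
    and upper: "ereal (ln (real M / real L) / real n) < Llim"
    and a2pos: "let \<alpha>s = 1 / (1 - deriv (E_sc Y W P) (ln (real M / real L) / real n))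
                in 0 < abs_moment Y W P \<alpha>s 2 \<and> abs_moment Y W P \<alpha>s 2 < \<infinity>"
  shows "let R = ln (real M / real L) / real n;
             \<alpha>s = 1 / (1 - deriv (E_sc Y W P) R);
             a2 = enn2real (abs_moment Y W P \<alpha>s 2);
             a3 = enn2real (abs_moment Y W P \<alpha>s 3);
             \<delta> = 1 / (exp 1 * sqrt a2) * (1 / sqrt (2 * pi) + 2 * (0.56 * a3 / a2))
         in E_sc Y W P differentiable (at R)
          \<and> \<alpha>s \<in> {1<..}
          \<and> augustin_info Y (tilted_channel Y W P \<alpha>s) P 1 = ereal R
          \<and> (abs_moment Y W P \<alpha>s 3 < \<infinity> \<longrightarrow>
              (\<forall>\<Psi> \<Theta>. is_list_code Y n M L \<Psi> \<Theta> \<and> (\<forall>m\<in>{1..M}. has_composition n P (\<Psi> m)) \<longrightarrow>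
                 error_prob W n M \<Psi> \<Theta> \<ge>
                   1 - 2 * exp \<alpha>s * (\<delta> / (\<alpha>s - 1)) powr (1 / \<alpha>s)
                       * real n powr (- 1 / (2 * \<alpha>s)) * exp (- real n * E_sc Y W P R)))"
proof -
  define R where "R = ln (real M / real L) / real n"
  interpret channel_input Y W P
    using chan finP unfolding is_channel_def by (intro channel_input.intro) blast+
  have opt: "\<exists>\<alpha>>1. tilted_info \<alpha> = R \<and> E_sc Y W P R = ((\<alpha> - 1) * R - J \<alpha>) / \<alpha>
      \<and> (E_sc Y W P has_real_derivative ((\<alpha> - 1) / \<alpha>)) (at R)"
    by (rule ex_optimal_order[OF lower[folded R_def] lim upper[folded R_def]])
  obtain \<alpha>s where \<alpha>s: "1 < \<alpha>s" "tilted_info \<alpha>s = R" and E: "E_sc Y W P R = ((\<alpha>s - 1) * R - J \<alpha>s) / \<alpha>s"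
    and D: "(E_sc Y W P has_real_derivative ((\<alpha>s - 1) / \<alpha>s)) (at R)"
    using opt by blast
  \<comment> \<open>The derivative is 1 - 1 / \<alpha>s, so the expression in the statement recovers
    \<alpha>s.\<close>
  have d: "1 / (1 - deriv (E_sc Y W P) R) = \<alpha>s"
  proof -
    have "1 - (\<alpha>s - 1) / \<alpha>s = 1 / \<alpha>s" using \<alpha>s by (simp add: field_simps)
    then show ?thesis by (simp add: DERIV_imp_deriv[OF D])
  qed
  have diff: "E_sc Y W P differentiable (at R)"
    using D real_differentiable_def by blast
  have info: "augustin_info Y (tilted_channel Y W P \<alpha>s) P 1 = ereal R"
    unfolding augustin_info_tilted[OF \<alpha>s(1)] \<alpha>s(2) ..
  interpret m: channel_mean Y W P \<alpha>s "augustin_mean Y W P \<alpha>s" by (rule channel_mean[OF \<alpha>s(1)])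
  have a2pos': "0 < abs_moment Y W P \<alpha>s 2" using a2pos unfolding Let_def R_def[symmetric] d by (rule conjunct1)
  have code: "1 - 2 * exp \<alpha>s * (1 / (exp 1 * sqrt (enn2real (abs_moment Y W P \<alpha>s 2))) *
        (1 / sqrt (2 * pi) + 2 * (0.56 * enn2real (abs_moment Y W P \<alpha>s 3) / enn2real (abs_moment Y W P \<alpha>s 2))) / (\<alpha>s - 1)) powr (1 / \<alpha>s)
      * real n powr (- 1 / (2 * \<alpha>s)) * exp (- real n * E_sc Y W P R) \<le> error_prob W n M \<Psi> \<Theta>"
    if fin3: "abs_moment Y W P \<alpha>s 3 < \<infinity>" and c: "is_list_code Y n M L \<Psi> \<Theta>" "\<And>m. m \<in> {1..M} \<Longrightarrow> has_composition n P (\<Psi> m)" for \<Psi> \<Theta>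
  proof -
    note am = m.abs_moments[OF fin3]
    have A2: "0 < m.A2" using a2pos' unfolding am(1) by (simp only: ennreal_less_zero_iff)
    have e2: "enn2real (abs_moment Y W P \<alpha>s 2) = m.A2" and e3: "enn2real (abs_moment Y W P \<alpha>s 3) = m.A3"
      unfolding am using m.A_nonneg by (simp_all only: enn2real_ennreal)
    show ?thesis
      unfolding e2 e3 E J_eq[OF \<alpha>s(1)] unfolding R_def
      by (rule m.list_code_error_ge_optimised[OF pos(3,1,2) c fin3 A2])
  qed
  show ?thesis
    unfolding Let_def R_def[symmetric] d
  proof (intro conjI impI allI)
    show "E_sc Y W P differentiable (at R)" by (rule diff)
    show "\<alpha>s \<in> {1<..}" using \<alpha>s(1) by simp
    show "augustin_info Y (tilted_channel Y W P \<alpha>s) P 1 = ereal R" by (rule info)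
  qed (rule code; blast)
qed

end
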